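(* Let $M,N,P,Q$ be finite dimensional $C^*$-algebras and let $\Phi\colon M\to P$ and $\Psi\colon N\to Q$ be positive unital trace preserving linear maps such that $\Phi\otimes\Psi\colon M\otimes N\to P\otimes Q$ is positive. Let $(e_i)$ be a finite family of projections in $M$ with $\sum_i e_i=1$ and $(f_j)$ a finite family of projections in $N$ with $\sum_j f_j=1$, such that all $\Phi(e_i)$ and all $\Psi(f_j)$ are projections. Let $$\Phi_i=\Phi|_{e_iMe_i}\colon e_iMe_i\to\Phi(e_i)P\Phi(e_i),\qquad \Psi_j=\Psi|_{f_jNf_j}\colon f_jNf_j\to\Psi(f_j)Q\Psi(f_j).$$ Suppose $C(\Phi_i\otimes\Psi_j)=C(\Phi_i)+C(\Psi_j)$ for all $i,j$. Then $$C(\Phi\otimes\Psi)=C(\Phi)+C(\Psi),$$ where $C(\cdot)$ denotes capacity.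
   Context: For a finite dimensional $C^*$-algebra $P$, $\mathrm{Tr}_P$ denotes the trace on $P$ taking the value $1$ at each minimal projection of $P$. A linear map $\Phi\colon M\to P$ between finite dimensional $C^*$-algebras is trace preserving if $\mathrm{Tr}_P(\Phi(x))=\mathrm{Tr}_M(x)$ for all $x\in M$. "Positive" means that positive elements are mapped to positive elements (complete positivity is not assumed). Let $\eta(t)=-t\log t$ for $t>0$ and $\eta(0)=0$, with $\log$ the natural logarithm. The entropy of a positive operator $a\in P$ is $S(a)=\mathrm{Tr}_P(\eta(a))$. Capacity: for a positive unital trace preserving map $\Phi\colon M\to P$, let $C$ be the set of positive $a\in M$ with $\mathrm{Tr}_M(a)=1$. For $a\in C$ put $$C(\Phi,a)=\sup\Big( S(\Phi(a))-\sum_i\lambda_iS(\Phi(a_i))\Big),$$ the supremum being over all (finite) convex combinations $\sum_i\lambda_ia_i=a$ with $a_i\in C$, $\lambda_i\ge0$, $\sum_i\lambda_i=1$. The capacity of $\Phi$ is $C(\Phi)=\sup_{a\in C}C(\Phi,a)$. For a projection $e\in M$, the algebra $eMe$ is a finite dimensional $C^*$-algebra with unit $e$; the maps $\Phi_i$, $\Psi_j$ and $\Phi_i\otimes\Psi_j\colon e_iMe_i\otimes f_jNf_j\to \Phi(e_i)P\Phi(e_i)\otimes\Psi(f_j)Q\Psi(f_j)$ are positive unital trace preserving maps between such algebras. *)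

theory Defs
  imports Complex_Main "HOL-Library.Extended_Real"
begin

text \<open>A finite dimensional C*-algebra always has a unit, so taking \<open>1\<close> as part of the signature
  loses nothing. The zero algebra (\<open>1 = 0\<close>) is not excluded.\<close>

class cstar_algebra = real_normed_algebra + banach + monoid_mult +
  fixes scaleC :: "complex \<Rightarrow> 'a \<Rightarrow> 'a"  (infixr "*\<^sub>C" 75)
    and star :: "'a \<Rightarrow> 'a"
  assumes scaleC_add_right: "c *\<^sub>C (x + y) = c *\<^sub>C x + c *\<^sub>C y"
    and scaleC_add_left: "(c + d) *\<^sub>C x = c *\<^sub>C x + d *\<^sub>C x"
    and scaleC_scaleC: "c *\<^sub>C d *\<^sub>C x = (c * d) *\<^sub>C x"
    and scaleC_one: "1 *\<^sub>C x = x"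
    and scaleR_scaleC: "r *\<^sub>R x = complex_of_real r *\<^sub>C x"
    and mult_scaleC_left: "(c *\<^sub>C x) * y = c *\<^sub>C (x * y)"
    and mult_scaleC_right: "x * (c *\<^sub>C y) = c *\<^sub>C (x * y)"
    and norm_scaleC: "norm (c *\<^sub>C x) = cmod c * norm x"
    and star_add: "star (x + y) = star x + star y"
    and star_scaleC: "star (c *\<^sub>C x) = cnj c *\<^sub>C star x"
    and star_mult: "star (x * y) = star y * star x"
    and star_star: "star (star x) = x"
    and norm_star_mult: "norm (star x * x) = (norm x)\<^sup>2"

class fd_cstar_algebra = cstar_algebra +
  assumes finite_dimensional: "\<exists>B. finite B \<and> (\<forall>x. \<exists>c. x = (\<Sum>b\<in>B. c b *\<^sub>C b))"

lemma vector_space_scaleC: "vector_space (scaleC :: complex \<Rightarrow> 'a::cstar_algebra \<Rightarrow> 'a)"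
  by unfold_locales
    (simp_all add: scaleC_add_right scaleC_add_left scaleC_scaleC scaleC_one)

instantiation complex :: fd_cstar_algebra
begin

definition scaleC_complex :: "complex \<Rightarrow> complex \<Rightarrow> complex" where
  "scaleC_complex c x = c * x"

definition star_complex :: "complex \<Rightarrow> complex" where
  "star_complex = cnj"

instance
proof
  show "\<exists>B::complex set. finite B \<and> (\<forall>x. \<exists>c. x = (\<Sum>b\<in>B. c b *\<^sub>C b))"
    by (rule exI[of _ "{1}"]) (auto simp: scaleC_complex_def)
qed (simp_all add: scaleC_complex_def star_complex_def algebra_simps scaleR_conv_of_real
    norm_mult power2_eq_square)

end

text \<open>All algebras below are *-subalgebras \<open>A\<close> of an ambient type, so that corners \<open>eMe\<close>, whose
  unit is \<open>e\<close>, are covered; a full algebra is \<open>UNIV\<close>.\<close>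

definition corner :: "'a::cstar_algebra \<Rightarrow> 'a set" where
  "corner e = {e * x * e | x. True}"

definition is_projection :: "'a::cstar_algebra \<Rightarrow> bool" where
  "is_projection p \<longleftrightarrow> star p = p \<and> p * p = p"

definition minimal_projection_in :: "'a::cstar_algebra set \<Rightarrow> 'a \<Rightarrow> bool" where
  "minimal_projection_in A p \<longleftrightarrow> p \<in> A \<and> is_projection p \<and> p \<noteq> 0 \<and>
     (\<forall>q\<in>A. is_projection q \<and> q * p = q \<longrightarrow> q = 0 \<or> q = p)"

definition positive_in :: "'a::cstar_algebra set \<Rightarrow> 'a \<Rightarrow> bool" where
  "positive_in A a \<longleftrightarrow> (\<exists>b\<in>A. a = star b * b)"

definition clinear_on :: "'a::cstar_algebra set \<Rightarrow> ('a \<Rightarrow> 'b::cstar_algebra) \<Rightarrow> bool" where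
  "clinear_on A F \<longleftrightarrow> (\<forall>x\<in>A. \<forall>y\<in>A. F (x + y) = F x + F y) \<and>
     (\<forall>c. \<forall>x\<in>A. F (c *\<^sub>C x) = c *\<^sub>C F x)"

text \<open>On a finite dimensional \<open>A\<close> the functional chosen here exists and its values on \<open>A\<close> are
  uniquely determined; its values off \<open>A\<close> are irrelevant.\<close>

definition Tr :: "'a::cstar_algebra set \<Rightarrow> 'a \<Rightarrow> complex" where
  "Tr A = (SOME \<tau>. clinear_on A \<tau> \<and> (\<forall>x\<in>A. \<forall>y\<in>A. \<tau> (x * y) = \<tau> (y * x)) \<and>
     (\<forall>p. minimal_projection_in A p \<longrightarrow> \<tau> p = 1))"

text \<open>Functional calculus for a self-adjoint \<open>a \<in> A\<close>: if \<open>a = (\<Sum>\<lambda>. \<lambda> p\<^sub>\<lambda>)\<close> with mutually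
  orthogonal projections \<open>p\<^sub>\<lambda> \<in> A\<close> summing up to the unit of \<open>A\<close>, then \<open>h(a) = (\<Sum>\<lambda>. h(\<lambda>) p\<^sub>\<lambda>)\<close>.\<close>

definition fun_calc :: "'a::cstar_algebra set \<Rightarrow> (real \<Rightarrow> real) \<Rightarrow> 'a \<Rightarrow> 'a" where
  "fun_calc A h a = (THE b. \<exists>\<Lambda> p. finite \<Lambda> \<and>
     (\<forall>l\<in>\<Lambda>. p l \<in> A \<and> is_projection (p l)) \<and>
     (\<forall>l\<in>\<Lambda>. \<forall>m\<in>\<Lambda>. l \<noteq> m \<longrightarrow> p l * p m = 0) \<and>
     (\<forall>x\<in>A. (\<Sum>l\<in>\<Lambda>. p l) * x = x) \<and>
     a = (\<Sum>l\<in>\<Lambda>. l *\<^sub>R p l) \<and>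
     b = (\<Sum>l\<in>\<Lambda>. h l *\<^sub>R p l))"

definition eta :: "real \<Rightarrow> real" where
  "eta t = (if t > 0 then - t * ln t else 0)"

text \<open>The trace of the self-adjoint element \<open>\<eta>(a)\<close> is real.\<close>

definition entropy :: "'a::cstar_algebra set \<Rightarrow> 'a \<Rightarrow> real" where
  "entropy A a = Re (Tr A (fun_calc A eta a))"

definition positive_map_on ::
  "'a::cstar_algebra set \<Rightarrow> 'b::cstar_algebra set \<Rightarrow> ('a \<Rightarrow> 'b) \<Rightarrow> bool" where
  "positive_map_on A B \<Phi> \<longleftrightarrow> \<Phi> ` A \<subseteq> B \<and> clinear_on A \<Phi> \<and>
     (\<forall>a. positive_in A a \<longrightarrow> positive_in B (\<Phi> a))"

definition trace_preserving_on ::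
  "'a::cstar_algebra set \<Rightarrow> 'b::cstar_algebra set \<Rightarrow> ('a \<Rightarrow> 'b) \<Rightarrow> bool" where
  "trace_preserving_on A B \<Phi> \<longleftrightarrow> (\<forall>x\<in>A. Tr B (\<Phi> x) = Tr A x)"

definition states :: "'a::cstar_algebra set \<Rightarrow> 'a set" where
  "states A = {a. positive_in A a \<and> Tr A a = 1}"

text \<open>Suprema are taken in the extended reals. They are bounded above by finite dimensionality;
  the zero algebra has no states, so maps on it (e.g. on \<open>corner 0\<close>) have capacity \<open>-\<infinity>\<close>.\<close>

definition capacity_at ::
  "'a::cstar_algebra set \<Rightarrow> 'b::cstar_algebra set \<Rightarrow> ('a \<Rightarrow> 'b) \<Rightarrow> 'a \<Rightarrow> ereal" where
  "capacity_at A B \<Phi> a =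
     Sup {ereal (entropy B (\<Phi> a) - (\<Sum>i<n. l i * entropy B (\<Phi> (x i)))) | (n::nat) l x.
       (\<forall>i<n. 0 \<le> l i \<and> x i \<in> states A) \<and> (\<Sum>i<n. l i) = 1 \<and> (\<Sum>i<n. l i *\<^sub>R x i) = a}"

definition capacity ::
  "'a::cstar_algebra set \<Rightarrow> 'b::cstar_algebra set \<Rightarrow> ('a \<Rightarrow> 'b) \<Rightarrow> ereal" where
  "capacity A B \<Phi> = (SUP a\<in>states A. capacity_at A B \<Phi> a)"

definition cbilinear ::
  "('a::cstar_algebra \<Rightarrow> 'b::cstar_algebra \<Rightarrow> 'c::cstar_algebra) \<Rightarrow> bool" where
  "cbilinear t \<longleftrightarrow> (\<forall>x. clinear_on UNIV (t x)) \<and> (\<forall>y. clinear_on UNIV (\<lambda>x. t x y))"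

text \<open>\<open>tensor_product t\<close>: the type \<open>'c\<close>, with \<open>t x y\<close> as \<open>x \<otimes> y\<close>, is the tensor product of the
  *-algebras \<open>'a\<close> and \<open>'b\<close>. In finite dimension it suffices to state the universal property for
  bilinear forms (apply it to coordinates), and the C*-norm on the tensor product is unique.\<close>

definition tensor_product ::
  "('a::fd_cstar_algebra \<Rightarrow> 'b::fd_cstar_algebra \<Rightarrow> 'c::fd_cstar_algebra) \<Rightarrow> bool" where
  "tensor_product t \<longleftrightarrow> cbilinear t \<and> t 1 1 = 1 \<and>
     (\<forall>x y x' y'. t x y * t x' y' = t (x * x') (y * y')) \<and>
     (\<forall>x y. star (t x y) = t (star x) (star y)) \<and>
     (\<forall>\<beta> :: 'a \<Rightarrow> 'b \<Rightarrow> complex. cbilinear \<beta> \<longrightarrow>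
        (\<exists>!\<phi>. clinear_on UNIV \<phi> \<and> (\<forall>x y. \<phi> (t x y) = \<beta> x y)))"

definition tensor_set ::
  "('a::cstar_algebra \<Rightarrow> 'b::cstar_algebra \<Rightarrow> 'c::cstar_algebra) \<Rightarrow> 'a set \<Rightarrow> 'b set \<Rightarrow> 'c set"
  where "tensor_set t A B = module.span scaleC {t x y | x y. x \<in> A \<and> y \<in> B}"

text \<open>The linear map \<open>\<Phi> \<otimes> \<Psi>\<close> on \<open>A \<otimes> B\<close>; only its values on \<open>tensor_set s A B\<close>, where it is
  unique, matter.\<close>

definition tensor_map ::
  "('a::cstar_algebra \<Rightarrow> 'b::cstar_algebra \<Rightarrow> 'c::cstar_algebra) \<Rightarrow>
   ('d::cstar_algebra \<Rightarrow> 'e::cstar_algebra \<Rightarrow> 'f::cstar_algebra) \<Rightarrow>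
   'a set \<Rightarrow> 'b set \<Rightarrow> ('a \<Rightarrow> 'd) \<Rightarrow> ('b \<Rightarrow> 'e) \<Rightarrow> 'c \<Rightarrow> 'f" where
  "tensor_map s t A B \<Phi> \<Psi> = (SOME F. clinear_on (tensor_set s A B) F \<and>
     (\<forall>x\<in>A. \<forall>y\<in>B. F (s x y) = t (\<Phi> x) (\<Psi> y)))"

end

theory Submission
  imports Defs "HOL-Computational_Algebra.Fundamental_Theorem_Algebra"
begin

text \<open>The capacity of a positive unital trace preserving map \<open>\<Phi>\<close> with projections \<open>\<Phi>(e\<^sub>i)\<close>,
  \<open>\<Sum> e\<^sub>i = 1\<close>, satisfies \<open>exp C(\<Phi>) = \<Sum> exp C(\<Phi>\<^sub>i)\<close>. As \<open>C(\<Phi>\<^sub>i \<otimes> \<Psi>\<^sub>j) = C(\<Phi>\<^sub>i) + C(\<Psi>\<^sub>j)\<close>,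
  the sum of exponentials for \<open>\<Phi> \<otimes> \<Psi>\<close> and the projections \<open>e\<^sub>i \<otimes> f\<^sub>j\<close> is the product of
  the sums for \<open>\<Phi>\<close> and \<open>\<Psi>\<close>.

  For the formula, write \<open>q\<^sub>i = \<Phi>(e\<^sub>i)\<close> and \<open>N(b) = S(b) - \<eta>(Tr b)\<close>. With \<open>x\<^sub>m = \<lambda>\<^sub>m a\<^sub>m\<close> the
  quantity whose supremum is the capacity is \<open>N(\<Phi>(\<Sum> x\<^sub>m)) - \<Sum> N(\<Phi>(x\<^sub>m))\<close>. Three facts give the
  upper bound: pinching increases the entropy, \<open>S(b) \<le> \<Sum> S(q\<^sub>i b q\<^sub>i)\<close>; an ideal measurement
  decreases it on average, \<open>\<Sum> N(q\<^sub>i b q\<^sub>i) \<le> N(b)\<close>, since for \<open>b = y\<^sup>* y\<close> the operators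
  \<open>q\<^sub>i b q\<^sub>i\<close> are equivalent to \<open>y q\<^sub>i y\<^sup>*\<close>, which sum up to \<open>y y\<^sup>*\<close>, and \<open>N\<close> is superadditive; and
  \<open>q\<^sub>i \<Phi>(x) q\<^sub>i = \<Phi>(e\<^sub>i x e\<^sub>i)\<close>. They leave \<open>\<Sum> (\<eta>(p\<^sub>i) + p\<^sub>i C(\<Phi>\<^sub>i))\<close> for a probability vector \<open>p\<close>,
  whose maximum is \<open>log \<Sum> exp C(\<Phi>\<^sub>i)\<close>, and orthogonal sums of ensembles attain it.\<close>

text \<open>Complete positivity is not assumed, so no Kraus or Stinespring form of \<Phi> is
  available. The compression identity is derived instead from positivity of \<Phi> on a
  one-parameter family of positive elements, whose images are compressed by the projection
  \<open>\<Phi> e\<close>. The algebras are abstract, without matrix units or a Hilbert space, and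
  \<open>Tr\<close> and \<open>fun_calc\<close> are given by description operators. Minimal
  projections take over the role of rank-one projections: an orthogonal family of them with sum 1
  replaces an orthonormal basis. Existence of the trace, non-negativity of the eigenvalues of
  \<open>star b * b\<close> and multiplicativity of the trace on tensor products all rest on the
  fact that \<open>p * x * p\<close> is a multiple of \<open>p\<close> for minimal \<open>p\<close>.
  Superadditivity of N becomes the scalar log sum inequality once everything is written in an
  eigenframe of the total operator. The formula is kept in exponential form because some
  \<open>e i\<close> may be 0: the capacity is then \<open>- \<infinity>\<close> and its exponential
  is a harmless 0. Going back from exponentials to capacities requires that no capacity is
  \<open>\<infinity>\<close>.\<close>

interpretation cvs: vector_space "scaleC :: complex \<Rightarrow> 'a \<Rightarrow> 'a::cstar_algebra"
  by (rule vector_space_scaleC)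

section \<open>Involution, projections and corners\<close>

lemma star_0 [simp]: "star (0::'a::cstar_algebra) = 0"
  using star_add[of "0::'a" 0] by simp

lemma star_1 [simp]: "star (1::'a::cstar_algebra) = 1"
  by (metis mult_1_right star_mult star_star)

declare star_star [simp]

lemma star_uminus: "star (- x) = - star (x::'a::cstar_algebra)"
  by (metis add.right_inverse add_eq_0_iff2 star_0 star_add)

lemma star_diff: "star (x - y) = star x - star (y::'a::cstar_algebra)"
  by (metis add_uminus_conv_diff star_add star_uminus)

lemma star_sum: "star (\<Sum>i\<in>I. f i) = (\<Sum>i\<in>I. star (f i :: 'a::cstar_algebra))"
  by (induction I rule: infinite_finite_induct) (simp_all add: star_add)

lemma star_scaleR: "star (r *\<^sub>R x) = r *\<^sub>R star (x::'a::cstar_algebra)"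
  by (simp add: scaleR_scaleC star_scaleC)

lemma star_mult_self_eq_0_iff [simp]: "star x * x = 0 \<longleftrightarrow> (x::'a::cstar_algebra) = 0"
  using norm_star_mult[of x] by auto

lemma selfadjoint_decomp:
  fixes x :: "'a::cstar_algebra"
  obtains h k where "star h = h" "star k = k" "x = h + \<i> *\<^sub>C k"
    "h = (1/2) *\<^sub>R (x + star x)" "k = (- \<i>/2) *\<^sub>C (x - star x)"
proof
  show "star ((1/2) *\<^sub>R (x + star x)) = (1/2) *\<^sub>R (x + star x)"
    by (simp add: star_scaleR star_add add.commute)
  have "star ((- \<i>/2) *\<^sub>C (x - star x)) = (\<i>/2) *\<^sub>C (star x - x)"
    by (simp add: star_scaleC star_diff star_uminus)
  then show "star ((- \<i>/2) *\<^sub>C (x - star x)) = (- \<i>/2) *\<^sub>C (x - star x)"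
    by (simp add: cvs.scale_right_diff_distrib cvs.scale_minus_left)
  show "x = (1/2) *\<^sub>R (x + star x) + \<i> *\<^sub>C (- \<i>/2) *\<^sub>C (x - star x)"
    by (simp add: scaleR_scaleC cvs.scale_right_diff_distrib cvs.scale_right_distrib
        flip: cvs.scale_left_distrib)
qed (rule refl)+

lemma is_projection_0 [simp]: "is_projection 0"
  and is_projection_1 [simp]: "is_projection 1"
  by (simp_all add: is_projection_def)

lemma is_projectionD:
  assumes "is_projection p" shows "star p = p" "p * p = p" "p * (p * x) = p * x"
  using assms by (simp_all add: is_projection_def flip: mult.assoc)

lemma projection_le_sym:
  assumes "is_projection p" "is_projection r"
  shows "p * r = p \<longleftrightarrow> r * p = p"
  by (metis assms is_projection_def star_mult)

lemma projection_orth_sym: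
  assumes "is_projection p" "is_projection r" "p * r = 0"
  shows "r * p = 0"
  by (metis assms is_projection_def star_mult star_0)

lemma is_projection_diff:
  assumes "is_projection p" "is_projection r" "p * r = p"
  shows "is_projection (r - p)"
  using assms projection_le_sym[OF assms(1,2)]
  by (simp add: is_projection_def star_diff algebra_simps)

lemma is_projection_compl: "is_projection p \<Longrightarrow> is_projection (1 - p)"
  by (simp add: is_projection_diff)

lemma is_projection_sum:
  assumes "finite R" "\<And>r. r \<in> R \<Longrightarrow> is_projection (f r)"
    and "\<And>r s. r \<in> R \<Longrightarrow> s \<in> R \<Longrightarrow> r \<noteq> s \<Longrightarrow> f r * f s = 0"
  shows "is_projection (\<Sum>r\<in>R. f r)"
proof -
  have "(\<Sum>s\<in>R. f r * f s) = f r" if "r \<in> R" for r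
  proof -
    have "(\<Sum>s\<in>R. f r * f s) = (\<Sum>s\<in>R. if s = r then f r else 0)"
      using assms that by (intro sum.cong) (auto simp: is_projection_def)
    then show ?thesis using assms(1) that by simp
  qed
  then show ?thesis using assms(2)
    by (simp add: is_projection_def star_sum sum_distrib_left sum_distrib_right sum.swap[of _ R R])
qed

lemma corner_iff:
  assumes "is_projection q"
  shows "x \<in> corner q \<longleftrightarrow> q * x = x \<and> x * q = x"
proof
  assume "x \<in> corner q"
  then show "q * x = x \<and> x * q = x"
    using assms by (auto simp: corner_def is_projection_def mult.assoc)
      (simp_all flip: mult.assoc)
next
  assume "q * x = x \<and> x * q = x"
  then show "x \<in> corner q"
    by (auto simp: corner_def intro!: exI[of _ x])
qed

lemma corner_one [simp]: "corner 1 = UNIV"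
  by (auto simp: corner_def)

lemma compress_in_corner: "q * x * q \<in> corner q"
  by (auto simp: corner_def)

lemma subspace_corner: "cvs.subspace (corner (q::'a::cstar_algebra))"
proof (rule cvs.subspaceI)
  show "0 \<in> corner q"
    by (auto simp: corner_def intro!: exI[of _ 0])
  show "x + y \<in> corner q" if "x \<in> corner q" "y \<in> corner q" for x y
    using that by (auto simp: corner_def) (metis distrib_left distrib_right)
  show "c *\<^sub>C x \<in> corner q" if "x \<in> corner q" for c x
    using that by (auto simp: corner_def) (metis mult_scaleC_left mult_scaleC_right)
qed

lemma corner_star: "is_projection q \<Longrightarrow> x \<in> corner q \<Longrightarrow> star x \<in> corner q"
  unfolding corner_iff by (metis is_projection_def star_mult)

lemma corner_trans:
  assumes "is_projection p" "is_projection q" "p \<in> corner q" "x \<in> corner p"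
  shows "x \<in> corner q"
  using assms by (metis corner_iff mult.assoc)

lemma scaleR_in_corner: "x \<in> corner q \<Longrightarrow> c *\<^sub>R x \<in> corner q"
  by (simp add: scaleR_scaleC cvs.subspace_scale subspace_corner)

lemma corner_0: "corner 0 = {0}"
  by (auto simp: corner_def)

section \<open>The spectral theorem\<close>

lemma finite_spanning_set:
  obtains B :: "'a::fd_cstar_algebra set" where "finite B" "cvs.span B = UNIV"
proof -
  obtain B :: "'a set" where B: "finite B" "\<forall>x. \<exists>c. x = (\<Sum>b\<in>B. c b *\<^sub>C b)"
    using finite_dimensional by blast
  have "UNIV \<subseteq> cvs.span B"
  proof
    fix x
    obtain c where "x = (\<Sum>b\<in>B. c b *\<^sub>C b)" using B by blast
    then show "x \<in> cvs.span B"
      by (auto intro: cvs.span_sum cvs.span_scale cvs.span_base)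
  qed
  then show ?thesis using that B by blast
qed

text \<open>The family is indexed because powers of one element may coincide; two equal members give
  the relation with coefficients 1 and -1.\<close>

lemma linear_dependence:
  fixes v :: "nat \<Rightarrow> 'a::fd_cstar_algebra"
  obtains n c where "\<exists>i\<le>n. c i \<noteq> 0" "(\<Sum>i\<le>n. c i *\<^sub>C v i) = 0"
proof -
  obtain B :: "'a set" where B: "finite B" and span: "\<And>S. S \<subseteq> cvs.span B"
    by (rule finite_spanning_set) blast
  let ?n = "card B"
  show ?thesis
  proof (cases "inj_on v {..?n}")
    case True
    have "cvs.dependent (v ` {..?n})"
    proof (rule ccontr)
      assume "cvs.independent (v ` {..?n})"
      then have "card (v ` {..?n}) \<le> ?n"
        using cvs.independent_span_bound[OF B _ span] by blast
      then show False by (simp add: card_image[OF True])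
    qed
    then obtain u where "\<exists>w\<in>v ` {..?n}. u w \<noteq> 0" "(\<Sum>w\<in>v ` {..?n}. u w *\<^sub>C w) = 0"
      by (subst (asm) cvs.dependent_finite) auto
    then show ?thesis
      by (intro that[of ?n "u \<circ> v"]) (auto simp: sum.reindex[OF True] o_def)
  next
    case False
    then obtain i j where ij: "i \<le> ?n" "j \<le> ?n" "i \<noteq> j" "v i = v j"
      by (auto simp: inj_on_def)
    have "(\<Sum>k\<le>?n. (if k = i then 1 else if k = j then -1 else 0) *\<^sub>C v k) =
      (\<Sum>k\<le>?n. (if k = i then v i else 0) - (if k = j then v j else 0))"
      using ij by (intro sum.cong) (auto simp: scaleC_one)
    also have "\<dots> = 0"
      using ij by (simp add: sum_subtractf)
    finally show ?thesis
      by (rule that[rotated]) (use ij in auto)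
  qed
qed

text \<open>The polynomial \<open>p\<close> evaluated at \<open>a\<close> in a corner with unit
  \<open>q\<close>: the factor \<open>q\<close> makes the constant term a multiple of that unit
  instead of 1.\<close>

definition ev :: "'a::cstar_algebra \<Rightarrow> 'a \<Rightarrow> complex poly \<Rightarrow> 'a" where
  "ev a q p = (\<Sum>i\<le>degree p. coeff p i *\<^sub>C (a ^ i * q))"

lemma ev_altdef: "degree p \<le> n \<Longrightarrow> ev a q p = (\<Sum>i\<le>n. coeff p i *\<^sub>C (a ^ i * q))"
  unfolding ev_def by (rule sum.mono_neutral_left) (auto simp: coeff_eq_0)

lemma ev_0 [simp]: "ev a q 0 = 0"
  by (simp add: ev_def)

lemma ev_pCons: "ev a q (pCons c p) = c *\<^sub>C q + a * ev a q p"
proof -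
  have "ev a q (pCons c p) = (\<Sum>i\<le>Suc (degree p). coeff (pCons c p) i *\<^sub>C (a ^ i * q))"
    by (intro ev_altdef degree_pCons_le)
  then show ?thesis
    unfolding sum.atMost_Suc_shift
    by (simp add: ev_def sum_distrib_left mult_scaleC_right mult.assoc)
qed

lemma ev_add: "ev a q (p + p') = ev a q p + ev a q p'"
proof -
  define n where "n = max (degree p) (degree p')"
  have n: "degree p \<le> n" "degree p' \<le> n" "degree (p + p') \<le> n"
    by (simp_all add: n_def degree_add_le_max)
  show ?thesis
    by (simp add: n[THEN ev_altdef] cvs.scale_left_distrib sum.distrib)
qed

lemma ev_smult: "ev a q (smult c p) = c *\<^sub>C ev a q p"
  using ev_altdef[of "smult c p" "degree p"]
  by (simp add: ev_def cvs.scale_sum_right)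

text \<open>A polynomial annihilating \<open>a\<close> exists by dimension, and a root
  \<open>\<mu>\<close> of one of least degree yields \<open>x \<noteq> 0\<close> with
  \<open>a * x = \<mu> *\<^sub>C x\<close>. As \<open>x\<close> is a polynomial in the self-adjoint
  \<open>a\<close>, \<open>star x * x\<close> is a multiple of \<open>x\<close>, so its square is a
  multiple of itself and rescaling gives a projection.\<close>

lemma eigenprojection:
  fixes a q :: "'a::fd_cstar_algebra"
  assumes q: "is_projection q" "q \<noteq> 0" and a: "star a = a" "a \<in> corner q"
  obtains r and c :: real
  where "is_projection r" "r \<noteq> 0" "r \<in> corner q" "a * r = c *\<^sub>R r"
proof -
  have aq: "q * a = a" "a * q = a" using a q by (auto simp: corner_iff)
  have qq: "q * q = q" "star q = q" using q by (auto simp: is_projection_def)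
  obtain n c where c: "\<exists>i\<le>n. c i \<noteq> 0" "(\<Sum>i\<le>n. c i *\<^sub>C (a ^ i * q)) = 0"
    using linear_dependence[of "\<lambda>i. a ^ i * q"] by blast
  define p0 where "p0 = (\<Sum>i\<le>n. monom (c i) i)"
  have p0c: "coeff p0 k = (if k \<le> n then c k else 0)" for k
    by (simp add: p0_def coeff_sum if_distrib cong: if_cong)
  then have "degree p0 \<le> n" by (intro degree_le) auto
  then have "ev a q p0 = 0"
    using c(2) by (simp add: ev_altdef[of p0 n] p0c)
  moreover have "p0 \<noteq> 0"
    using c(1) p0c by (metis coeff_0)
  ultimately obtain p where p: "p \<noteq> 0" "ev a q p = 0"
    and min: "\<And>p'. p' \<noteq> 0 \<Longrightarrow> ev a q p' = 0 \<Longrightarrow> degree p \<le> degree p'"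
    using ex_has_least_nat[of "\<lambda>p. p \<noteq> 0 \<and> ev a q p = 0" p0 degree] by blast
  have "degree p \<noteq> 0"
  proof
    assume "degree p = 0"
    then obtain d where "p = [:d:]" by (metis degree_eq_zeroE)
    then show False using p q by (simp add: ev_pCons)
  qed
  then obtain \<mu> where "poly p \<mu> = 0"
    using fundamental_theorem_of_algebra[of p] by (auto simp: constant_degree)
  then obtain g where g: "p = [:- \<mu>, 1:] * g"
    by (auto simp: poly_eq_0_iff_dvd)
  \<comment> \<open>The cofactor of a linear factor of the minimal polynomial: nonzero at
    \<open>a\<close> by minimality, yet annihilated by \<open>a - \<mu>\<close>.\<close>
  define x where "x = ev a q g"
  have "g \<noteq> 0" using g p by auto
  then have "degree p = degree [:- \<mu>, 1:] + degree g"
    unfolding g by (intro degree_mult_eq) auto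
  then have "degree g < degree p" by simp
  then have x0: "x \<noteq> 0" using min \<open>g \<noteq> 0\<close> by (force simp: x_def)
  have "p = pCons 0 g + smult (- \<mu>) g" by (simp add: g)
  then have "ev a q p = a * x - \<mu> *\<^sub>C x"
    by (simp only: ev_add ev_smult ev_pCons x_def) simp
  then have "a * x = \<mu> *\<^sub>C x" using p(2) by simp
  have "x * q = x"
    using qq by (simp add: x_def ev_def sum_distrib_right mult_scaleC_left mult.assoc)
  have "q * ev a q p = ev a q p" for p
    by (induction p) (simp_all add: ev_pCons distrib_left mult_scaleC_right qq aq flip: mult.assoc)
  then have "q * x = x" by (simp add: x_def)
  \<comment> \<open>On the eigenvector \<open>x\<close> every polynomial in \<open>a\<close> acts as
    a scalar, and so does its adjoint because \<open>star a = a\<close>. This is what makes both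
    \<open>star x * x\<close> and \<open>x * x\<close> multiples of \<open>x\<close>.\<close>
  have poly_x: "\<exists>d. ev a q p * x = d *\<^sub>C x" for p
  proof (induction p)
    case (pCons c p)
    then obtain d where "ev a q p * x = d *\<^sub>C x" by blast
    then have "ev a q (pCons c p) * x = (c + d * \<mu>) *\<^sub>C x"
      using \<open>a * x = \<mu> *\<^sub>C x\<close> \<open>q * x = x\<close>
      by (simp add: ev_pCons distrib_right mult_scaleC_left mult_scaleC_right mult.assoc
          cvs.scale_left_distrib)
    then show ?case by blast
  qed (auto intro: exI[of _ 0])
  have star_poly_x: "\<exists>d. star (ev a q p) * x = d *\<^sub>C x" for p
  proof (induction p)
    case (pCons c p)
    then obtain d where "star (ev a q p) * x = d *\<^sub>C x" by blast
    then have "star (ev a q (pCons c p)) * x = (cnj c + \<mu> * d) *\<^sub>C x"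
      using \<open>a * x = \<mu> *\<^sub>C x\<close> \<open>q * x = x\<close> a qq
      by (simp add: ev_pCons star_add star_mult star_scaleC distrib_right mult_scaleC_left
          mult_scaleC_right mult.assoc cvs.scale_left_distrib)
    then show ?case by blast
  qed (auto intro: exI[of _ 0])
  define h where "h = star x * x"
  obtain d where d: "h = d *\<^sub>C x" using star_poly_x[of g] by (auto simp: h_def x_def)
  obtain e where e: "x * x = e *\<^sub>C x" using poly_x[of g] by (auto simp: x_def)
  have h: "h \<noteq> 0" "star h = h" using x0 by (auto simp: h_def star_mult)
  define \<kappa> where "\<kappa> = d * e"
  have hh: "h * h = \<kappa> *\<^sub>C h"
    by (simp add: d mult_scaleC_left mult_scaleC_right e \<kappa>_def mult.commute mult.left_commute)
  have "h * h \<noteq> 0" using h star_mult_self_eq_0_iff[of h] by auto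
  then have k0: "\<kappa> \<noteq> 0" using hh by auto
  have "cnj \<kappa> *\<^sub>C h = \<kappa> *\<^sub>C h"
    using hh h by (metis star_mult star_scaleC)
  then have kr: "cnj \<kappa> = \<kappa>" using h by simp
  \<comment> \<open>The eigenvalue is real because \<open>star x * a * x\<close> is self-adjoint and
    equals \<open>\<mu> *\<^sub>C h\<close>.\<close>
  have "cnj \<mu> *\<^sub>C h = \<mu> *\<^sub>C h"
  proof -
    have "star x * (a * x) = \<mu> *\<^sub>C h"
      by (simp add: \<open>a * x = \<mu> *\<^sub>C x\<close> h_def mult_scaleC_right)
    moreover have "star (star x * (a * x)) = star x * (a * x)"
      by (simp add: star_mult a mult.assoc)
    ultimately show ?thesis using h by (metis star_scaleC)
  qed
  then have "cnj \<mu> = \<mu>" using h by simp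
  then have mr: "\<mu> = complex_of_real (Re \<mu>)"
    by (metis Reals_cnj_iff of_real_Re)
  define r where "r = (1/\<kappa>) *\<^sub>C h"
  show ?thesis
  proof (rule that[of r "Re \<mu>"])
    show "is_projection r"
      using h hh k0 kr
      by (simp add: is_projection_def r_def star_scaleC mult_scaleC_left mult_scaleC_right)
    show "r \<noteq> 0" using h k0 by (simp add: r_def)
    show "r \<in> corner q"
      using q \<open>q * x = x\<close> \<open>x * q = x\<close>
      by (simp add: corner_iff r_def d mult_scaleC_left mult_scaleC_right)
    have "a * r = \<mu> *\<^sub>C r"
      by (simp add: r_def d mult_scaleC_right \<open>a * x = \<mu> *\<^sub>C x\<close> mult_ac)
    then show "a * r = Re \<mu> *\<^sub>R r"
      using mr by (simp add: scaleR_scaleC)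
  qed
qed

definition orth_projs :: "'a::cstar_algebra set \<Rightarrow> bool" where
  "orth_projs R \<longleftrightarrow> (\<forall>r\<in>R. is_projection r \<and> r \<noteq> 0) \<and> (\<forall>r\<in>R. \<forall>s\<in>R. r \<noteq> s \<longrightarrow> r * s = 0)"

text \<open>Nonzero orthogonal projections are linearly independent: multiplying a relation by one
  of them isolates its coefficient. The uniform bound makes families of maximal cardinality
  available.\<close>

lemma orth_projs_bound:
  obtains n where "\<And>R::'a::fd_cstar_algebra set. orth_projs R \<Longrightarrow> finite R \<and> card R \<le> n"
proof -
  obtain B :: "'a set" where B: "finite B" and span: "\<And>S. S \<subseteq> cvs.span B"
    by (rule finite_spanning_set) blast
  have ind: "cvs.independent R" if R: "orth_projs R" for R :: "'a set"
  proof
    assume "cvs.dependent R"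
    then obtain S u r where S: "finite S" "S \<subseteq> R" "(\<Sum>v\<in>S. u v *\<^sub>C v) = 0" "r \<in> S" "u r \<noteq> 0"
      unfolding cvs.dependent_explicit by blast
    have orth: "r * v = 0" if "v \<in> S" "v \<noteq> r" for v
      using R S(2,4) that unfolding orth_projs_def by (metis subsetD)
    have "0 = (\<Sum>v\<in>S. u v *\<^sub>C (r * v))"
      using S(3) by (simp flip: mult_scaleC_right sum_distrib_left)
    also have "\<dots> = (\<Sum>v\<in>S. if v = r then u r *\<^sub>C r else 0)"
    proof (intro sum.cong refl)
      fix v assume "v \<in> S"
      have "r * r = r" using R S(2,4) by (auto simp: orth_projs_def is_projection_def)
      then show "u v *\<^sub>C (r * v) = (if v = r then u r *\<^sub>C r else 0)"
        using orth[OF \<open>v \<in> S\<close>] by simp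
    qed
    also have "\<dots> = u r *\<^sub>C r" using S by simp
    finally show False using S R by (auto simp: orth_projs_def)
  qed
  show ?thesis
    using cvs.independent_span_bound[OF B _ span] ind that by blast
qed

text \<open>The coordinate-free counterpart of an orthonormal basis of the range of
  \<open>q\<close>. For members of a corner, minimality in the whole algebra agrees with minimality
  in that corner (\<open>minimal_projection_in_corner\<close>).\<close>

definition frame :: "'a::cstar_algebra \<Rightarrow> 'a set \<Rightarrow> bool" where
  "frame q R \<longleftrightarrow> finite R \<and> (\<forall>r\<in>R. minimal_projection_in UNIV r) \<and>
     (\<forall>r\<in>R. \<forall>s\<in>R. r \<noteq> s \<longrightarrow> r * s = 0) \<and> \<Sum>R = q"

lemma frame_projection:
  assumes "frame q R" "r \<in> R" shows "is_projection r" "r \<noteq> 0"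
  using assms by (auto simp: frame_def minimal_projection_in_def)

lemma frame_mult:
  assumes "frame q R" "r \<in> R" shows "q * r = r" "r * q = r"
proof -
  have "q * r = (\<Sum>s\<in>R. s * r)" using assms by (auto simp: frame_def sum_distrib_right)
  also have "\<dots> = (\<Sum>s\<in>R. if s = r then r else 0)"
    using assms frame_projection[OF assms(1)]
    by (intro sum.cong) (auto simp: frame_def is_projection_def)
  also have "\<dots> = r" using assms by (simp add: frame_def)
  finally show "q * r = r" .
  have "r * q = (\<Sum>s\<in>R. r * s)" using assms by (auto simp: frame_def sum_distrib_left)
  also have "\<dots> = (\<Sum>s\<in>R. if s = r then r else 0)"
    using assms frame_projection[OF assms(1)]
    by (intro sum.cong) (auto simp: frame_def is_projection_def)
  also have "\<dots> = r" using assms by (simp add: frame_def)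
  finally show "r * q = r" .
qed

text \<open>Take a family of eigenprojections of maximal cardinality. If its sum were not
  \<open>q\<close>, the remainder, which commutes with \<open>a\<close>, would contain a further
  eigenprojection; if a member \<open>r\<close> were not minimal, replacing it by \<open>p\<close>
  and \<open>r - p\<close> would enlarge the family.\<close>

lemma diagonalize:
  fixes a q :: "'a::fd_cstar_algebra"
  assumes q: "is_projection q" and a: "star a = a" "a \<in> corner q"
  obtains R c where "frame q R" "\<And>r. r \<in> R \<Longrightarrow> r \<in> corner q"
    "\<And>r. r \<in> R \<Longrightarrow> a * r = c r *\<^sub>R r" "a = (\<Sum>r\<in>R. c r *\<^sub>R r)"
proof -
  define P where "P R \<longleftrightarrow> orth_projs R \<and> (\<forall>r\<in>R. r \<in> corner q \<and> (\<exists>c. a * r = c *\<^sub>R r))" for R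
  obtain n where n: "\<And>R::'a set. orth_projs R \<Longrightarrow> finite R \<and> card R \<le> n"
    using orth_projs_bound by blast
  have "P {}" by (simp add: P_def orth_projs_def)
  then obtain R where R: "P R" and max: "\<And>R'. P R' \<Longrightarrow> card R' \<le> card R"
    using ex_has_greatest_nat[of P "{}" card "Suc n"] n by (auto simp: P_def less_Suc_eq_le)
  have fin: "finite R" and proj: "\<And>r. r \<in> R \<Longrightarrow> is_projection r \<and> r \<noteq> 0"
    and orth: "\<And>r s. r \<in> R \<Longrightarrow> s \<in> R \<Longrightarrow> r \<noteq> s \<Longrightarrow> r * s = 0"
    and corner: "\<And>r. r \<in> R \<Longrightarrow> r \<in> corner q"
    using R n by (auto simp: P_def orth_projs_def)
  obtain c where c: "\<And>r. r \<in> R \<Longrightarrow> a * r = c r *\<^sub>R r"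
    using R unfolding P_def by metis
  have c': "r * a = c r *\<^sub>R r" if "r \<in> R" for r
  proof -
    have "star (a * r) = star (c r *\<^sub>R r)" using c that by simp
    then show ?thesis using proj[OF that] a by (simp add: star_mult star_scaleR is_projectionD)
  qed
  have projS: "is_projection (\<Sum>R)"
    using is_projection_sum[of R id] fin proj orth by auto
  have Sq: "\<Sum>R * q = \<Sum>R"
    using corner q by (auto simp: sum_distrib_right corner_iff intro: sum.cong)
  have rS: "r * \<Sum>R = r" if "r \<in> R" for r
  proof -
    have "r * \<Sum>R = (\<Sum>s\<in>R. if s = r then r else 0)"
      unfolding sum_distrib_left using orth proj that
      by (intro sum.cong) (auto simp: is_projection_def)
    then show ?thesis using fin that by simp
  qed
  have "\<Sum>R = q"
  proof (rule ccontr)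
    assume neq: "\<Sum>R \<noteq> q"
    define q' where "q' = q - \<Sum>R"
    have q': "is_projection q'" "q' \<noteq> 0"
      using neq is_projection_diff[OF projS q Sq] by (auto simp: q'_def)
    have aS: "a * \<Sum>R = \<Sum>R * a" by (simp add: sum_distrib_left sum_distrib_right c c')
    have aq: "q * a = a" "a * q = a" using a q by (auto simp: corner_iff)
    have comm: "a * q' = q' * a" by (simp add: q'_def algebra_simps aS aq)
    have "star (a * q') = a * q'" using q' a comm by (simp add: star_mult is_projectionD)
    moreover have "a * q' \<in> corner q'"
      using q' comm by (simp add: corner_iff mult.assoc is_projectionD)
    ultimately obtain r d where r: "is_projection r" "r \<noteq> 0" "r \<in> corner q'" "a * q' * r = d *\<^sub>R r"
      using eigenprojection[OF q'] by metis
    have q'r: "q' * r = r" "r * q' = r" using r q' by (auto simp: corner_iff)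
    have ar: "a * r = d *\<^sub>R r" using r(4) q'r by (simp add: mult.assoc)
    have sr: "s * r = 0" if "s \<in> R" for s
    proof -
      have "s * r = s * q' * r" by (simp add: mult.assoc q'r)
      also have "s * q' = 0"
        using rS[OF that] corner[OF that] q by (simp add: q'_def algebra_simps corner_iff)
      finally show ?thesis by simp
    qed
    have rs: "r * s = 0" if "s \<in> R" for s
      using projection_orth_sym[OF _ r(1) sr[OF that]] proj that by blast
    have "q * q' = q'" using q Sq projection_le_sym[OF projS q]
      by (simp add: q'_def algebra_simps is_projectionD)
    then have "r \<in> corner q"
      using corner_trans[OF q'(1) q _ r(3)] q q' projection_le_sym[OF q'(1) q]
      by (simp add: corner_iff)
    then have "P (insert r R)"
      using R r ar sr rs by (auto simp: P_def orth_projs_def)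
    moreover have "r \<notin> R" using rs[of r] r by (auto simp: is_projection_def)
    ultimately show False using max[of "insert r R"] fin by simp
  qed
  have minimal: "minimal_projection_in UNIV r" if rR: "r \<in> R" for r
  proof -
    have "p = 0 \<or> p = r" if p: "is_projection p" "p * r = p" for p
    proof (rule ccontr)
      assume np: "\<not> (p = 0 \<or> p = r)"
      have r: "is_projection r" using proj rR by blast
      have rp: "r * p = p" using p projection_le_sym[OF p(1) r] by simp
      have d: "is_projection (r - p)" using is_projection_diff[OF p(1) r p(2)] .
      have pc: "p \<in> corner r" using p rp r by (simp add: corner_iff)
      have pq: "p \<in> corner q" using corner_trans[OF r q corner[OF rR] pc] .
      have dq: "r - p \<in> corner q"
        using pq corner[OF rR] by (intro cvs.subspace_diff[OF subspace_corner])
      have ap: "a * p = c r *\<^sub>R p"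
        using c[OF rR] rp by (metis mult.assoc mult_scaleR_left)
      have ad: "a * (r - p) = c r *\<^sub>R (r - p)"
        using ap c[OF rR] by (simp add: algebra_simps)
      have ps: "p * s = 0 \<and> s * p = 0" if "s \<in> R - {r}" for s
        using orth[OF rR] orth[OF _ rR] that p rp by (metis DiffE insertCI mult.assoc mult_zero_left mult_zero_right)
      have ds: "(r - p) * s = 0 \<and> s * (r - p) = 0" if "s \<in> R - {r}" for s
        using ps[OF that] orth[OF rR] orth[OF _ rR] that by (auto simp: algebra_simps)
      have pd: "p * (r - p) = 0" "(r - p) * p = 0"
        using p rp by (auto simp: algebra_simps is_projectionD)
      have "P (insert p (insert (r - p) (R - {r})))"
      proof -
        have "r - p \<noteq> 0" "p \<noteq> 0" using np by auto
        then have "orth_projs (insert p (insert (r - p) (R - {r})))"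
          unfolding orth_projs_def using p(1) d pd ps ds proj orth by simp
        then show ?thesis unfolding P_def using ap ad pq dq corner c by blast
      qed
      moreover have "p \<notin> R - {r}" using ps[of p] p np by (auto simp: is_projectionD)
      moreover have "r - p \<notin> R - {r}" using ds[of "r - p"] d np by (auto simp: is_projectionD)
      moreover have "p \<noteq> r - p" using pd np p by (metis is_projectionD(2))
      ultimately have "card (insert p (insert (r - p) (R - {r}))) \<le> card R"
        "card (insert p (insert (r - p) (R - {r}))) = Suc (Suc (card (R - {r})))"
        using max fin by (blast, simp)
      then show False using card_Suc_Diff1[OF fin rR] by linarith
    qed
    then show ?thesis using proj[OF rR] by (auto simp: minimal_projection_in_def)
  qed
  have "a = a * q" using a q by (simp add: corner_iff)
  also have "\<dots> = (\<Sum>r\<in>R. c r *\<^sub>R r)"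
    by (subst \<open>\<Sum>R = q\<close>[symmetric]) (simp add: sum_distrib_left c)
  finally have "a = (\<Sum>r\<in>R. c r *\<^sub>R r)" .
  moreover have "frame q R"
    using fin minimal orth \<open>\<Sum>R = q\<close> by (simp add: frame_def)
  ultimately show ?thesis using that corner c by blast
qed

section \<open>The trace\<close>

lemma clinear_on_UNIV_simps:
  assumes "clinear_on UNIV F"
  shows "F (x + y) = F x + F y" "F (c *\<^sub>C x) = c *\<^sub>C F x" "F 0 = 0" "F (- x) = - F x"
    "F (x - y) = F x - F y" "F (r *\<^sub>R x) = r *\<^sub>R F x"
proof -
  show add: "F (x + y) = F x + F y" for x y using assms by (simp add: clinear_on_def)
  show scale: "F (c *\<^sub>C x) = c *\<^sub>C F x" for c x using assms by (simp add: clinear_on_def)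
  show z: "F 0 = 0" using scale[of 0 0] by simp
  show neg: "F (- x) = - F x" for x using add[of x "- x"] z by (simp add: add_eq_0_iff)
  show "F (x - y) = F x - F y" using add[of x "- y"] neg by simp
  show "F (r *\<^sub>R x) = r *\<^sub>R F x" using scale by (simp add: scaleR_scaleC)
qed

lemma clinear_on_sum:
  assumes "clinear_on A F" "cvs.subspace A" "\<And>i. i \<in> I \<Longrightarrow> x i \<in> A"
  shows "F (\<Sum>i\<in>I. x i) = (\<Sum>i\<in>I. F (x i))"
proof -
  have F0: "F 0 = 0"
    using assms(1) cvs.subspace_0[OF assms(2)] unfolding clinear_on_def
    by (metis cvs.scale_zero_left)
  show ?thesis using assms(3)
  proof (induction I rule: infinite_finite_induct)
    case (insert i I)
    then have "(\<Sum>i\<in>I. x i) \<in> A" by (intro cvs.subspace_sum assms(2)) auto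
    then show ?case using insert assms(1) by (simp add: clinear_on_def)
  qed (use F0 in auto)
qed

lemma selfadjoint_decomp_corner:
  assumes "is_projection q" "x \<in> corner q"
  obtains h k where "star h = h" "star k = k" "x = h + \<i> *\<^sub>C k" "h \<in> corner q" "k \<in> corner q"
proof -
  obtain h k where "star h = h" "star k = k" "x = h + \<i> *\<^sub>C k"
    "h = (1/2) *\<^sub>R (x + star x)" "k = (- \<i>/2) *\<^sub>C (x - star x)"
    by (rule selfadjoint_decomp)
  moreover have "x + star x \<in> corner q" "x - star x \<in> corner q"
    using assms corner_star cvs.subspace_add[OF subspace_corner] cvs.subspace_diff[OF subspace_corner]
    by blast+
  ultimately show ?thesis
    using that cvs.subspace_scale[OF subspace_corner] by (metis scaleR_scaleC)
qed

lemma minimal_projection_in_UNIV_D: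
  assumes "minimal_projection_in UNIV p"
  shows "is_projection p" "p \<noteq> 0" "star p = p" "p * p = p"
  using assms by (auto simp: minimal_projection_in_def is_projection_def)

text \<open>A self-adjoint element of the corner has an eigenprojection there, which minimality
  forces to be \<open>p\<close> itself, so the element is a multiple of \<open>p\<close>. Real and
  imaginary parts give the general case.\<close>

lemma minimal_projection_scalar:
  fixes p :: "'a::fd_cstar_algebra"
  assumes p: "minimal_projection_in UNIV p"
  shows "\<exists>c. p * x * p = c *\<^sub>C p"
proof -
  note pp = minimal_projection_in_UNIV_D[OF p]
  have sa: "\<exists>c. a = c *\<^sub>C p" if a: "star a = a" "a \<in> corner p" for a
  proof -
    obtain r c where r: "is_projection r" "r \<noteq> 0" "r \<in> corner p" "a * r = c *\<^sub>R r"
      using eigenprojection[OF pp(1,2) a] by blast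
    then have "r * p = r" using pp by (simp add: corner_iff)
    then have "r = p" using p r by (auto simp: minimal_projection_in_def)
    then have "a = c *\<^sub>R p" using r a pp by (simp add: corner_iff)
    then show ?thesis by (auto simp: scaleR_scaleC)
  qed
  obtain h k where hk: "star h = h" "star k = k" "p * x * p = h + \<i> *\<^sub>C k"
    "h \<in> corner p" "k \<in> corner p"
    using selfadjoint_decomp_corner[OF pp(1) compress_in_corner] by blast
  obtain c d where "h = c *\<^sub>C p" "k = d *\<^sub>C p" using sa hk by blast
  then have "p * x * p = (c + \<i> * d) *\<^sub>C p" using hk by (simp add: cvs.scale_left_distrib)
  then show ?thesis by blast
qed

definition min_coeff :: "'a::cstar_algebra \<Rightarrow> 'a \<Rightarrow> complex" where
  "min_coeff p x = (SOME c. p * x * p = c *\<^sub>C p)"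

lemma min_coeff:
  fixes p :: "'a::fd_cstar_algebra"
  assumes "minimal_projection_in UNIV p"
  shows "p * x * p = min_coeff p x *\<^sub>C p"
  unfolding min_coeff_def using someI_ex[OF minimal_projection_scalar[OF assms, of x]] .

lemma min_coeff_eqI:
  fixes p :: "'a::fd_cstar_algebra"
  assumes "minimal_projection_in UNIV p" "p * x * p = c *\<^sub>C p"
  shows "min_coeff p x = c"
  using min_coeff[OF assms(1), of x] assms(2) minimal_projection_in_UNIV_D(2)[OF assms(1)]
  by simp

lemma min_coeff_add:
  fixes p :: "'a::fd_cstar_algebra"
  assumes "minimal_projection_in UNIV p"
  shows "min_coeff p (x + y) = min_coeff p x + min_coeff p y"
  using min_coeff[OF assms] 
  by (intro min_coeff_eqI assms) (simp add: algebra_simps cvs.scale_left_distrib)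

lemma min_coeff_scaleC:
  fixes p :: "'a::fd_cstar_algebra"
  assumes "minimal_projection_in UNIV p"
  shows "min_coeff p (c *\<^sub>C x) = c * min_coeff p x"
  using min_coeff[OF assms]
  by (intro min_coeff_eqI assms) (simp add: mult_scaleC_left mult_scaleC_right)

lemma min_coeff_sum:
  fixes p :: "'a::fd_cstar_algebra"
  assumes "minimal_projection_in UNIV p"
  shows "min_coeff p (\<Sum>i\<in>I. f i) = (\<Sum>i\<in>I. min_coeff p (f i))"
proof -
  have "min_coeff p 0 = 0" by (intro min_coeff_eqI assms) simp
  then show ?thesis
    by (induction I rule: infinite_finite_induct) (simp_all add: min_coeff_add[OF assms])
qed

text \<open>The germ of the trace property. With \<open>u = p * x * r\<close> and
  \<open>v = r * y * p\<close> the two coefficients are those of \<open>u * v\<close> and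
  \<open>v * u\<close>, and associativity of \<open>u * v * u\<close> equates them unless
  \<open>u = 0\<close>, when both vanish.\<close>

lemma min_coeff_swap:
  fixes p r :: "'a::fd_cstar_algebra"
  assumes p: "minimal_projection_in UNIV p" and r: "minimal_projection_in UNIV r"
  shows "min_coeff p (x * r * y) = min_coeff r (y * p * x)"
proof -
  note pp = minimal_projection_in_UNIV_D[OF p] and rr = minimal_projection_in_UNIV_D[OF r]
  define u v where "u = p * x * r" and "v = r * y * p"
  have "u * v = p * x * (r * r) * y * p" "v * u = r * y * (p * p) * x * r"
    unfolding u_def v_def by (simp_all only: mult.assoc)
  then have uv: "u * v = min_coeff p (x * r * y) *\<^sub>C p" "v * u = min_coeff r (y * p * x) *\<^sub>C r"
    using min_coeff[OF p, of "x * r * y"] min_coeff[OF r, of "y * p * x"] pp rr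
    by (simp_all add: mult.assoc)
  have "p * u = u" "u * r = u"
    using pp rr by (simp_all add: u_def mult.assoc is_projectionD)
  then have "min_coeff p (x * r * y) *\<^sub>C u = min_coeff r (y * p * x) *\<^sub>C u"
    using uv by (metis mult.assoc mult_scaleC_left mult_scaleC_right)
  then show ?thesis using uv pp rr by (cases "u = 0") auto
qed

definition is_trace :: "'a::cstar_algebra set \<Rightarrow> ('a \<Rightarrow> complex) \<Rightarrow> bool" where
  "is_trace A \<tau> \<longleftrightarrow> clinear_on A \<tau> \<and> (\<forall>x\<in>A. \<forall>y\<in>A. \<tau> (x * y) = \<tau> (y * x)) \<and>
     (\<forall>p. minimal_projection_in A p \<longrightarrow> \<tau> p = 1)"

lemma Tr_eq_SOME: "Tr A = (SOME \<tau>. is_trace A \<tau>)"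
  by (simp add: Tr_def is_trace_def)

lemma frame_exists:
  fixes q :: "'a::fd_cstar_algebra"
  assumes "is_projection q"
  obtains R where "frame q R" "\<And>r. r \<in> R \<Longrightarrow> r \<in> corner q"
proof -
  have "star q = q" "q \<in> corner q" using assms by (simp_all add: corner_iff is_projectionD)
  then show ?thesis using diagonalize[OF assms] that by metis
qed

text \<open>\<open>Tr\<close> is a choice, so a trace must first be exhibited: the sum of the
  diagonal coefficients in a frame of 1.\<close>

lemma is_trace_UNIV: "is_trace UNIV (Tr (UNIV :: 'a::fd_cstar_algebra set))"
proof -
  obtain R :: "'a set" where R: "frame 1 R" using frame_exists by (metis is_projection_1)
  have min: "minimal_projection_in UNIV r" if "r \<in> R" for r using R that by (simp add: frame_def)
  have sum: "\<Sum>R = 1" using R by (simp add: frame_def)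
  have "is_trace UNIV (\<lambda>x. \<Sum>r\<in>R. min_coeff r x)"
    unfolding is_trace_def
  proof (intro conjI ballI allI impI)
    show "clinear_on UNIV (\<lambda>x. \<Sum>r\<in>R. min_coeff r x)"
      by (simp add: clinear_on_def min_coeff_add min_coeff_scaleC min sum.distrib
          scaleC_complex_def sum_distrib_left)
    \<comment> \<open>Inserting the unit as the sum of the frame between \<open>x\<close> and
      \<open>y\<close> makes \<open>min_coeff_swap\<close> applicable term by term.\<close>
    have expand: "(\<Sum>r\<in>R. min_coeff r (x * y)) = (\<Sum>r\<in>R. \<Sum>s\<in>R. min_coeff r (x * s * y))" for x y
    proof (intro sum.cong refl)
      fix r assume "r \<in> R"
      have "x * y = (\<Sum>s\<in>R. x * s * y)"
        by (simp add: sum flip: sum_distrib_left sum_distrib_right)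
      then show "min_coeff r (x * y) = (\<Sum>s\<in>R. min_coeff r (x * s * y))"
        by (simp add: min_coeff_sum[OF min[OF \<open>r \<in> R\<close>]])
    qed
    show "(\<Sum>r\<in>R. min_coeff r (x * y)) = (\<Sum>r\<in>R. min_coeff r (y * x))" for x y
      unfolding expand by (subst sum.swap) (intro sum.cong refl min_coeff_swap min)
    show "(\<Sum>r\<in>R. min_coeff r p) = 1" if p: "minimal_projection_in UNIV p" for p
    proof -
      have "(\<Sum>r\<in>R. min_coeff r p) = (\<Sum>r\<in>R. min_coeff p r)"
        using min_coeff_swap[OF p, of _ 1 1] min by (intro sum.cong refl) simp
      also have "\<dots> = min_coeff p 1"
        by (subst min_coeff_sum[OF p, of "\<lambda>x. x", symmetric]) (simp add: sum)
      also have "\<dots> = 1"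
        by (intro min_coeff_eqI p) (simp add: scaleC_one minimal_projection_in_UNIV_D[OF p])
      finally show ?thesis .
    qed
  qed
  then show ?thesis unfolding Tr_eq_SOME by (rule someI[of "is_trace UNIV"])
qed

text \<open>Projections below \<open>p\<close> stay in every corner that contains \<open>p\<close>,
  so minimality does not depend on the surrounding corner.\<close>

lemma minimal_projection_in_corner:
  assumes "is_projection q"
  shows "minimal_projection_in (corner q) p \<longleftrightarrow> p \<in> corner q \<and> minimal_projection_in UNIV p"
proof -
  have "r \<in> corner q" if "p \<in> corner q" "is_projection p" "is_projection r" "r * p = r" for r
    using that assms projection_le_sym[of r p] by (metis corner_iff mult.assoc)
  then show ?thesis by (auto simp: minimal_projection_in_def)
qed

text \<open>Diagonalisation shows that a trace on the corner is determined by its value 1 on minimal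
  projections, and the ambient trace restricts to one. Later arguments can therefore work with the
  ambient trace.\<close>

lemma Tr_corner:
  fixes q :: "'a::fd_cstar_algebra"
  assumes q: "is_projection q" and x: "x \<in> corner q"
  shows "Tr (corner q) x = Tr UNIV x"
proof -
  have tr: "is_trace (corner q) (Tr UNIV)"
    using is_trace_UNIV q
    by (auto simp: is_trace_def clinear_on_def minimal_projection_in_corner)
  then have tr': "is_trace (corner q) (Tr (corner q))"
    unfolding Tr_eq_SOME[of "corner q"] by (rule someI[of "is_trace (corner q)"])
  have sa: "Tr (corner q) a = Tr UNIV a" if a: "star a = a" "a \<in> corner q" for a
  proof -
    obtain R c where R: "frame q R" "\<And>r. r \<in> R \<Longrightarrow> r \<in> corner q" "a = (\<Sum>r\<in>R. c r *\<^sub>R r)"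
      using diagonalize[OF q a] by metis
    have "\<tau> a = (\<Sum>r\<in>R. complex_of_real (c r))" if "is_trace (corner q) \<tau>" for \<tau>
    proof -
      have lin: "clinear_on (corner q) \<tau>" using that by (simp add: is_trace_def)
      have "\<tau> a = (\<Sum>r\<in>R. \<tau> (c r *\<^sub>R r))"
        unfolding R(3) using R(2) by (intro clinear_on_sum[OF lin subspace_corner] scaleR_in_corner)
      also have "\<dots> = (\<Sum>r\<in>R. complex_of_real (c r))"
      proof (intro sum.cong refl)
        fix r assume "r \<in> R"
        then have "\<tau> r = 1"
          using that R q by (auto simp: is_trace_def minimal_projection_in_corner frame_def)
        then show "\<tau> (c r *\<^sub>R r) = complex_of_real (c r)"
          using lin R(2)[OF \<open>r \<in> R\<close>] by (simp add: clinear_on_def scaleR_scaleC scaleC_complex_def)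
      qed
      finally show ?thesis .
    qed
    then show ?thesis using tr tr' by metis
  qed
  obtain h k where hk: "star h = h" "star k = k" "x = h + \<i> *\<^sub>C k" "h \<in> corner q" "k \<in> corner q"
    using selfadjoint_decomp_corner[OF q x] by blast
  have ik: "\<i> *\<^sub>C k \<in> corner q" using hk cvs.subspace_scale[OF subspace_corner] by blast
  have "\<tau> x = \<tau> h + \<i> * \<tau> k" if "is_trace (corner q) \<tau>" for \<tau>
    using that hk ik by (simp add: is_trace_def clinear_on_def scaleC_complex_def)
  then show ?thesis using sa hk tr tr' by metis
qed

abbreviation tr :: "'a::cstar_algebra \<Rightarrow> complex" where "tr \<equiv> Tr UNIV"
abbreviation rtr :: "'a::cstar_algebra \<Rightarrow> real" where "rtr x \<equiv> Re (Tr UNIV x)"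
abbreviation pos :: "'a::cstar_algebra \<Rightarrow> bool" where "pos \<equiv> positive_in UNIV"

lemma clinear_on_tr: "clinear_on UNIV (tr :: 'a::fd_cstar_algebra \<Rightarrow> complex)"
  using is_trace_UNIV[where 'a='a] by (simp add: is_trace_def)

lemmas tr_simps = clinear_on_UNIV_simps[OF clinear_on_tr, unfolded scaleC_complex_def]

lemma tr_sum: "tr (\<Sum>i\<in>I. x i :: 'a::fd_cstar_algebra) = (\<Sum>i\<in>I. tr (x i))"
  by (rule clinear_on_sum[OF clinear_on_tr]) simp_all

lemma tr_commute: "tr (x * y) = tr (y * (x::'a::fd_cstar_algebra))"
  using is_trace_UNIV[where 'a='a] by (simp add: is_trace_def)

lemma tr_minimal: "minimal_projection_in UNIV p \<Longrightarrow> tr (p::'a::fd_cstar_algebra) = 1"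
  using is_trace_UNIV[where 'a='a] by (simp add: is_trace_def)

section \<open>Positivity\<close>

text \<open>If \<open>c\<close> were negative, then \<open>\<alpha>\<close> could be chosen such that \<open>x = p + \<alpha> w\<close> satisfies
  \<open>x\<^sup>* x = 0\<close>.\<close>

lemma min_proj_nonneg:
  fixes p w :: "'a::fd_cstar_algebra"
  assumes p: "minimal_projection_in UNIV p" and w: "w * p = w" "star w * w = c *\<^sub>R p"
  shows "0 \<le> c"
proof (rule ccontr)
  assume "\<not> 0 \<le> c"
  then have c: "c < 0" by simp
  note pp = minimal_projection_in_UNIV_D[OF p]
  define \<gamma> where "\<gamma> = min_coeff p w"
  have pw: "p * w = \<gamma> *\<^sub>C p"
    using min_coeff[OF p, of w] w by (simp add: \<gamma>_def mult.assoc)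
  then have wp: "star w * p = cnj \<gamma> *\<^sub>C p"
    using pp by (metis star_mult star_scaleC)
  \<comment> \<open>The modulus gives \<open>(cmod \<alpha>)\<^sup>2 * c = - 1\<close>. The phase
    makes \<open>\<alpha> * \<gamma>\<close> purely imaginary, so that the cross terms cancel
    against each other.\<close>
  define \<alpha> where "\<alpha> = (if \<gamma> = 0 then 1 else \<i> * cnj \<gamma> / cmod \<gamma>) / sqrt (- c)"
  have "cmod \<alpha> = 1 / sqrt (- c)"
    using c by (simp add: \<alpha>_def norm_divide norm_mult)
  then have a2: "(cmod \<alpha>)\<^sup>2 * c = - 1" using c by (simp add: power_divide)
  have "cnj \<alpha> * \<alpha> = complex_of_real ((cmod \<alpha>)\<^sup>2)"
    by (metis complex_norm_square mult.commute)
  then have a2': "cnj \<alpha> * \<alpha> * complex_of_real c = - 1"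
    using a2 by (metis of_real_1 of_real_minus of_real_mult)
  have "\<alpha> * \<gamma> = (if \<gamma> = 0 then 0 else \<i> * complex_of_real (cmod \<gamma> / sqrt (- c)))"
    by (auto simp: \<alpha>_def complex_norm_square[symmetric] power2_eq_square field_simps
        simp flip: of_real_mult)
       (simp add: mult.commute[of "cnj \<gamma>"] complex_norm_square[symmetric] power2_eq_square)
  then have ag: "\<alpha> * \<gamma> + cnj \<alpha> * cnj \<gamma> = 0"
    by (auto simp flip: complex_cnj_mult simp: complex_add_cnj split: if_splits)
  define x where "x = p + \<alpha> *\<^sub>C w"
  have "star x * x = (p + cnj \<alpha> *\<^sub>C star w) * (p + \<alpha> *\<^sub>C w)"
    by (simp add: x_def star_add star_scaleC pp)
  also have "\<dots> = (1 + (\<alpha> * \<gamma> + cnj \<alpha> * cnj \<gamma>) + cnj \<alpha> * \<alpha> * complex_of_real c) *\<^sub>C p"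
    by (simp add: distrib_left distrib_right mult_scaleC_left mult_scaleC_right pw wp w pp
        cvs.scale_left_distrib cvs.scale_right_distrib scaleR_scaleC mult_ac scaleC_one add_ac)
  also have "\<dots> = 0" using ag a2' by simp
  finally have "x = 0" by simp
  then have "p = (- \<alpha>) *\<^sub>C w" by (simp add: x_def add_eq_0_iff2)
  then have "star p * p = (cnj \<alpha> * \<alpha>) *\<^sub>C (star w * w)"
    by (simp add: star_scaleC star_uminus mult_scaleC_left mult_scaleC_right mult_ac)
  then have "p = (cnj \<alpha> * \<alpha> * complex_of_real c) *\<^sub>C p"
    using pp w by (simp add: scaleR_scaleC)
  then have "p = - p" using a2' by (simp add: scaleC_one)
  then have "2 *\<^sub>R p = 0" by (metis add.right_inverse scaleR_2)
  then show False using pp by simp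
qed

lemma posI: "pos (star b * b)"
  by (auto simp: positive_in_def)

lemma pos_diagonalize:
  fixes a q :: "'a::fd_cstar_algebra"
  assumes q: "is_projection q" and a: "pos a" "a \<in> corner q"
  obtains R c where "frame q R" "\<forall>r\<in>R. r \<in> corner q"
    "\<forall>r\<in>R. a * r = c r *\<^sub>R r" "a = (\<Sum>r\<in>R. c r *\<^sub>R r)" "\<forall>r\<in>R. 0 \<le> c r"
proof -
  obtain b where b: "a = star b * b" using a by (auto simp: positive_in_def)
  have "star a = a" by (simp add: b star_mult)
  then obtain R c where R: "frame q R" "\<And>r. r \<in> R \<Longrightarrow> r \<in> corner q"
    "\<And>r. r \<in> R \<Longrightarrow> a * r = c r *\<^sub>R r" "a = (\<Sum>r\<in>R. c r *\<^sub>R r)"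
    using diagonalize[OF q _ a(2)] by metis
  have "0 \<le> c r" if "r \<in> R" for r
  proof -
    have min: "minimal_projection_in UNIV r" using R that by (simp add: frame_def)
    note rr = minimal_projection_in_UNIV_D[OF min]
    have "star (b * r) * (b * r) = r * (a * r)" by (simp add: star_mult rr b mult.assoc)
    also have "\<dots> = c r *\<^sub>R r" using R that rr by simp
    finally show ?thesis
      by (intro min_proj_nonneg[OF min, of "b * r"]) (simp_all add: mult.assoc rr)
  qed
  then show ?thesis using that R by blast
qed

lemma sum_orth_projs_mult:
  fixes r :: "'k \<Rightarrow> 'a::cstar_algebra"
  assumes "finite K" "\<And>k. k \<in> K \<Longrightarrow> is_projection (r k)"
    and "\<And>k l. k \<in> K \<Longrightarrow> l \<in> K \<Longrightarrow> k \<noteq> l \<Longrightarrow> r k * r l = 0"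
  shows "(\<Sum>k\<in>K. c k *\<^sub>R r k) * (\<Sum>k\<in>K. d k *\<^sub>R r k) = (\<Sum>k\<in>K. (c k * d k) *\<^sub>R r k)"
proof -
  have "(\<Sum>k\<in>K. c k *\<^sub>R r k) * (\<Sum>k\<in>K. d k *\<^sub>R r k)
      = (\<Sum>k\<in>K. \<Sum>l\<in>K. (c k * d l) *\<^sub>R (r k * r l))"
    by (simp add: sum_product mult.commute)
  also have "\<dots> = (\<Sum>k\<in>K. \<Sum>l\<in>K. if l = k then (c k * d k) *\<^sub>R r k else 0)"
    using assms by (intro sum.cong refl) (auto simp: is_projection_def)
  finally show ?thesis using assms(1) by simp
qed

lemma positive_in_sum_projections:
  fixes r :: "'k \<Rightarrow> 'a::cstar_algebra"
  assumes "finite K" "\<And>k. k \<in> K \<Longrightarrow> is_projection (r k)"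
    and "\<And>k l. k \<in> K \<Longrightarrow> l \<in> K \<Longrightarrow> k \<noteq> l \<Longrightarrow> r k * r l = 0"
    and c: "\<And>k. k \<in> K \<Longrightarrow> 0 \<le> c k" and corner: "\<And>k. k \<in> K \<Longrightarrow> r k \<in> corner q"
  shows "positive_in (corner q) (\<Sum>k\<in>K. c k *\<^sub>R r k)"
proof -
  define b where "b = (\<Sum>k\<in>K. sqrt (c k) *\<^sub>R r k)"
  have "star b = b"
    using assms(2) by (simp add: b_def star_sum star_scaleR is_projectionD)
  moreover have "b * b = (\<Sum>k\<in>K. c k *\<^sub>R r k)"
    unfolding b_def using sum_orth_projs_mult[OF assms(1-3)] c by simp
  moreover have "b \<in> corner q"
    unfolding b_def by (intro cvs.subspace_sum[OF subspace_corner] scaleR_in_corner corner)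
  ultimately show ?thesis by (auto simp: positive_in_def intro!: bexI[of _ b])
qed

text \<open>The square root built from eigenprojections lies in the corner even when the given
  \<open>b\<close> with \<open>a = star b * b\<close> does not.\<close>

lemma positive_in_corner:
  fixes q :: "'a::fd_cstar_algebra"
  assumes q: "is_projection q"
  shows "positive_in (corner q) a \<longleftrightarrow> pos a \<and> a \<in> corner q"
proof
  assume "positive_in (corner q) a"
  then obtain b where b: "b \<in> corner q" "a = star b * b" by (auto simp: positive_in_def)
  have sb: "star b \<in> corner q" using b corner_star q by blast
  have "a \<in> corner q"
    using b sb q by (simp add: corner_iff mult.assoc) (simp flip: mult.assoc)
  then show "pos a \<and> a \<in> corner q" using b posI by auto
next
  assume "pos a \<and> a \<in> corner q"
  then obtain R c where R: "frame q R" "\<And>r. r \<in> R \<Longrightarrow> r \<in> corner q"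
    "a = (\<Sum>r\<in>R. c r *\<^sub>R r)" "\<And>r. r \<in> R \<Longrightarrow> 0 \<le> c r"
    using pos_diagonalize[OF q] by metis
  show "positive_in (corner q) a"
    unfolding R(3) using R frame_projection[OF R(1)]
    by (intro positive_in_sum_projections) (auto simp: frame_def)
qed

lemma tr_frame_sum:
  assumes "frame (q::'a::fd_cstar_algebra) R"
  shows "tr (\<Sum>r\<in>R. c r *\<^sub>R r) = complex_of_real (\<Sum>r\<in>R. c r)"
proof -
  have "tr r = 1" if "r \<in> R" for r using assms that tr_minimal by (auto simp: frame_def)
  then show ?thesis by (simp add: tr_sum tr_simps scaleR_conv_of_real)
qed

lemma pos_trace:
  fixes a :: "'a::fd_cstar_algebra"
  assumes "pos a"
  shows "tr a = complex_of_real (rtr a)" "0 \<le> rtr a" "rtr a = 0 \<longleftrightarrow> a = 0"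
proof -
  obtain R c where R: "frame 1 R" "a = (\<Sum>r\<in>R. c r *\<^sub>R r)" "\<And>r. r \<in> R \<Longrightarrow> 0 \<le> c r"
    using pos_diagonalize[OF is_projection_1 assms] by (metis UNIV_I corner_one)
  have t: "tr a = complex_of_real (\<Sum>r\<in>R. c r)"
    using tr_frame_sum[OF R(1)] R(2) by simp
  then show "tr a = complex_of_real (rtr a)" by simp
  show "0 \<le> rtr a" using t R(3) by (simp add: sum_nonneg)
  show "rtr a = 0 \<longleftrightarrow> a = 0"
  proof
    assume "rtr a = 0"
    then have "\<forall>r\<in>R. c r = 0"
      using t R(3) sum_nonneg_eq_0_iff[of R c] R(1) by (simp add: frame_def)
    then show "a = 0" by (simp add: R(2))
  qed (simp add: tr_simps)
qed

lemma tr_star_mult_nonneg: "0 \<le> rtr (star x * (x::'a::fd_cstar_algebra))"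
  using pos_trace posI by blast

text \<open>The form \<open>star b * b\<close> does not reveal that sums of positive elements are
  positive; the quadratic form on the right does.\<close>

lemma pos_iff:
  fixes a :: "'a::fd_cstar_algebra"
  shows "pos a \<longleftrightarrow> star a = a \<and> (\<forall>x. 0 \<le> rtr (star x * a * x))"
proof
  assume "pos a"
  then obtain b where b: "a = star b * b" by (auto simp: positive_in_def)
  have "0 \<le> rtr (star x * a * x)" for x
    using tr_star_mult_nonneg[of "b * x"] by (simp add: b star_mult mult.assoc)
  then show "star a = a \<and> (\<forall>x. 0 \<le> rtr (star x * a * x))"
    by (simp add: b star_mult)
next
  assume a: "star a = a \<and> (\<forall>x. 0 \<le> rtr (star x * a * x))"
  obtain R c where R: "frame 1 R" "\<And>r. r \<in> R \<Longrightarrow> a * r = c r *\<^sub>R r" "a = (\<Sum>r\<in>R. c r *\<^sub>R r)"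
    using diagonalize[of 1 a] a by auto
  have "0 \<le> c r" if "r \<in> R" for r
  proof -
    have min: "minimal_projection_in UNIV r" using R that by (simp add: frame_def)
    have "star r * a * r = c r *\<^sub>R r"
      using R(2)[OF that] minimal_projection_in_UNIV_D[OF min] by (simp add: mult.assoc)
    then have "rtr (star r * a * r) = c r" using tr_minimal[OF min] by (simp add: tr_simps)
    then show ?thesis using a by metis
  qed
  then have "positive_in (corner 1) a"
    unfolding R(3) using R frame_projection[OF R(1)]
    by (intro positive_in_sum_projections) (auto simp: frame_def)
  then show "pos a" by simp
qed

lemma pos_selfadjoint: "pos a \<Longrightarrow> star a = (a::'a::fd_cstar_algebra)"
  by (simp add: pos_iff)

lemma pos_0 [simp]: "pos (0::'a::fd_cstar_algebra)"
  by (simp add: pos_iff tr_simps)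

lemma pos_add: "pos a \<Longrightarrow> pos b \<Longrightarrow> pos (a + b :: 'a::fd_cstar_algebra)"
  by (simp add: pos_iff star_add distrib_left distrib_right tr_simps)

lemma pos_sum:
  fixes a :: "'k \<Rightarrow> 'a::fd_cstar_algebra"
  shows "(\<And>k. k \<in> K \<Longrightarrow> pos (a k)) \<Longrightarrow> pos (\<Sum>k\<in>K. a k)"
  by (induction K rule: infinite_finite_induct) (simp_all add: pos_add)

lemma pos_scaleR: "0 \<le> t \<Longrightarrow> pos a \<Longrightarrow> pos (t *\<^sub>R a :: 'a::fd_cstar_algebra)"
  by (simp add: pos_iff star_scaleR tr_simps)

lemma pos_projection: "is_projection p \<Longrightarrow> pos p"
  by (metis is_projection_def posI)

lemma pos_compress: "pos a \<Longrightarrow> pos (star x * a * x)"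
  unfolding positive_in_def by (metis UNIV_I mult.assoc star_mult)

lemma pos_compress_projection: "is_projection q \<Longrightarrow> pos a \<Longrightarrow> pos (q * a * q)"
  using pos_compress[of a q] by (simp add: is_projectionD)

lemma tr_compress:
  assumes "is_projection r"
  shows "tr (r * b * r) = tr (r * (b::'a::fd_cstar_algebra))"
  using tr_commute[of "r * b" r] assms by (simp add: is_projectionD)

lemma rtr_projection_mult_nonneg:
  assumes "is_projection r" "pos b"
  shows "0 \<le> rtr (r * (b::'a::fd_cstar_algebra))"
  using pos_trace(2)[OF pos_compress_projection[OF assms]] tr_compress[OF assms(1)] by simp

lemma selfadjoint_eq_0I:
  fixes a :: "'a::fd_cstar_algebra"
  assumes "star a = a" "\<And>x. rtr (star x * a * x) = 0"
  shows "a = 0"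
proof -
  have "pos a" using assms by (simp add: pos_iff)
  moreover have "rtr a = 0" using assms(2)[of 1] by simp
  ultimately show ?thesis using pos_trace by blast
qed

section \<open>Entropy\<close>

lemma eta_0 [simp]: "eta 0 = 0" and eta_1 [simp]: "eta 1 = 0"
  by (simp_all add: eta_def)

lemma eta_eq: "0 \<le> t \<Longrightarrow> eta t = - t * ln t"
  by (auto simp: eta_def)

text \<open>The right-hand side is the tangent of the concave function \<open>eta\<close> at
  \<open>u\<close>. \<open>eta_jensen\<close>, \<open>eta_log_sum\<close> and
  \<open>gibbs_variational\<close> sum this bound with suitable points of contact.\<close>

lemma eta_le_tangent:
  assumes "0 \<le> t" "0 < u"
  shows "eta t \<le> u - t - t * ln u"
proof (cases "t = 0")
  case False
  with assms have t: "0 < t" by simp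
  have "ln (u / t) \<le> u / t - 1" using t assms by (intro ln_le_minus_one) simp
  then have "t * ln (u / t) \<le> t * (u / t - 1)" using t by (intro mult_left_mono) auto
  then show ?thesis using t assms by (simp add: eta_def ln_div algebra_simps)
qed (use assms in simp)

lemma eta_le_1: "0 \<le> t \<Longrightarrow> eta t \<le> 1"
  using eta_le_tangent[of t 1] by simp

lemma eta_mult: "0 \<le> s \<Longrightarrow> 0 \<le> t \<Longrightarrow> eta (s * t) = s * eta t + t * eta s"
  by (cases "s = 0"; cases "t = 0") (simp_all add: eta_eq ln_mult algebra_simps)

lemma eta_jensen:
  assumes "finite K" "\<And>k. k \<in> K \<Longrightarrow> 0 \<le> w k" "(\<Sum>k\<in>K. w k) = 1" "\<And>k. k \<in> K \<Longrightarrow> 0 \<le> c k"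
  shows "(\<Sum>k\<in>K. w k * eta (c k)) \<le> eta (\<Sum>k\<in>K. w k * c k)"
proof -
  define u where "u = (\<Sum>k\<in>K. w k * c k)"
  have u: "0 \<le> u" unfolding u_def using assms by (intro sum_nonneg) simp
  show ?thesis
  proof (cases "u = 0")
    case True
    then have "\<forall>k\<in>K. w k * c k = 0"
      using assms sum_nonneg_eq_0_iff[of K "\<lambda>k. w k * c k"] by (simp add: u_def)
    then have "(\<Sum>k\<in>K. w k * eta (c k)) = 0" by (intro sum.neutral) auto
    then show ?thesis using True by (simp add: u_def)
  next
    case False
    have "(\<Sum>k\<in>K. w k * eta (c k)) \<le> (\<Sum>k\<in>K. w k * (u - c k - c k * ln u))"
      using assms u False by (intro sum_mono mult_left_mono eta_le_tangent) auto
    also have "\<dots> = (\<Sum>k\<in>K. w k * u - w k * c k - w k * c k * ln u)"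
      by (simp add: algebra_simps)
    also have "\<dots> = (\<Sum>k\<in>K. w k) * u - u - u * ln u"
      by (simp only: u_def sum_subtractf sum_distrib_right)
    also have "\<dots> = eta u" using assms u by (simp add: eta_eq)
    finally show ?thesis by (simp add: u_def)
  qed
qed

text \<open>The log sum inequality, since \<open>eta t + t * ln p\<close> is
  \<open>- t * ln (t / p)\<close> for positive \<open>t\<close> and \<open>p\<close>. The tangents
  touch at \<open>p k * (T / P)\<close>, where all ratios to \<open>p k\<close> are equal. The bound
  \<open>t k \<le> p k\<close> makes \<open>t k\<close> vanish with \<open>p k\<close>, so
  \<open>ln 0\<close> never carries weight.\<close>

lemma eta_log_sum:
  assumes "finite K" "\<And>k. k \<in> K \<Longrightarrow> 0 \<le> t k \<and> t k \<le> p k"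
  shows "(\<Sum>k\<in>K. eta (t k) + t k * ln (p k)) \<le> eta (\<Sum>k\<in>K. t k) + (\<Sum>k\<in>K. t k) * ln (\<Sum>k\<in>K. p k)"
proof -
  define T P where "T = (\<Sum>k\<in>K. t k)" and "P = (\<Sum>k\<in>K. p k)"
  have T: "0 \<le> T" "T \<le> P" unfolding T_def P_def using assms by (auto intro: sum_nonneg sum_mono)
  show ?thesis
  proof (cases "T = 0")
    case True
    then have "\<forall>k\<in>K. t k = 0"
      using assms sum_nonneg_eq_0_iff[of K t] by (simp add: T_def)
    then show ?thesis using True by (simp add: T_def)
  next
    case False
    have "eta (t k) + t k * ln (p k) \<le> p k * (T / P) - t k - t k * ln (T / P)" if "k \<in> K" for k
    proof (cases "p k = 0")
      case True
      then have "t k = 0" using assms(2)[OF that] by simp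
      then show ?thesis using True by simp
    next
      case pk: False
      then have "0 < p k" using assms(2)[OF that] by linarith
      then have "ln (p k * (T / P)) = ln (p k) + ln (T / P)"
        using T False by (intro ln_mult_pos) auto
      moreover have "eta (t k) \<le> p k * (T / P) - t k - t k * ln (p k * (T / P))"
        using assms(2)[OF that] T False \<open>0 < p k\<close> by (intro eta_le_tangent) auto
      ultimately show ?thesis by (simp add: distrib_left)
    qed
    then have "(\<Sum>k\<in>K. eta (t k) + t k * ln (p k)) \<le> (\<Sum>k\<in>K. p k * (T / P) - t k - t k * ln (T / P))"
      by (intro sum_mono)
    also have "\<dots> = P * (T / P) - T - T * ln (T / P)"
      by (simp add: T_def P_def sum_subtractf flip: sum_distrib_right sum_divide_distrib)
    also have "\<dots> = eta T + T * ln P"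
      using T False by (simp add: eta_eq ln_div algebra_simps)
    finally show ?thesis by (simp add: T_def P_def)
  qed
qed

text \<open>The tangents touch at the Gibbs weights \<open>exp (c i) / Z\<close>, which are the
  maximiser.\<close>

lemma gibbs_variational:
  assumes "finite I" "\<And>i. i \<in> I \<Longrightarrow> 0 \<le> p i" "(\<Sum>i\<in>I. p i) = 1"
  shows "(\<Sum>i\<in>I. eta (p i) + p i * c i) \<le> ln (\<Sum>i\<in>I. exp (c i))"
proof -
  define Z where "Z = (\<Sum>i\<in>I. exp (c i))"
  have "I \<noteq> {}" using assms by auto
  then have Z: "0 < Z" unfolding Z_def using assms by (intro sum_pos) auto
  have "eta (p i) + p i * c i \<le> exp (c i) / Z - p i + p i * ln Z" if "i \<in> I" for i
    using eta_le_tangent[of "p i" "exp (c i) / Z"] assms(2)[OF that] Z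
    by (simp add: ln_div algebra_simps)
  then have "(\<Sum>i\<in>I. eta (p i) + p i * c i) \<le> (\<Sum>i\<in>I. exp (c i) / Z - p i + p i * ln Z)"
    by (intro sum_mono)
  also have "\<dots> = (\<Sum>i\<in>I. exp (c i)) / Z - (\<Sum>i\<in>I. p i) + (\<Sum>i\<in>I. p i) * ln Z"
    by (simp add: sum.distrib sum_subtractf sum_divide_distrib sum_distrib_right)
  also have "\<dots> = ln Z" using Z assms by (simp flip: Z_def)
  finally show ?thesis by (simp add: Z_def)
qed

text \<open>Frees the functional calculus from the normal form in its definition: the values
  \<open>c k\<close> may repeat, and the \<open>r k\<close> need not add up to \<open>q\<close>, the
  missing part carrying the eigenvalue 0, at which \<open>h\<close> vanishes.\<close>

lemma fun_calc_eq:
  fixes q a :: "'a::fd_cstar_algebra" and r :: "'k \<Rightarrow> 'a"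
  assumes q: "is_projection q" and K: "finite K" and r: "\<And>k. k \<in> K \<Longrightarrow> is_projection (r k)"
    and orth: "\<And>k l. k \<in> K \<Longrightarrow> l \<in> K \<Longrightarrow> k \<noteq> l \<Longrightarrow> r k * r l = 0"
    and corner: "\<And>k. k \<in> K \<Longrightarrow> r k \<in> corner q"
    and a: "a = (\<Sum>k\<in>K. c k *\<^sub>R r k)" and h: "h 0 = 0"
  shows "fun_calc (corner q) h a = (\<Sum>k\<in>K. h (c k) *\<^sub>R r k)"
proof -
  define P where "P b \<longleftrightarrow> (\<exists>\<Lambda> p. finite \<Lambda> \<and> (\<forall>l\<in>\<Lambda>. p l \<in> corner q \<and> is_projection (p l)) \<and>
     (\<forall>l\<in>\<Lambda>. \<forall>m\<in>\<Lambda>. l \<noteq> m \<longrightarrow> p l * p m = 0) \<and> (\<forall>x\<in>corner q. (\<Sum>l\<in>\<Lambda>. p l) * x = x) \<and>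
     a = (\<Sum>l\<in>\<Lambda>. l *\<^sub>R p l) \<and> b = (\<Sum>l\<in>\<Lambda>. h l *\<^sub>R p l))" for b
  define s where "s = (\<Sum>k\<in>K. r k)"
  have unique: "b = (\<Sum>k\<in>K. h (c k) *\<^sub>R r k)" if "P b" for b
  proof -
    obtain \<Lambda> p where fin: "finite \<Lambda>" and p [rule_format]: "\<forall>l\<in>\<Lambda>. p l \<in> corner q \<and> is_projection (p l)"
      and po [rule_format]: "\<forall>l\<in>\<Lambda>. \<forall>m\<in>\<Lambda>. l \<noteq> m \<longrightarrow> p l * p m = 0"
      and unit [rule_format]: "\<forall>x\<in>corner q. (\<Sum>l\<in>\<Lambda>. p l) * x = x"
      and ap: "a = (\<Sum>l\<in>\<Lambda>. l *\<^sub>R p l)" and b: "b = (\<Sum>l\<in>\<Lambda>. h l *\<^sub>R p l)"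
      using \<open>P b\<close> unfolding P_def by blast
    have ar: "a * r k = c k *\<^sub>R r k" if "k \<in> K" for k
    proof -
      have "a * r k = (\<Sum>l\<in>K. if l = k then c k *\<^sub>R r k else 0)"
        unfolding a sum_distrib_right using orth r that
        by (intro sum.cong refl) (auto simp: is_projectionD)
      then show ?thesis using K that by simp
    qed
    have pa: "p m * a = m *\<^sub>R p m" if "m \<in> \<Lambda>" for m
    proof -
      have "p m * a = (\<Sum>l\<in>\<Lambda>. if l = m then m *\<^sub>R p m else 0)"
        unfolding ap sum_distrib_left using po p that
        by (intro sum.cong refl) (auto simp: is_projectionD)
      then show ?thesis using fin that by simp
    qed
    \<comment> \<open>Evaluating \<open>p m * a * r k\<close> from both sides shows that
      \<open>p m * r k\<close> is 0 unless \<open>m = c k\<close>.\<close>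
    have hc: "h m *\<^sub>R (p m * r k) = h (c k) *\<^sub>R (p m * r k)" if "m \<in> \<Lambda>" "k \<in> K" for m k
    proof -
      have "p m * a * r k = m *\<^sub>R (p m * r k)" "p m * (a * r k) = c k *\<^sub>R (p m * r k)"
        by (simp_all only: pa[OF that(1)] ar[OF that(2)] mult_scaleR_left mult_scaleR_right)
      then have "m *\<^sub>R (p m * r k) = c k *\<^sub>R (p m * r k)" by (simp only: mult.assoc)
      then show ?thesis by auto
    qed
    have "a * s = (\<Sum>k\<in>K. c k *\<^sub>R r k)" by (simp add: s_def sum_distrib_left ar)
    then have "a * s = a" by (simp only: a)
    moreover have "a * q = a"
      unfolding a sum_distrib_right using corner q by (auto simp: corner_iff)
    \<comment> \<open>\<open>a\<close> annihilates the remainder \<open>q - s\<close>, so among the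
      \<open>p m\<close> only \<open>p 0\<close> can meet it, and \<open>h 0 = 0\<close> removes
      that one from \<open>b\<close>.\<close>
    ultimately have "m *\<^sub>R (p m * (q - s)) = 0" if "m \<in> \<Lambda>" for m
    proof -
      have "m *\<^sub>R (p m * (q - s)) = p m * a * (q - s)" by (simp only: pa[OF that] mult_scaleR_left)
      also have "\<dots> = p m * (a * q - a * s)" by (simp only: mult.assoc right_diff_distrib)
      finally show ?thesis using \<open>a * s = a\<close> \<open>a * q = a\<close> by simp
    qed
    then have "h m *\<^sub>R (p m * (q - s)) = 0" if "m \<in> \<Lambda>" for m
      using that h by (cases "m = 0") force+
    then have "b * (q - s) = 0"
      unfolding b sum_distrib_right mult_scaleR_left by (rule sum.neutral[OF ballI])
    moreover have "b * q = b"
      unfolding b sum_distrib_right using p q by (auto simp: corner_iff)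
    ultimately have "b = b * s" by (simp add: algebra_simps)
    also have "\<dots> = (\<Sum>k\<in>K. \<Sum>m\<in>\<Lambda>. h m *\<^sub>R (p m * r k))"
      by (simp add: b s_def sum_distrib_left sum_distrib_right sum.swap[of _ \<Lambda>])
    also have "\<dots> = (\<Sum>k\<in>K. h (c k) *\<^sub>R ((\<Sum>m\<in>\<Lambda>. p m) * r k))"
      by (simp add: hc sum_distrib_right scaleR_sum_right)
    also have "\<dots> = (\<Sum>k\<in>K. h (c k) *\<^sub>R r k)" by (simp add: unit corner)
    finally show ?thesis .
  qed
  have "star a = a" by (simp add: a star_sum star_scaleR is_projectionD r)
  moreover have "a \<in> corner q"
    unfolding a by (intro cvs.subspace_sum[OF subspace_corner] scaleR_in_corner corner)
  ultimately obtain R d where R: "frame q R" "\<And>r. r \<in> R \<Longrightarrow> r \<in> corner q"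
    "a = (\<Sum>r\<in>R. d r *\<^sub>R r)"
    using diagonalize[OF q] by metis
  have finR: "finite R" and sumR: "\<Sum>R = q"
    and orthR: "\<And>r s. r \<in> R \<Longrightarrow> s \<in> R \<Longrightarrow> r \<noteq> s \<Longrightarrow> r * s = 0"
    using R(1) by (auto simp: frame_def)
  \<comment> \<open>The definition indexes the projections by eigenvalues, so frame members with a
    common eigenvalue are merged.\<close>
  define p where "p l = \<Sum>{r \<in> R. d r = l}" for l
  have group: "(\<Sum>r\<in>R. f (d r) *\<^sub>R r) = (\<Sum>l\<in>d ` R. f l *\<^sub>R p l)" for f :: "real \<Rightarrow> real"
    unfolding p_def by (subst sum.image_gen[OF finR, of _ d]) (auto simp: scaleR_sum_right intro!: sum.cong)
  have "P (\<Sum>r\<in>R. h (d r) *\<^sub>R r)"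
    unfolding P_def
  proof (intro exI[of _ "d ` R"] exI[of _ p] conjI ballI impI)
    show "p l \<in> corner q" for l
      unfolding p_def using R(2) by (intro cvs.subspace_sum[OF subspace_corner]) auto
    show "is_projection (p l)" for l
      unfolding p_def
      by (rule is_projection_sum) (use finR orthR frame_projection[OF R(1)] in auto)
    show "p l * p m = 0" if "l \<noteq> m" for l m
      unfolding p_def sum_product using that orthR by (intro sum.neutral ballI) auto
    show "(\<Sum>l\<in>d ` R. p l) * x = x" if "x \<in> corner q" for x
      using group[of "\<lambda>_. 1"] that q sumR by (simp add: corner_iff)
    show "a = (\<Sum>l\<in>d ` R. l *\<^sub>R p l)"
      using group[of "\<lambda>x. x"] R(3) by simp
    show "(\<Sum>r\<in>R. h (d r) *\<^sub>R r) = (\<Sum>l\<in>d ` R. h l *\<^sub>R p l)" by (rule group)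
  qed (use finR in simp)
  \<comment> \<open>Existence for \<open>THE\<close>: the diagonalisation supplies a value
    satisfying \<open>P\<close>, and \<open>unique\<close> identifies it with the given sum.\<close>
  then have "P (\<Sum>k\<in>K. h (c k) *\<^sub>R r k)" using unique by metis
  then have "(THE b. P b) = (\<Sum>k\<in>K. h (c k) *\<^sub>R r k)"
    by (rule the_equality) (rule unique)
  then show ?thesis by (simp only: fun_calc_def P_def)
qed

lemma entropy_eq:
  fixes q a :: "'a::fd_cstar_algebra" and r :: "'k \<Rightarrow> 'a"
  assumes "is_projection q" "finite K" "\<And>k. k \<in> K \<Longrightarrow> is_projection (r k)"
    and "\<And>k l. k \<in> K \<Longrightarrow> l \<in> K \<Longrightarrow> k \<noteq> l \<Longrightarrow> r k * r l = 0"
    and corner: "\<And>k. k \<in> K \<Longrightarrow> r k \<in> corner q"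
    and "a = (\<Sum>k\<in>K. c k *\<^sub>R r k)"
  shows "entropy (corner q) a = (\<Sum>k\<in>K. eta (c k) * rtr (r k))"
proof -
  have "fun_calc (corner q) eta a = (\<Sum>k\<in>K. eta (c k) *\<^sub>R r k)"
    using assms by (intro fun_calc_eq) auto
  moreover have "(\<Sum>k\<in>K. eta (c k) *\<^sub>R r k) \<in> corner q"
    by (intro cvs.subspace_sum[OF subspace_corner] scaleR_in_corner corner)
  ultimately show ?thesis
    using Tr_corner[OF assms(1)] by (simp add: entropy_def tr_sum tr_simps)
qed

lemmas entropy_UNIV_eq = entropy_eq[OF is_projection_1, unfolded corner_one, simplified]

lemma frame_tr: "frame q R \<Longrightarrow> r \<in> R \<Longrightarrow> tr (r::'a::fd_cstar_algebra) = 1"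
  by (auto simp: frame_def intro: tr_minimal)

text \<open>Collects what later proofs read off a spectral decomposition. Expressing eigenvalues as
  \<open>rtr (r * a)\<close> allows several operators to be compared in one frame.\<close>

lemma pos_diagonalize_entropy:
  fixes a q :: "'a::fd_cstar_algebra"
  assumes q: "is_projection q" and a: "pos a" "a \<in> corner q"
  obtains R c where "frame q R" "\<forall>r\<in>R. r \<in> corner q" "a = (\<Sum>r\<in>R. c r *\<^sub>R r)"
    "\<forall>r\<in>R. 0 \<le> c r" "\<forall>r\<in>R. c r = rtr (r * a)"
    "entropy UNIV a = (\<Sum>r\<in>R. eta (c r))" "entropy (corner q) a = (\<Sum>r\<in>R. eta (c r))"
    "rtr a = (\<Sum>r\<in>R. c r)"
proof -
  obtain R c where R [rule_format]: "frame q R" "\<forall>r\<in>R. r \<in> corner q"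
    "\<forall>r\<in>R. a * r = c r *\<^sub>R r" "a = (\<Sum>r\<in>R. c r *\<^sub>R r)" "\<forall>r\<in>R. 0 \<le> c r"
    by (rule pos_diagonalize[OF assms])
  have t: "rtr r = 1" if "r \<in> R" for r using frame_tr[OF R(1) that] by simp
  have "entropy UNIV a = (\<Sum>r\<in>R. eta (c r) * rtr r)"
    using R frame_projection[OF R(1)] by (intro entropy_UNIV_eq) (auto simp: frame_def)
  then have ent: "entropy UNIV a = (\<Sum>r\<in>R. eta (c r))" by (simp add: t)
  have "entropy (corner q) a = (\<Sum>r\<in>R. eta (c r) * rtr r)"
    using R frame_projection[OF R(1)] by (intro entropy_eq q) (auto simp: frame_def)
  then have ent': "entropy (corner q) a = (\<Sum>r\<in>R. eta (c r))" by (simp add: t)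
  have c: "\<forall>r\<in>R. c r = rtr (r * a)"
  proof
    fix r assume "r \<in> R"
    have "tr (r * a) = tr (a * r)" by (rule tr_commute)
    then show "c r = rtr (r * a)" by (simp only: R(3)[OF \<open>r \<in> R\<close>]) (simp add: tr_simps t[OF \<open>r \<in> R\<close>])
  qed
  have "rtr a = (\<Sum>r\<in>R. c r)"
    by (subst R(4)) (simp only: tr_frame_sum[OF R(1)] Re_complex_of_real)
  with R(1,2,4,5) c ent ent' show ?thesis by (intro that[of R c]) blast+
qed

lemma pos_diagonalize_entropy_UNIV:
  fixes b :: "'a::fd_cstar_algebra"
  assumes "pos b"
  obtains R c where "frame 1 R" "b = (\<Sum>r\<in>R. c r *\<^sub>R r)" "\<forall>r\<in>R. 0 \<le> c r"
    "\<forall>r\<in>R. c r = rtr (r * b)" "entropy UNIV b = (\<Sum>r\<in>R. eta (c r))"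
    "rtr b = (\<Sum>r\<in>R. c r)"
  by (rule pos_diagonalize_entropy[OF is_projection_1 assms, unfolded corner_one, OF UNIV_I]) (rule that)

text \<open>Outside the corner \<open>a\<close> only acquires eigenvalues 0, and
  \<open>eta 0 = 0\<close>; entropies can thus be computed in the ambient algebra.\<close>

lemma entropy_corner:
  fixes q a :: "'a::fd_cstar_algebra"
  assumes "is_projection q" "pos a" "a \<in> corner q"
  shows "entropy (corner q) a = entropy UNIV a"
  by (rule pos_diagonalize_entropy[OF assms]) simp

lemma entropy_0 [simp]: "entropy UNIV (0::'a::fd_cstar_algebra) = 0"
  using entropy_UNIV_eq[of "{}" "\<lambda>_. 0" 0 "\<lambda>_. 0"] by simp

text \<open>The overlaps \<open>rtr (s * r)\<close> of two frames form a doubly stochastic matrix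
  that turns the eigenvalues of \<open>b\<close> into its diagonal entries
  \<open>rtr (s * b)\<close>. One family of sums expands the entropy, the other provides the weights
  for Jensen.\<close>

lemma entropy_le_frame:
  fixes b :: "'a::fd_cstar_algebra"
  assumes R: "frame 1 R" and b: "pos b"
  shows "entropy UNIV b \<le> (\<Sum>s\<in>R. eta (rtr (s * b)))"
proof -
  obtain R' c where R' [rule_format]: "frame 1 R'" "b = (\<Sum>r\<in>R'. c r *\<^sub>R r)" "\<forall>r\<in>R'. 0 \<le> c r"
    "\<forall>r\<in>R'. c r = rtr (r * b)"
    and ent: "entropy UNIV b = (\<Sum>r\<in>R'. eta (c r))" "rtr b = (\<Sum>r\<in>R'. c r)"
    by (rule pos_diagonalize_entropy_UNIV[OF b])
  have fin: "finite R" "finite R'" "\<Sum>R = 1" "\<Sum>R' = 1"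
    using R R' by (auto simp: frame_def)
  have w0: "0 \<le> rtr (s * r)" if "s \<in> R" "r \<in> R'" for s r
    using frame_projection[OF R that(1)] frame_projection[OF R'(1) that(2)]
    by (intro rtr_projection_mult_nonneg pos_projection)
  have w1: "(\<Sum>r\<in>R'. rtr (s * r)) = 1" if "s \<in> R" for s
  proof -
    have "(\<Sum>r\<in>R'. rtr (s * r)) = rtr (s * \<Sum>R')" by (simp add: sum_distrib_left tr_sum)
    then show ?thesis using fin frame_tr[OF R that] by simp
  qed
  have w2: "(\<Sum>s\<in>R. rtr (s * r)) = 1" if "r \<in> R'" for r
  proof -
    have "(\<Sum>s\<in>R. rtr (s * r)) = rtr (\<Sum>R * r)" by (simp add: sum_distrib_right tr_sum)
    then show ?thesis using fin frame_tr[OF R'(1) that] by simp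
  qed
  have "entropy UNIV b = (\<Sum>r\<in>R'. (\<Sum>s\<in>R. rtr (s * r)) * eta (c r))"
    by (simp add: ent w2)
  also have "\<dots> = (\<Sum>s\<in>R. \<Sum>r\<in>R'. rtr (s * r) * eta (c r))"
    by (simp add: sum_distrib_right sum.swap[of _ R])
  also have "\<dots> \<le> (\<Sum>s\<in>R. eta (\<Sum>r\<in>R'. rtr (s * r) * c r))"
    using w0 w1 R'(3) fin by (intro sum_mono eta_jensen) auto
  also have "\<dots> = (\<Sum>s\<in>R. eta (rtr (s * b)))"
    by (simp add: R'(2) sum_distrib_left tr_sum tr_simps mult.commute)
  finally show ?thesis .
qed

lemma entropy_scaleR:
  fixes b :: "'a::fd_cstar_algebra"
  assumes b: "pos b" and t: "0 \<le> t"
  shows "entropy UNIV (t *\<^sub>R b) = t * entropy UNIV b + eta t * rtr b"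
proof -
  obtain R c where R [rule_format]: "frame 1 R" "b = (\<Sum>r\<in>R. c r *\<^sub>R r)" "\<forall>r\<in>R. 0 \<le> c r"
    "\<forall>r\<in>R. c r = rtr (r * b)"
    and ent: "entropy UNIV b = (\<Sum>r\<in>R. eta (c r))" "rtr b = (\<Sum>r\<in>R. c r)"
    by (rule pos_diagonalize_entropy_UNIV[OF b])
  have tr: "rtr r = 1" if "r \<in> R" for r using frame_tr[OF R(1) that] by simp
  have tb: "t *\<^sub>R b = (\<Sum>r\<in>R. (t * c r) *\<^sub>R r)"
    by (subst R(2)) (simp add: scaleR_sum_right)
  have "entropy UNIV (t *\<^sub>R b) = (\<Sum>r\<in>R. eta (t * c r) * rtr r)"
    using R(1) frame_projection[OF R(1)] tb by (intro entropy_UNIV_eq) (auto simp: frame_def)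
  also have "\<dots> = t * entropy UNIV b + eta t * rtr b"
    using t R(3) by (simp add: tr ent eta_mult sum.distrib sum_distrib_left mult.commute)
  finally show ?thesis .
qed

text \<open>For \<open>p = Tr(b) > 0\<close> this is \<open>p S(b/p)\<close>; it is homogeneous in \<open>b\<close>.\<close>

definition hom_entropy :: "'a::cstar_algebra \<Rightarrow> real" where
  "hom_entropy b = entropy UNIV b - eta (rtr b)"

lemma hom_entropy_0 [simp]: "hom_entropy (0::'a::fd_cstar_algebra) = 0"
  by (simp add: hom_entropy_def tr_simps)

lemma hom_entropy_scaleR:
  fixes b :: "'a::fd_cstar_algebra"
  assumes "pos b" "0 \<le> t"
  shows "hom_entropy (t *\<^sub>R b) = t * hom_entropy b"
  using pos_trace[OF assms(1)] assms
  by (simp add: hom_entropy_def entropy_scaleR tr_simps eta_mult algebra_simps)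

lemma hom_entropy_nonneg:
  fixes b :: "'a::fd_cstar_algebra"
  assumes b: "pos b"
  shows "0 \<le> hom_entropy b"
proof -
  obtain R c where R [rule_format]: "frame 1 R" "b = (\<Sum>r\<in>R. c r *\<^sub>R r)" "\<forall>r\<in>R. 0 \<le> c r"
    "\<forall>r\<in>R. c r = rtr (r * b)"
    and ent: "entropy UNIV b = (\<Sum>r\<in>R. eta (c r))" "rtr b = (\<Sum>r\<in>R. c r)"
    by (rule pos_diagonalize_entropy_UNIV[OF b])
  have fin: "finite R" using R by (simp add: frame_def)
  define p where "p = (\<Sum>r\<in>R. c r)"
  have "0 \<le> eta (c r) + c r * ln p" if "r \<in> R" for r
  proof (cases "c r = 0")
    case False
    then have "0 < c r" "c r \<le> p"
      using R(3)[OF that] member_le_sum[OF that _ fin, of c] R(3) by (auto simp: p_def)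
    then have "ln (c r) \<le> ln p" by simp
    then show ?thesis using \<open>0 < c r\<close> by (simp add: eta_eq flip: right_diff_distrib)
  qed simp
  then have "0 \<le> (\<Sum>r\<in>R. eta (c r) + c r * ln p)" by (intro sum_nonneg)
  also have "\<dots> = hom_entropy b"
  proof -
    have "0 \<le> p" unfolding p_def using R(3) by (rule sum_nonneg)
    then have "(\<Sum>r\<in>R. c r * ln p) = - eta p" by (simp add: eta_eq p_def flip: sum_distrib_right)
    then show ?thesis by (simp add: hom_entropy_def ent sum.distrib p_def)
  qed
  finally show ?thesis .
qed

text \<open>For a homogeneous function superadditivity is concavity. In the eigenframe of the sum,
  passing to diagonals can only increase the terms on the left and leaves the right-hand side
  unchanged; what remains is \<open>eta_log_sum\<close> for each frame member.\<close>

lemma hom_entropy_superadditive: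
  fixes b :: "'k \<Rightarrow> 'a::fd_cstar_algebra"
  assumes K: "finite K" and b: "\<And>k. k \<in> K \<Longrightarrow> pos (b k)"
  shows "(\<Sum>k\<in>K. hom_entropy (b k)) \<le> hom_entropy (\<Sum>k\<in>K. b k)"
proof -
  define B where "B = (\<Sum>k\<in>K. b k)"
  have "pos B" unfolding B_def using b by (rule pos_sum)
  then obtain R c where R [rule_format]: "frame 1 R" "B = (\<Sum>r\<in>R. c r *\<^sub>R r)" "\<forall>r\<in>R. 0 \<le> c r"
    "\<forall>r\<in>R. c r = rtr (r * B)"
    and ent: "entropy UNIV B = (\<Sum>r\<in>R. eta (c r))" "rtr B = (\<Sum>r\<in>R. c r)"
    by (rule pos_diagonalize_entropy_UNIV)
  have sumR: "\<Sum>R = 1" "finite R" using R(1) by (auto simp: frame_def)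
  define t where "t k r = rtr (r * b k)" for k r
  have t0: "0 \<le> t k r" if "k \<in> K" "r \<in> R" for k r
    unfolding t_def using frame_projection[OF R(1) that(2)] b[OF that(1)]
    by (intro rtr_projection_mult_nonneg)
  have p: "rtr (b k) = (\<Sum>r\<in>R. t k r)" for k
  proof -
    have "rtr (b k) = rtr (\<Sum>R * b k)" by (simp add: sumR)
    then show ?thesis by (simp add: t_def sum_distrib_right tr_sum)
  qed
  have c: "c r = (\<Sum>k\<in>K. t k r)" if "r \<in> R" for r
    using R(4)[OF that] by (simp add: t_def B_def sum_distrib_left tr_sum)
  have tp: "t k r \<le> rtr (b k)" if "k \<in> K" "r \<in> R" for k r
    unfolding p using t0 that sumR by (intro member_le_sum) auto
  have "hom_entropy (b k) \<le> (\<Sum>r\<in>R. eta (t k r) + t k r * ln (rtr (b k)))" if "k \<in> K" for k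
  proof -
    have "(\<Sum>r\<in>R. t k r * ln (rtr (b k))) = - eta (rtr (b k))"
      using pos_trace(2)[OF b[OF that]] p[of k] by (simp add: eta_eq flip: sum_distrib_right)
    then show ?thesis
      using entropy_le_frame[OF R(1) b[OF that]] by (simp add: hom_entropy_def sum.distrib t_def)
  qed
  then have "(\<Sum>k\<in>K. hom_entropy (b k))
      \<le> (\<Sum>k\<in>K. \<Sum>r\<in>R. eta (t k r) + t k r * ln (rtr (b k)))"
    by (intro sum_mono)
  also have "\<dots> = (\<Sum>r\<in>R. \<Sum>k\<in>K. eta (t k r) + t k r * ln (rtr (b k)))"
    by (rule sum.swap)
  also have "\<dots> \<le> (\<Sum>r\<in>R. eta (\<Sum>k\<in>K. t k r) + (\<Sum>k\<in>K. t k r) * ln (\<Sum>k\<in>K. rtr (b k)))"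
    using t0 tp K by (intro sum_mono eta_log_sum) auto
  also have "\<dots> = (\<Sum>r\<in>R. eta (c r) + c r * ln (rtr B))"
    by (simp add: c B_def tr_sum)
  also have "\<dots> = hom_entropy B"
    using pos_trace(2)[OF \<open>pos B\<close>] ent
    by (simp add: hom_entropy_def sum.distrib eta_eq flip: sum_distrib_right)
  finally show ?thesis by (simp add: B_def)
qed

text \<open>Both products have the same nonzero eigenvalues with the same multiplicities, because
  \<open>x\<close> carries eigenprojections of \<open>star x * x\<close> to eigenprojections of
  \<open>x * star x\<close>.\<close>

lemma hom_entropy_swap:
  fixes x :: "'a::fd_cstar_algebra"
  shows "hom_entropy (star x * x) = hom_entropy (x * star x)"
proof -
  obtain R c where R [rule_format]: "frame 1 R" "\<forall>r\<in>R. r \<in> corner 1"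
    "\<forall>r\<in>R. (star x * x) * r = c r *\<^sub>R r" "star x * x = (\<Sum>r\<in>R. c r *\<^sub>R r)"
    "\<forall>r\<in>R. 0 \<le> c r"
    by (rule pos_diagonalize[OF is_projection_1 posI[of x], unfolded corner_one, OF UNIV_I]) auto
  have fin: "finite R" and sumR: "\<Sum>R = 1"
    and orth: "\<And>r s. r \<in> R \<Longrightarrow> s \<in> R \<Longrightarrow> r \<noteq> s \<Longrightarrow> r * s = 0"
    using R(1) by (auto simp: frame_def)
  note proj = frame_projection(1)[OF R(1)]
  define K where "K = {r \<in> R. c r \<noteq> 0}"
  have x0: "x * r = 0" if "r \<in> R - K" for r
  proof -
    have "star (x * r) * (x * r) = r * (star x * x * r)"
      using proj[of r] that by (simp add: star_mult mult.assoc is_projectionD)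
    also have "\<dots> = 0" using R(3)[of r] that by (auto simp: K_def)
    finally show ?thesis by simp
  qed
  \<comment> \<open>For \<open>r\<close> in \<open>K\<close> the element \<open>x * r\<close> is
    \<open>sqrt (c r)\<close> times a partial isometry with initial projection \<open>r\<close>;
    \<open>f r\<close> is its final projection.\<close>
  define f where "f r = (1 / c r) *\<^sub>R (x * r * star x)" for r
  have ff: "f r * f s = (1 / c r * (1 / c s) * c s) *\<^sub>R (x * (r * s) * star x)" if "r \<in> K" "s \<in> K" for r s
  proof -
    have "f r * f s = (1 / c r * (1 / c s)) *\<^sub>R (x * r * (star x * x * s) * star x)"
      by (simp add: f_def mult.assoc)
    also have "star x * x * s = c s *\<^sub>R s" using R(3) that by (simp add: K_def)
    finally show ?thesis by (simp add: mult.assoc)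
  qed
  have f: "is_projection (f r)" if "r \<in> K" for r
  proof -
    have r: "r \<in> R" "c r \<noteq> 0" using that by (auto simp: K_def)
    have "star (f r) = f r" using proj[OF r(1)]
      by (simp add: f_def star_scaleR star_mult mult.assoc is_projectionD)
    moreover have "f r * f r = f r"
      unfolding ff[OF that that] using proj[OF r(1)] r by (simp add: is_projectionD f_def)
    ultimately show ?thesis by (simp add: is_projection_def)
  qed
  have fo: "f r * f s = 0" if "r \<in> K" "s \<in> K" "r \<noteq> s" for r s
    using ff[OF that(1,2)] orth[of r s] that by (simp add: K_def)
  have "x * star x = x * \<Sum>R * star x" by (simp add: sumR)
  also have "\<dots> = (\<Sum>r\<in>R. x * r * star x)" by (simp add: sum_distrib_left sum_distrib_right)
  also have "\<dots> = (\<Sum>r\<in>K. x * r * star x)"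
    using x0 fin by (intro sum.mono_neutral_right) (auto simp: K_def)
  also have "\<dots> = (\<Sum>r\<in>K. c r *\<^sub>R f r)" by (intro sum.cong) (auto simp: f_def K_def)
  finally have xx: "x * star x = (\<Sum>r\<in>K. c r *\<^sub>R f r)" .
  have tf: "rtr (f r) = rtr r" if "r \<in> K" for r
  proof -
    have "tr (x * r * star x) = tr (star x * x * r)"
      using tr_commute[of "x * r" "star x"] by (simp add: mult.assoc)
    also have "\<dots> = c r * tr r" using R(3)[of r] that by (simp add: K_def tr_simps scaleR_conv_of_real)
    finally show ?thesis using that by (simp add: f_def tr_simps K_def)
  qed
  have "entropy UNIV (x * star x) = (\<Sum>r\<in>K. eta (c r) * rtr (f r))"
    using fin f fo xx by (intro entropy_UNIV_eq) (auto simp: K_def)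
  also have "\<dots> = (\<Sum>r\<in>K. eta (c r) * rtr r)" by (simp add: tf)
  also have "\<dots> = (\<Sum>r\<in>R. eta (c r) * rtr r)"
    using fin by (intro sum.mono_neutral_left) (auto simp: K_def)
  also have "\<dots> = entropy UNIV (star x * x)"
    using fin proj orth R(4) by (intro entropy_UNIV_eq[symmetric]) auto
  finally show ?thesis by (simp add: hom_entropy_def tr_commute[of x])
qed

text \<open>Compress the sum by \<open>q j\<close> and cancel the term \<open>k = j\<close>: the
  remaining \<open>q j * q k * q j = star (q k * q j) * (q k * q j)\<close> add up to 0, and
  positive elements with sum 0 vanish.\<close>

lemma projections_sum_1_orth:
  fixes q :: "'i \<Rightarrow> 'a::fd_cstar_algebra"
  assumes I: "finite I" "\<And>i. i \<in> I \<Longrightarrow> is_projection (q i)" "(\<Sum>i\<in>I. q i) = 1"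
    and ij: "i \<in> I" "j \<in> I" "i \<noteq> j"
  shows "q i * q j = 0"
proof -
  have eq: "star (q k * q j) * (q k * q j) = q j * q k * q j" if "k \<in> I" for k
    using I(2)[OF that] I(2)[OF ij(2)] by (simp add: star_mult mult.assoc is_projectionD)
  have "(\<Sum>k\<in>I. q j * q k * q j) = q j * (\<Sum>k\<in>I. q k) * q j"
    by (simp add: sum_distrib_left sum_distrib_right)
  also have "\<dots> = q j * q j * q j" using I(2)[OF ij(2)] by (simp add: I(3) is_projectionD)
  finally have "(\<Sum>k\<in>I - {j}. q j * q k * q j) = 0"
    using ij I(1) by (simp add: sum.remove[of I j])
  then have "(\<Sum>k\<in>I - {j}. rtr (q j * q k * q j)) = 0"
    by (metis Re_sum complex.sel(1) tr_simps(3) tr_sum zero_complex.code)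
  moreover have "0 \<le> rtr (q j * q k * q j)" if "k \<in> I" for k
    using eq[OF that] tr_star_mult_nonneg by metis
  ultimately have "rtr (q j * q i * q j) = 0"
    using sum_nonneg_eq_0_iff[of "I - {j}" "\<lambda>k. rtr (q j * q k * q j)"] I(1) ij by auto
  then have "star (q i * q j) * (q i * q j) = 0"
    using eq[OF ij(1)] pos_trace(3)[OF posI] by metis
  then show ?thesis by simp
qed

lemma frame_Union:
  fixes q :: "'i \<Rightarrow> 'a::cstar_algebra"
  assumes I: "finite I" "\<And>i j. i \<in> I \<Longrightarrow> j \<in> I \<Longrightarrow> i \<noteq> j \<Longrightarrow> q i * q j = 0"
    and R: "\<And>i. i \<in> I \<Longrightarrow> frame (q i) (R i)"
  shows "frame (\<Sum>i\<in>I. q i) (\<Union>i\<in>I. R i)"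
    "\<And>g. (\<Sum>r\<in>(\<Union>i\<in>I. R i). g r) = (\<Sum>i\<in>I. \<Sum>r\<in>R i. g r)"
proof -
  have orth: "r * s = 0" if "i \<in> I" "j \<in> I" "i \<noteq> j" "r \<in> R i" "s \<in> R j" for i j r s
  proof -
    have "r * s = r * (q i * q j) * s"
      using frame_mult[OF R[OF that(1)] that(4)] frame_mult[OF R[OF that(2)] that(5)]
      by (metis mult.assoc)
    then show ?thesis using I(2)[OF that(1-3)] by simp
  qed
  have disj: "R i \<inter> R j = {}" if "i \<in> I" "j \<in> I" "i \<noteq> j" for i j
    using orth[OF that] frame_projection[OF R[OF that(1)]] by (fastforce simp: is_projection_def)
  have fin: "finite (R i)" if "i \<in> I" for i using R[OF that] by (simp add: frame_def)
  show sum: "(\<Sum>r\<in>(\<Union>i\<in>I. R i). g r) = (\<Sum>i\<in>I. \<Sum>r\<in>R i. g r)" for g :: "'a \<Rightarrow> 'c::comm_monoid_add"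
    using I(1) fin disj by (intro sum.UNION_disjoint) auto
  show "frame (\<Sum>i\<in>I. q i) (\<Union>i\<in>I. R i)"
    unfolding frame_def
  proof (intro conjI ballI impI)
    show "finite (\<Union>i\<in>I. R i)" using I fin by blast
    show "minimal_projection_in UNIV r" if "r \<in> (\<Union>i\<in>I. R i)" for r
      using that R by (auto simp: frame_def)
    show "r * s = 0" if "r \<in> (\<Union>i\<in>I. R i)" "s \<in> (\<Union>i\<in>I. R i)" "r \<noteq> s" for r s
    proof -
      obtain i j where ij: "i \<in> I" "j \<in> I" "r \<in> R i" "s \<in> R j" using \<open>r \<in> _\<close> \<open>s \<in> _\<close> by blast
      then show ?thesis
        using orth[OF ij(1,2) _ ij(3,4)] R[OF ij(1)] \<open>r \<noteq> s\<close> by (cases "i = j") (auto simp: frame_def)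
    qed
    show "\<Sum>(\<Union>i\<in>I. R i) = (\<Sum>i\<in>I. q i)"
      using sum[of "\<lambda>r. r"] R by (simp add: frame_def)
  qed
qed

lemma hom_entropy_pinching:
  fixes q :: "'i \<Rightarrow> 'a::fd_cstar_algebra"
  assumes I: "finite I" "\<And>i. i \<in> I \<Longrightarrow> is_projection (q i)" "(\<Sum>i\<in>I. q i) = 1" and b: "pos b"
  shows "(\<Sum>i\<in>I. hom_entropy (q i * b * q i)) \<le> hom_entropy b"
proof -
  obtain y where y: "b = star y * y" using b by (auto simp: positive_in_def)
  have "hom_entropy (q i * b * q i) = hom_entropy (y * q i * star y)" if "i \<in> I" for i
    using hom_entropy_swap[of "y * q i"] I(2)[OF that]
    by (simp add: star_mult y mult.assoc is_projectionD)
  then have "(\<Sum>i\<in>I. hom_entropy (q i * b * q i)) = (\<Sum>i\<in>I. hom_entropy (y * q i * star y))"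
    by simp
  also have "\<dots> \<le> hom_entropy (\<Sum>i\<in>I. y * q i * star y)"
  proof (rule hom_entropy_superadditive[OF I(1)])
    show "pos (y * q i * star y)" if "i \<in> I" for i
      using pos_compress[OF pos_projection[OF I(2)[OF that]], of "star y"] by simp
  qed
  also have "(\<Sum>i\<in>I. y * q i * star y) = y * star y"
    by (simp add: I(3) flip: sum_distrib_left sum_distrib_right)
  finally show ?thesis by (simp add: y hom_entropy_swap)
qed

text \<open>The eigenframes of the compressions together form a frame of 1. Each member
  \<open>r\<close> lies below its \<open>q i\<close>, so its eigenvalue is the diagonal entry
  \<open>rtr (r * b)\<close> of \<open>b\<close> itself and \<open>entropy_le_frame\<close>
  applies.\<close>

lemma entropy_pinching:
  fixes q :: "'i \<Rightarrow> 'a::fd_cstar_algebra"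
  assumes I: "finite I" "\<And>i. i \<in> I \<Longrightarrow> is_projection (q i)" "(\<Sum>i\<in>I. q i) = 1" and b: "pos b"
  shows "entropy UNIV b \<le> (\<Sum>i\<in>I. entropy UNIV (q i * b * q i))"
proof -
  have "\<exists>R. frame (q i) R \<and> entropy UNIV (q i * b * q i) = (\<Sum>r\<in>R. eta (rtr (r * b)))"
    if "i \<in> I" for i
  proof -
    note qi = I(2)[OF that]
    obtain R c where R [rule_format]: "frame (q i) R" "\<forall>r\<in>R. r \<in> corner (q i)"
      "q i * b * q i = (\<Sum>r\<in>R. c r *\<^sub>R r)" "\<forall>r\<in>R. 0 \<le> c r"
      "\<forall>r\<in>R. c r = rtr (r * (q i * b * q i))"
      "entropy UNIV (q i * b * q i) = (\<Sum>r\<in>R. eta (c r))"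
      "entropy (corner (q i)) (q i * b * q i) = (\<Sum>r\<in>R. eta (c r))"
      "rtr (q i * b * q i) = (\<Sum>r\<in>R. c r)"
      by (rule pos_diagonalize_entropy[OF qi pos_compress_projection[OF qi b] compress_in_corner])
    have "rtr (r * (q i * b * q i)) = rtr (r * b)" if "r \<in> R" for r
    proof -
      have "tr (r * (q i * b * q i)) = tr (r * q i * b * q i)" by (simp only: mult.assoc)
      also have "\<dots> = tr (q i * (r * b))"
        by (simp only: frame_mult[OF R(1) that] tr_commute[of "r * b"])
      also have "\<dots> = tr (r * b)" by (simp only: frame_mult[OF R(1) that] flip: mult.assoc)
      finally show ?thesis by simp
    qed
    then have "entropy UNIV (q i * b * q i) = (\<Sum>r\<in>R. eta (rtr (r * b)))"
      unfolding R(6) using R(5) by (intro sum.cong refl) simp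
    with R(1) show ?thesis by blast
  qed
  then obtain R where R: "\<And>i. i \<in> I \<Longrightarrow> frame (q i) (R i)"
    "\<And>i. i \<in> I \<Longrightarrow> entropy UNIV (q i * b * q i) = (\<Sum>r\<in>R i. eta (rtr (r * b)))"
    by metis
  note U = frame_Union[of I q R, OF I(1) projections_sum_1_orth[OF I] R(1)]
  have "frame 1 (\<Union>i\<in>I. R i)" using U(1) I(3) by simp
  from entropy_le_frame[OF this b] show ?thesis by (simp add: U(2) R(2))
qed

text \<open>The eigenframes of the \<open>b i\<close> together diagonalise the sum.\<close>

lemma entropy_orth_sum:
  fixes q b :: "'i \<Rightarrow> 'a::fd_cstar_algebra"
  assumes I: "finite I" "\<And>i. i \<in> I \<Longrightarrow> is_projection (q i)" "(\<Sum>i\<in>I. q i) = 1"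
    and b: "\<And>i. i \<in> I \<Longrightarrow> pos (b i)" "\<And>i. i \<in> I \<Longrightarrow> b i \<in> corner (q i)"
  shows "entropy UNIV (\<Sum>i\<in>I. b i) = (\<Sum>i\<in>I. entropy UNIV (b i))"
proof -
  \<comment> \<open>Eigenvalues are recorded as traces: because \<open>r * B = r * b i\<close>, they
    become a single function of \<open>r\<close> on the union of the frames.\<close>
  have "\<forall>i\<in>I. \<exists>R. frame (q i) R \<and> b i = (\<Sum>r\<in>R. rtr (r * b i) *\<^sub>R r)
      \<and> entropy UNIV (b i) = (\<Sum>r\<in>R. eta (rtr (r * b i)))"
  proof
    fix i assume "i \<in> I"
    obtain R c where R [rule_format]: "frame (q i) R" "\<forall>r\<in>R. r \<in> corner (q i)"
      "b i = (\<Sum>r\<in>R. c r *\<^sub>R r)" "\<forall>r\<in>R. 0 \<le> c r" "\<forall>r\<in>R. c r = rtr (r * b i)"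
      "entropy UNIV (b i) = (\<Sum>r\<in>R. eta (c r))" "entropy (corner (q i)) (b i) = (\<Sum>r\<in>R. eta (c r))"
      "rtr (b i) = (\<Sum>r\<in>R. c r)"
      by (rule pos_diagonalize_entropy[OF I(2) b(1) b(2), OF \<open>i \<in> I\<close> \<open>i \<in> I\<close> \<open>i \<in> I\<close>])
    have "b i = (\<Sum>r\<in>R. rtr (r * b i) *\<^sub>R r)"
      by (subst R(3)) (intro sum.cong refl, simp only: R(5))
    moreover have "entropy UNIV (b i) = (\<Sum>r\<in>R. eta (rtr (r * b i)))"
      by (subst R(6)) (intro sum.cong refl, simp only: R(5))
    ultimately show "\<exists>R. frame (q i) R \<and> b i = (\<Sum>r\<in>R. rtr (r * b i) *\<^sub>R r)
      \<and> entropy UNIV (b i) = (\<Sum>r\<in>R. eta (rtr (r * b i)))"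
      using R(1) by blast
  qed
  from bchoice[OF this] obtain R where R0: "\<forall>i\<in>I. frame (q i) (R i) \<and> b i = (\<Sum>r\<in>R i. rtr (r * b i) *\<^sub>R r)
      \<and> entropy UNIV (b i) = (\<Sum>r\<in>R i. eta (rtr (r * b i)))"
    by (elim exE) (rule that)
  have R: "frame (q i) (R i)" "b i = (\<Sum>r\<in>R i. rtr (r * b i) *\<^sub>R r)"
    "entropy UNIV (b i) = (\<Sum>r\<in>R i. eta (rtr (r * b i)))" if "i \<in> I" for i
    using R0[rule_format, OF that] by blast+
  note U = frame_Union[of I q R, OF I(1) projections_sum_1_orth[OF I] R(1)]
  define B where "B = (\<Sum>i\<in>I. b i)"
  have rB: "r * B = r * b i" if "i \<in> I" "r \<in> R i" for i r
  proof -
    have "r * b j = 0" if "j \<in> I" "j \<noteq> i" for j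
    proof -
      have "q j * b j = b j"
        using b(2)[OF \<open>j \<in> I\<close>] I(2)[OF \<open>j \<in> I\<close>] by (simp add: corner_iff)
      then have "r * b j = (r * q i) * (q j * b j)"
        by (simp only: frame_mult[OF R(1)[OF \<open>i \<in> I\<close>] \<open>r \<in> R i\<close>])
      also have "\<dots> = r * (q i * q j) * b j" by (simp only: mult.assoc)
      finally have "r * b j = r * (q i * q j) * b j" .
      then show ?thesis using projections_sum_1_orth[OF I \<open>i \<in> I\<close> that(1)] that by simp
    qed
    then have "r * B = (\<Sum>j\<in>I. if j = i then r * b i else 0)"
      unfolding B_def sum_distrib_left by (intro sum.cong) auto
    then show ?thesis using I(1) that by simp
  qed
  have "b i = (\<Sum>r\<in>R i. rtr (r * B) *\<^sub>R r)" if "i \<in> I" for i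
    by (subst R(2)[OF that]) (intro sum.cong refl, simp only: rB[OF that])
  then have "B = (\<Sum>i\<in>I. \<Sum>r\<in>R i. rtr (r * B) *\<^sub>R r)"
    by (subst B_def) (rule sum.cong[OF refl])
  also have "\<dots> = (\<Sum>r\<in>(\<Union>i\<in>I. R i). rtr (r * B) *\<^sub>R r)" by (simp add: U(2))
  finally have BU: "B = (\<Sum>r\<in>(\<Union>i\<in>I. R i). rtr (r * B) *\<^sub>R r)" .
  have tr: "rtr r = 1" if "r \<in> (\<Union>i\<in>I. R i)" for r
    using frame_tr[OF U(1) that] by simp
  have "entropy UNIV B = (\<Sum>r\<in>(\<Union>i\<in>I. R i). eta (rtr (r * B)) * rtr r)"
  proof (rule entropy_UNIV_eq)
    show "finite (\<Union>i\<in>I. R i)" using U(1) unfolding frame_def by blast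
    show "is_projection r" if "r \<in> (\<Union>i\<in>I. R i)" for r using frame_projection[OF U(1) that] by blast
    show "r * r' = 0" if "r \<in> (\<Union>i\<in>I. R i)" "r' \<in> (\<Union>i\<in>I. R i)" "r \<noteq> r'" for r r'
      using U(1) that unfolding frame_def by blast
  qed (rule BU)
  also have "\<dots> = (\<Sum>r\<in>(\<Union>i\<in>I. R i). eta (rtr (r * B)))"
    by (intro sum.cong refl) (simp only: tr mult_1_right)
  also have "\<dots> = (\<Sum>i\<in>I. \<Sum>r\<in>R i. eta (rtr (r * B)))"
    by (rule frame_Union(2)[of I q R, OF I(1) projections_sum_1_orth[OF I] R(1)])
  also have "\<dots> = (\<Sum>i\<in>I. entropy UNIV (b i))"
  proof (rule sum.cong[OF refl])
    fix i assume "i \<in> I"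
    show "(\<Sum>r\<in>R i. eta (rtr (r * B))) = entropy UNIV (b i)"
      by (subst R(3)[OF \<open>i \<in> I\<close>]) (intro sum.cong refl, simp only: rB[OF \<open>i \<in> I\<close>])
  qed
  finally show ?thesis by (simp add: B_def)
qed

text \<open>A crude bound, at most 1 for each eigenvalue, but enough to keep capacities below
  \<open>\<infinity>\<close>.\<close>

lemma entropy_le_trace_1:
  fixes b :: "'a::fd_cstar_algebra"
  assumes b: "pos b"
  shows "entropy UNIV b \<le> rtr (1::'a)"
proof -
  obtain R c where R [rule_format]: "frame 1 R" "b = (\<Sum>r\<in>R. c r *\<^sub>R r)" "\<forall>r\<in>R. 0 \<le> c r"
    "\<forall>r\<in>R. c r = rtr (r * b)"
    and ent: "entropy UNIV b = (\<Sum>r\<in>R. eta (c r))" "rtr b = (\<Sum>r\<in>R. c r)"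
    by (rule pos_diagonalize_entropy_UNIV[OF b])
  have "entropy UNIV b \<le> (\<Sum>r\<in>R. 1)"
    unfolding ent using R(3) eta_le_1 by (intro sum_mono) auto
  also have "\<dots> = rtr (1::'a)"
    using tr_frame_sum[OF R(1), of "\<lambda>_. 1"] R(1) by (simp add: frame_def)
  finally show ?thesis .
qed

section \<open>Positive unital trace preserving maps\<close>

lemma quadratic_nonneg_imp_linear_coeff_0:
  fixes \<alpha> \<beta> :: real
  assumes "\<And>t. 0 \<le> t * \<alpha> + t\<^sup>2 * \<beta>"
  shows "\<alpha> = 0"
proof (rule ccontr)
  assume "\<alpha> \<noteq> 0"
  \<comment> \<open>Any positive number above \<open>\<beta>\<close> serves: at
    \<open>t = - \<alpha> / b\<close> the quadratic has the sign of
    \<open>\<beta> - b\<close>.\<close>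
  define b where "b = \<bar>\<beta>\<bar> + 1"
  have b: "0 < b" "\<beta> < b" by (auto simp: b_def)
  have "(- \<alpha> / b) * \<alpha> + (- \<alpha> / b)\<^sup>2 * \<beta> = \<alpha>\<^sup>2 / b\<^sup>2 * (\<beta> - b)"
    using b by (simp add: power2_eq_square field_simps)
  also have "\<dots> < 0" using b \<open>\<alpha> \<noteq> 0\<close> by (intro mult_pos_neg) auto
  finally show False using assms[of "- \<alpha> / b"] by simp
qed

locale channel =
  fixes \<Phi> :: "'m::fd_cstar_algebra \<Rightarrow> 'p::fd_cstar_algebra"
  assumes positive: "positive_map_on UNIV UNIV \<Phi>"
    and unital: "\<Phi> 1 = 1"
    and trace_preserving: "trace_preserving_on UNIV UNIV \<Phi>"
begin

lemma linear: "clinear_on UNIV \<Phi>"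
  using positive by (simp add: positive_map_on_def)

lemmas map_simps = clinear_on_UNIV_simps[OF linear]

lemma map_sum: "\<Phi> (\<Sum>i\<in>I. x i) = (\<Sum>i\<in>I. \<Phi> (x i))"
  by (rule clinear_on_sum[OF linear]) simp_all

lemma map_pos: "pos a \<Longrightarrow> pos (\<Phi> a)"
  using positive by (simp add: positive_map_on_def)

lemma map_tr: "tr (\<Phi> x) = tr x"
  using trace_preserving by (simp add: trace_preserving_on_def)

lemma map_selfadjoint:
  assumes "star a = a"
  shows "star (\<Phi> a) = \<Phi> a"
proof -
  obtain R c where R: "frame 1 R" "a = (\<Sum>r\<in>R. c r *\<^sub>R r)"
    using diagonalize[OF is_projection_1 assms] by (metis UNIV_I corner_one)
  have "star (\<Phi> r) = \<Phi> r" if "r \<in> R" for r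
    using frame_projection[OF R(1) that] pos_projection map_pos pos_selfadjoint by blast
  then show ?thesis by (simp add: R(2) map_sum map_simps star_sum star_scaleR)
qed

text \<open>If \<open>r\<close> is a projection below \<open>e\<close>, then \<open>e - r\<close> is
  positive, and compressing by \<open>1 - q\<close> makes \<open>\<Phi> r\<close> and its negative
  both positive; the compression is therefore 0. Such \<open>r\<close> span the corner by
  diagonalisation.\<close>

lemma map_corner:
  assumes e: "is_projection e" "is_projection (\<Phi> e)" and x: "x \<in> corner e"
  shows "\<Phi> x \<in> corner (\<Phi> e)"
proof -
  define q where "q = \<Phi> e"
  have q: "is_projection q" using e by (simp add: q_def)
  have proj: "\<Phi> r \<in> corner q" if r: "is_projection r" "r \<in> corner e" for r
  proof -
    define q' where "q' = 1 - q"
    have q': "is_projection q'" using q by (simp add: q'_def is_projection_compl)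
    have qq: "q' * q = 0" using q by (simp add: q'_def algebra_simps is_projectionD)
    have "is_projection (e - r)"
      using r e by (intro is_projection_diff) (auto simp: corner_iff)
    then have "pos (q' * \<Phi> (e - r) * q')"
      by (intro pos_compress_projection[OF q'] map_pos pos_projection)
    then have neg: "pos (- (q' * \<Phi> r * q'))"
      using qq by (simp add: map_simps right_diff_distrib left_diff_distrib flip: q_def)
    obtain y where y: "\<Phi> r = star y * y"
      using map_pos[OF pos_projection[OF r(1)]] by (auto simp: positive_in_def)
    have yy: "q' * \<Phi> r * q' = star (y * q') * (y * q')"
      by (simp add: y star_mult mult.assoc is_projectionD[OF q'])
    then have "rtr (q' * \<Phi> r * q') = 0"
      using pos_trace(2)[OF neg] tr_star_mult_nonneg[of "y * q'"] by (simp add: tr_simps)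
    then have "y * q' = 0" using yy pos_trace(3)[OF posI[of "y * q'"]] by simp
    then have r1: "\<Phi> r * q = \<Phi> r" by (simp add: y q'_def algebra_simps)
    moreover have "star (\<Phi> r) = \<Phi> r" using y by (simp add: star_mult)
    ultimately have "q * \<Phi> r = \<Phi> r" using q by (metis is_projectionD(1) star_mult)
    then show ?thesis using r1 q by (simp add: corner_iff)
  qed
  have sa: "\<Phi> a \<in> corner q" if a: "star a = a" "a \<in> corner e" for a
  proof -
    obtain R c where R: "frame e R" "\<And>r. r \<in> R \<Longrightarrow> r \<in> corner e" "a = (\<Sum>r\<in>R. c r *\<^sub>R r)"
      using diagonalize[OF e(1) a] by metis
    show ?thesis
      unfolding R(3) map_sum map_simps
      using frame_projection[OF R(1)] R(2)
      by (intro cvs.subspace_sum[OF subspace_corner] scaleR_in_corner proj) auto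
  qed
  obtain h k where hk: "star h = h" "star k = k" "x = h + \<i> *\<^sub>C k" "h \<in> corner e" "k \<in> corner e"
    using selfadjoint_decomp_corner[OF e(1) x] by blast
  show ?thesis
    unfolding hk(3) map_simps q_def[symmetric] using hk
    by (intro cvs.subspace_add[OF subspace_corner] cvs.subspace_scale[OF subspace_corner] sa) auto
qed

text \<open>Positivity of \<open>\<Phi> (v\<^sup>* v)\<close> for \<open>v = 1 - e + t y\<^sup>*\<close> with real \<open>t\<close> forces the compression of the
  off-diagonal part to vanish.\<close>

lemma map_off_diagonal:
  assumes e: "is_projection e" "is_projection (\<Phi> e)" and y: "e * y = y" "y * e = 0"
  shows "\<Phi> e * \<Phi> y * \<Phi> e = 0" "\<Phi> e * \<Phi> (star y) * \<Phi> e = 0"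
proof -
  define q where "q = \<Phi> e"
  have q: "is_projection q" using e by (simp add: q_def)
  have Z: "q * \<Phi> (y + star y) * q = 0" if y: "e * y = y" "y * e = 0" for y
  proof (rule selfadjoint_eq_0I)
    have "star (y + star y) = y + star y" by (simp add: star_add)
    then have "star (\<Phi> (y + star y)) = \<Phi> (y + star y)" by (rule map_selfadjoint)
    then show "star (q * \<Phi> (y + star y) * q) = q * \<Phi> (y + star y) * q"
      using q by (simp add: star_mult is_projectionD mult.assoc)
    fix x
    define V where "V = q * \<Phi> (y * star y) * q"
    show "rtr (star x * (q * \<Phi> (y + star y) * q) * x) = 0"
    proof (rule quadratic_nonneg_imp_linear_coeff_0)
      fix t :: real
      define v where "v = 1 - e + t *\<^sub>R star y"
      have ey: "e * star y = 0" "star y * e = star y"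
        using y e by (metis is_projectionD(1) star_mult star_0)+
      have "star v = 1 - e + t *\<^sub>R y"
        using e by (simp add: v_def star_add star_diff star_scaleR is_projectionD)
      then have "star v * v = (1 - e + t *\<^sub>R y) * (1 - e + t *\<^sub>R star y)"
        by (simp only: v_def)
      also have "\<dots> = (1 - e) + t *\<^sub>R (y + star y) + t\<^sup>2 *\<^sub>R (y * star y)"
        using e y ey by (simp add: algebra_simps is_projectionD power2_eq_square)
      finally have "\<Phi> (star v * v) = (1 - q) + t *\<^sub>R \<Phi> (y + star y) + t\<^sup>2 *\<^sub>R \<Phi> (y * star y)"
        by (simp add: map_simps unital q_def)
      then have "q * \<Phi> (star v * v) * q
          = q * ((1 - q) + t *\<^sub>R \<Phi> (y + star y) + t\<^sup>2 *\<^sub>R \<Phi> (y * star y)) * q"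
        by (simp only:)
      \<comment> \<open>The constant term disappears because \<open>q * (1 - q) = 0\<close>. A
        quadratic in \<open>t\<close> without constant term stays non-negative only if its linear
        coefficient is 0.\<close>
      also have "\<dots> = t *\<^sub>R (q * \<Phi> (y + star y) * q) + t\<^sup>2 *\<^sub>R V"
        using q by (simp add: V_def algebra_simps is_projectionD)
      finally have "pos (t *\<^sub>R (q * \<Phi> (y + star y) * q) + t\<^sup>2 *\<^sub>R V)"
        using pos_compress_projection[OF q map_pos[OF posI[of v]]] by simp
      then have "0 \<le> rtr (star x * (t *\<^sub>R (q * \<Phi> (y + star y) * q) + t\<^sup>2 *\<^sub>R V) * x)"
        unfolding pos_iff by blast
      then show "0 \<le> t * rtr (star x * (q * \<Phi> (y + star y) * q) * x) + t\<^sup>2 * rtr (star x * V * x)"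
        by (simp only: distrib_left distrib_right mult_scaleR_left mult_scaleR_right tr_simps
            plus_complex.sel scaleR_complex.sel)
    qed
  qed
  have plus: "q * \<Phi> y * q + q * \<Phi> (star y) * q = 0"
    using Z[OF y] by (simp add: map_simps distrib_left distrib_right)
  \<comment> \<open>\<open>Z\<close> for \<open>y\<close> controls only the sum of the two
    compressions; \<open>Z\<close> for \<open>\<i> *\<^sub>C y\<close> controls their
    difference.\<close>
  have "e * (\<i> *\<^sub>C y) = \<i> *\<^sub>C y" "(\<i> *\<^sub>C y) * e = 0"
    using y by (simp_all add: mult_scaleC_left mult_scaleC_right)
  from Z[OF this] have "\<i> *\<^sub>C (q * \<Phi> y * q - q * \<Phi> (star y) * q) = 0"
    by (simp add: map_simps distrib_left distrib_right star_scaleC mult_scaleC_left mult_scaleC_right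
        cvs.scale_right_diff_distrib left_diff_distrib right_diff_distrib)
  then have eq: "q * \<Phi> y * q = q * \<Phi> (star y) * q" by simp
  with plus have "2 *\<^sub>R (q * \<Phi> y * q) = 0" by (simp add: scaleR_2)
  then show "\<Phi> e * \<Phi> y * \<Phi> e = 0" by (simp add: q_def)
  with eq show "\<Phi> e * \<Phi> (star y) * \<Phi> e = 0" by (simp add: q_def)
qed

text \<open>Split \<open>x\<close> into four blocks by \<open>e\<close> and \<open>1 - e\<close>.
  The off-diagonal blocks die by \<open>map_off_diagonal\<close>, and the block of
  \<open>1 - e\<close> is mapped into the corner of \<open>1 - \<Phi> e\<close>.\<close>

lemma map_compress:
  assumes e: "is_projection e" "is_projection (\<Phi> e)"
  shows "\<Phi> e * \<Phi> x * \<Phi> e = \<Phi> (e * x * e)"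
proof -
  define q e' where "q = \<Phi> e" and "e' = 1 - e"
  have q: "is_projection q" and e': "is_projection e'"
    using e by (simp_all add: q_def e'_def is_projection_compl)
  have Pe': "\<Phi> e' = 1 - q" by (simp add: e'_def map_simps unital q_def)
  have ee: "e * e' = 0" "e' * e = 0" using e by (simp_all add: e'_def algebra_simps is_projectionD)
  \<comment> \<open>The block \<open>e' * x * e\<close> is written as an adjoint so that the second
    part of \<open>map_off_diagonal\<close> covers it.\<close>
  have x: "x = e * x * e + e * x * e' + star (e * star x * e') + e' * x * e'"
    using e e' by (simp add: star_mult is_projectionD mult.assoc)
      (simp add: e'_def algebra_simps)
  have off: "q * \<Phi> (e * z * e') * q = 0" "q * \<Phi> (star (e * z * e')) * q = 0" for z
  proof -
    have "e * (e * z * e') = e * z * e'" "(e * z * e') * e = 0"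
      using e ee by (simp_all add: mult.assoc is_projectionD)
    then show "q * \<Phi> (e * z * e') * q = 0" "q * \<Phi> (star (e * z * e')) * q = 0"
      unfolding q_def by (rule map_off_diagonal[OF e])+
  qed
  have in1: "\<Phi> (e * x * e) \<in> corner q"
    unfolding q_def by (intro map_corner e compress_in_corner)
  have "\<Phi> (e' * x * e') \<in> corner (1 - q)"
    unfolding Pe'[symmetric] using q
    by (intro map_corner e' compress_in_corner) (simp add: Pe' is_projection_compl)
  then have "\<Phi> (e' * x * e') * (1 - q) = \<Phi> (e' * x * e')"
    using q by (simp add: corner_iff is_projection_compl)
  then have "\<Phi> (e' * x * e') * q = 0" by (simp add: algebra_simps)
  then have in2: "q * \<Phi> (e' * x * e') * q = 0" by (simp add: mult.assoc)
  have "q * \<Phi> x * q = q * (\<Phi> (e * x * e) + \<Phi> (e * x * e') + \<Phi> (star (e * star x * e')) + \<Phi> (e' * x * e')) * q"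
    by (subst x) (simp only: map_simps)
  also have "\<dots> = q * \<Phi> (e * x * e) * q"
    by (simp add: distrib_left distrib_right off in2)
  also have "\<dots> = \<Phi> (e * x * e)" using in1 q by (simp add: corner_iff)
  finally show ?thesis by (simp add: q_def)
qed

end

section \<open>Capacity\<close>

text \<open>The Holevo quantity of an unnormalised ensemble, with the probabilities absorbed into
  the traces of the \<open>x k\<close>. The index set is arbitrary because glued ensembles are
  indexed by pairs.\<close>

definition holevo :: "('a::cstar_algebra \<Rightarrow> 'b::cstar_algebra) \<Rightarrow> 'k set \<Rightarrow> ('k \<Rightarrow> 'a) \<Rightarrow> real" where
  "holevo \<Phi> K x = hom_entropy (\<Phi> (\<Sum>k\<in>K. x k)) - (\<Sum>k\<in>K. hom_entropy (\<Phi> (x k)))"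

definition ensemble :: "'a::cstar_algebra \<Rightarrow> 'k set \<Rightarrow> ('k \<Rightarrow> 'a) \<Rightarrow> bool" where
  "ensemble e K x \<longleftrightarrow> finite K \<and> (\<forall>k\<in>K. pos (x k) \<and> x k \<in> corner e)"

lemma ensemble_sum:
  assumes "ensemble (e::'a::fd_cstar_algebra) K x"
  shows "pos (\<Sum>k\<in>K. x k)" "(\<Sum>k\<in>K. x k) \<in> corner e"
  using assms by (auto simp: ensemble_def intro!: pos_sum cvs.subspace_sum[OF subspace_corner])

lemma ensemble_trace_0:
  fixes x :: "'k \<Rightarrow> 'a::fd_cstar_algebra"
  assumes "ensemble e K x" "rtr (\<Sum>k\<in>K. x k) = 0" "k \<in> K"
  shows "x k = 0"
proof -
  have "(\<Sum>k\<in>K. rtr (x k)) = 0" using assms(2) by (simp add: tr_sum)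
  then have "rtr (x k) = 0"
    using assms sum_nonneg_eq_0_iff[of K "\<lambda>k. rtr (x k)"] pos_trace(2) by (auto simp: ensemble_def)
  then show ?thesis using assms pos_trace(3) by (auto simp: ensemble_def)
qed

lemma holevo_reindex:
  assumes "bij_betw h L K"
  shows "holevo \<Phi> L (\<lambda>l. x (h l)) = holevo \<Phi> K x"
  using sum.reindex_bij_betw[OF assms, of x] sum.reindex_bij_betw[OF assms, of "\<lambda>k. hom_entropy (\<Phi> (x k))"]
  by (simp add: holevo_def)

lemma states_corner:
  fixes e :: "'a::fd_cstar_algebra"
  assumes "is_projection e"
  shows "states (corner e) = {a. pos a \<and> a \<in> corner e \<and> tr a = 1}"
  using assms by (auto simp: states_def positive_in_corner Tr_corner)

context channel
begin

lemma holevo_scaleR: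
  assumes "ensemble e K x" "0 \<le> t"
  shows "holevo \<Phi> K (\<lambda>k. t *\<^sub>R x k) = t * holevo \<Phi> K x"
proof -
  have "hom_entropy (\<Phi> (\<Sum>k\<in>K. t *\<^sub>R x k)) = t * hom_entropy (\<Phi> (\<Sum>k\<in>K. x k))"
    using ensemble_sum[OF assms(1)] assms(2)
    by (simp add: map_simps hom_entropy_scaleR map_pos flip: scaleR_sum_right)
  moreover have "hom_entropy (\<Phi> (t *\<^sub>R x k)) = t * hom_entropy (\<Phi> (x k))" if "k \<in> K" for k
    using assms that by (simp add: map_simps hom_entropy_scaleR map_pos ensemble_def)
  ultimately show ?thesis by (simp add: holevo_def right_diff_distrib sum_distrib_left)
qed

lemma holevo_le_trace:
  assumes "ensemble e K x" "rtr (\<Sum>k\<in>K. x k) = 1"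
  shows "holevo \<Phi> K x \<le> rtr (1::'p)"
proof -
  have "0 \<le> hom_entropy (\<Phi> (x k))" if "k \<in> K" for k
    using assms that by (intro hom_entropy_nonneg map_pos) (simp add: ensemble_def)
  then have "holevo \<Phi> K x \<le> hom_entropy (\<Phi> (\<Sum>k\<in>K. x k))"
    by (simp add: holevo_def sum_nonneg)
  also have "\<dots> = entropy UNIV (\<Phi> (\<Sum>k\<in>K. x k))"
    using assms by (simp add: hom_entropy_def map_tr)
  also have "\<dots> \<le> rtr (1::'p)"
    using ensemble_sum[OF assms(1)] by (intro entropy_le_trace_1 map_pos)
  finally show ?thesis .
qed

text \<open>At trace one the two entropies agree since \<open>eta 1 = 0\<close>, and homogeneity
  absorbs the weight \<open>l i\<close> into the state.\<close>

lemma ensemble_value: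
  fixes n :: nat
  assumes e: "is_projection e" "is_projection (\<Phi> e)"
    and y: "\<forall>i<n. 0 \<le> l i \<and> y i \<in> states (corner e)" and l: "(\<Sum>i<n. l i) = 1"
  shows "ensemble e {..<n} (\<lambda>i. l i *\<^sub>R y i)" "tr (\<Sum>i<n. l i *\<^sub>R y i) = 1"
    "entropy (corner (\<Phi> e)) (\<Phi> (\<Sum>i<n. l i *\<^sub>R y i)) - (\<Sum>i<n. l i * entropy (corner (\<Phi> e)) (\<Phi> (y i)))
      = holevo \<Phi> {..<n} (\<lambda>i. l i *\<^sub>R y i)"
proof -
  have y': "pos (y i)" "y i \<in> corner e" "tr (y i) = 1" "0 \<le> l i" if "i < n" for i
    using y that e by (auto simp: states_corner)
  show ens: "ensemble e {..<n} (\<lambda>i. l i *\<^sub>R y i)"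
    using y' by (auto simp: ensemble_def pos_scaleR scaleR_in_corner)
  show tr1: "tr (\<Sum>i<n. l i *\<^sub>R y i) = 1"
    using l y' by (simp add: tr_sum tr_simps scaleR_conv_of_real flip: of_real_sum)
  have S: "entropy (corner (\<Phi> e)) (\<Phi> a) = hom_entropy (\<Phi> a)" if "pos a" "a \<in> corner e" "tr a = 1" for a
    using that e by (simp add: entropy_corner map_pos map_corner hom_entropy_def map_tr)
  have "hom_entropy (\<Phi> (l i *\<^sub>R y i)) = l i * hom_entropy (\<Phi> (y i))" if "i < n" for i
    using y'[OF that] by (simp add: map_simps hom_entropy_scaleR map_pos)
  then show "entropy (corner (\<Phi> e)) (\<Phi> (\<Sum>i<n. l i *\<^sub>R y i))
      - (\<Sum>i<n. l i * entropy (corner (\<Phi> e)) (\<Phi> (y i))) = holevo \<Phi> {..<n} (\<lambda>i. l i *\<^sub>R y i)"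
    using S y' S[OF ensemble_sum[OF ens] tr1] by (simp add: holevo_def)
qed

lemma holevo_le_capacity:
  assumes e: "is_projection e" "is_projection (\<Phi> e)"
    and x: "ensemble e K x" "rtr (\<Sum>k\<in>K. x k) = 1"
  shows "ereal (holevo \<Phi> K x) \<le> capacity (corner e) (corner (\<Phi> e)) \<Phi>"
proof -
  have "finite K" using x by (simp add: ensemble_def)
  then obtain h where h: "bij_betw h {..<card K} K"
    using ex_bij_betw_nat_finite by (metis atLeast0LessThan)
  define n x' where "n = card K" and "x' = (\<lambda>i. x (h i))"
  have x': "pos (x' i)" "x' i \<in> corner e" if "i < n" for i
    using x h that by (auto simp: ensemble_def bij_betw_def x'_def n_def)
  have sum: "(\<Sum>i<n. x' i) = (\<Sum>k\<in>K. x k)"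
    unfolding x'_def n_def by (rule sum.reindex_bij_betw[OF h])
  define a where "a = (\<Sum>i<n. x' i)"
  have a: "pos a" "a \<in> corner e" "tr a = 1"
    using ensemble_sum[OF x(1)] x(2) pos_trace(1) by (force simp: a_def sum)+
  \<comment> \<open>A vanishing \<open>x' i\<close> receives weight 0 and may be attached to any
    state; \<open>a\<close> is one.\<close>
  define l y where "l = (\<lambda>i. rtr (x' i))" and
    "y = (\<lambda>i. if x' i = 0 then a else (1 / rtr (x' i)) *\<^sub>R x' i)"
  have ly: "l i *\<^sub>R y i = x' i" if "i < n" for i
    using pos_trace(3)[OF x'(1)[OF that]] by (auto simp: l_def y_def tr_simps)
  have st: "\<forall>i<n. 0 \<le> l i \<and> y i \<in> states (corner e)"
  proof (intro allI impI conjI)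
    fix i assume i: "i < n"
    note t = pos_trace[OF x'(1)[OF i]]
    show "0 \<le> l i" using t by (simp add: l_def)
    have "tr (y i) = 1"
    proof (cases "x' i = 0")
      case False
      have "tr (y i) = tr (x' i) / complex_of_real (rtr (x' i))"
        by (simp add: y_def False tr_simps scaleR_conv_of_real)
      then show ?thesis using t False by (metis divide_self of_real_eq_0_iff)
    qed (simp add: y_def a)
    moreover have "pos (y i)" using a t x'(1)[OF i] by (simp add: y_def pos_scaleR)
    moreover have "y i \<in> corner e" using a x'(2)[OF i] by (simp add: y_def scaleR_in_corner)
    ultimately show "y i \<in> states (corner e)" using e by (simp add: states_corner)
  qed
  have l1: "(\<Sum>i<n. l i) = 1" using a by (simp add: l_def a_def tr_sum flip: Re_sum)
  have ly_sum: "(\<Sum>i<n. l i *\<^sub>R y i) = a" by (simp add: a_def ly)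
  have val: "holevo \<Phi> K x = holevo \<Phi> {..<n} (\<lambda>i. l i *\<^sub>R y i)"
    using holevo_reindex[OF h, of \<Phi> x] ly by (simp add: holevo_def x'_def n_def)
  have "ereal (holevo \<Phi> K x) \<le> capacity_at (corner e) (corner (\<Phi> e)) \<Phi> a"
    unfolding capacity_at_def
  proof (rule Sup_upper, rule CollectI, intro exI conjI)
    show "\<forall>i<n. 0 \<le> l i \<and> y i \<in> states (corner e)" "(\<Sum>i<n. l i) = 1" "(\<Sum>i<n. l i *\<^sub>R y i) = a"
      by fact+
    show "ereal (holevo \<Phi> K x) = ereal (entropy (corner (\<Phi> e)) (\<Phi> a)
        - (\<Sum>i<n. l i * entropy (corner (\<Phi> e)) (\<Phi> (y i))))"
      using ensemble_value(3)[OF e st l1] by (simp add: val ly_sum)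
  qed
  also have "\<dots> \<le> capacity (corner e) (corner (\<Phi> e)) \<Phi>"
    unfolding capacity_def using a e by (intro SUP_upper) (simp add: states_corner)
  finally show ?thesis .
qed

lemma capacity_eq_Sup:
  assumes e: "is_projection e" "is_projection (\<Phi> e)"
  shows "capacity (corner e) (corner (\<Phi> e)) \<Phi>
    = Sup {ereal (holevo \<Phi> {..<n} x) | (n::nat) x. ensemble e {..<n} x \<and> rtr (\<Sum>i<n. x i) = 1}"
    (is "_ = Sup ?S")
proof (rule antisym)
  show "capacity (corner e) (corner (\<Phi> e)) \<Phi> \<le> Sup ?S"
    unfolding capacity_def capacity_at_def
  proof (intro SUP_least Sup_least, elim CollectE exE conjE)
    fix a z l y and n :: nat
    assume z: "z = ereal (entropy (corner (\<Phi> e)) (\<Phi> a) - (\<Sum>i<n. l i * entropy (corner (\<Phi> e)) (\<Phi> (y i))))"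
      and y: "\<forall>i<n. 0 \<le> l i \<and> y i \<in> states (corner e)" and l: "(\<Sum>i<n. l i) = 1"
      and a: "(\<Sum>i<n. l i *\<^sub>R y i) = a"
    note v = ensemble_value[OF e y l]
    have "z = ereal (holevo \<Phi> {..<n} (\<lambda>i. l i *\<^sub>R y i))" using v(3) by (simp add: z a)
    moreover have "rtr (\<Sum>i<n. l i *\<^sub>R y i) = 1" using v(2) by simp
    ultimately show "z \<le> Sup ?S" using v(1) by (intro Sup_upper CollectI exI conjI)
  qed
  show "Sup ?S \<le> capacity (corner e) (corner (\<Phi> e)) \<Phi>"
    by (rule Sup_least) (auto intro: holevo_le_capacity[OF e])
qed

lemma capacity_zero: "capacity (corner 0) (corner (\<Phi> 0)) \<Phi> = - \<infinity>"
proof -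
  have no: "\<not> (ensemble 0 {..<n} x \<and> rtr (\<Sum>i<n. x i) = 1)" for n :: nat and x :: "nat \<Rightarrow> 'm"
  proof
    assume "ensemble 0 {..<n} x \<and> rtr (\<Sum>i<n. x i) = 1"
    then have "(\<Sum>i<n. x i) = 0" "rtr (\<Sum>i<n. x i) = 1"
      using ensemble_sum(2)[of 0 "{..<n}" x] by (auto simp: corner_0)
    then show False by (simp add: tr_simps)
  qed
  have "is_projection (\<Phi> 0)" by (simp add: map_simps)
  then show ?thesis by (simp add: capacity_eq_Sup no bot_ereal_def)
qed

text \<open>A single minimal projection is an ensemble of trace one and bounds the supremum from
  below; \<open>rtr 1\<close> bounds it from above.\<close>

lemma capacity_real:
  assumes e: "is_projection e" "is_projection (\<Phi> e)" and "e \<noteq> 0"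
  shows "\<exists>c. capacity (corner e) (corner (\<Phi> e)) \<Phi> = ereal c"
proof -
  obtain R where R: "frame e R" "\<And>r. r \<in> R \<Longrightarrow> r \<in> corner e" using frame_exists[OF e(1)] by blast
  then have "R \<noteq> {}" using \<open>e \<noteq> 0\<close> by (auto simp: frame_def)
  then obtain r where r: "r \<in> R" by blast
  have "ensemble e {()} (\<lambda>_. r)"
    using R r frame_projection[OF R(1) r] pos_projection by (simp add: ensemble_def)
  moreover have "rtr (\<Sum>k\<in>{()}. r) = 1" using frame_tr[OF R(1) r] by simp
  ultimately have "ereal (holevo \<Phi> {()} (\<lambda>_. r)) \<le> capacity (corner e) (corner (\<Phi> e)) \<Phi>"
    by (rule holevo_le_capacity[OF e])
  moreover have "capacity (corner e) (corner (\<Phi> e)) \<Phi> \<le> ereal (rtr (1::'p))"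
    unfolding capacity_eq_Sup[OF e] by (rule Sup_least) (auto intro: holevo_le_trace)
  ultimately show ?thesis
    by (cases "capacity (corner e) (corner (\<Phi> e)) \<Phi>") auto
qed

text \<open>Homogeneity reduces this to trace one. At trace 0 normalising is impossible, but then
  all members vanish.\<close>

lemma holevo_le:
  assumes e: "is_projection e" "is_projection (\<Phi> e)" and x: "ensemble e K x"
    and c: "capacity (corner e) (corner (\<Phi> e)) \<Phi> = ereal c"
  shows "holevo \<Phi> K x \<le> rtr (\<Sum>k\<in>K. x k) * c"
proof -
  define T where "T = rtr (\<Sum>k\<in>K. x k)"
  have T: "0 \<le> T" unfolding T_def using ensemble_sum[OF x] pos_trace by blast
  show ?thesis
  proof (cases "T = 0")
    case True
    then have "x k = 0" if "k \<in> K" for k using ensemble_trace_0[OF x] that by (simp add: T_def)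
    then have "holevo \<Phi> K x = 0" by (simp add: holevo_def map_simps)
    then show ?thesis using True by (simp add: T_def)
  next
    case False
    have "ensemble e K (\<lambda>k. (1 / T) *\<^sub>R x k)"
      using x T by (auto simp: ensemble_def pos_scaleR scaleR_in_corner)
    moreover have "rtr (\<Sum>k\<in>K. (1 / T) *\<^sub>R x k) = 1"
      using False by (simp add: tr_simps T_def flip: scaleR_sum_right)
    ultimately have "ereal (holevo \<Phi> K (\<lambda>k. (1 / T) *\<^sub>R x k)) \<le> ereal c"
      using holevo_le_capacity[OF e] c by metis
    then have "holevo \<Phi> K x / T \<le> c" using holevo_scaleR[OF x, of "1 / T"] T by simp
    then show ?thesis using False T by (simp add: T_def field_simps)
  qed
qed

lemma holevo_near_capacity:
  assumes e: "is_projection e" "is_projection (\<Phi> e)"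
    and c: "capacity (corner e) (corner (\<Phi> e)) \<Phi> = ereal c" and "\<epsilon> > 0"
  obtains n :: nat and x where "ensemble e {..<n} x" "rtr (\<Sum>i<n. x i) = 1"
    "c - \<epsilon> < holevo \<Phi> {..<n} x"
proof -
  have "ereal (c - \<epsilon>) < capacity (corner e) (corner (\<Phi> e)) \<Phi>" using c \<open>\<epsilon> > 0\<close> by simp
  then show ?thesis unfolding capacity_eq_Sup[OF e] less_Sup_iff using that by auto
qed

lemma capacity_UNIV: "capacity UNIV UNIV \<Phi> = capacity (corner 1) (corner (\<Phi> 1)) \<Phi>"
  by (simp add: unital)

section \<open>Decomposition of the capacity along projections with sum 1\<close>

context
  fixes I :: "'i set" and e :: "'i \<Rightarrow> 'm"
  assumes I: "finite I" and e: "\<And>i. i \<in> I \<Longrightarrow> is_projection (e i)" and e1: "(\<Sum>i\<in>I. e i) = 1"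
    and q: "\<And>i. i \<in> I \<Longrightarrow> is_projection (\<Phi> (e i))"
begin

lemma sum_map_projections: "(\<Sum>i\<in>I. \<Phi> (e i)) = 1"
  using map_sum[of e I] by (simp add: e1 unital)

lemma capacity_upper:
  fixes c :: "'i \<Rightarrow> real"
  assumes c: "\<And>i. i \<in> I \<Longrightarrow> e i \<noteq> 0 \<Longrightarrow> capacity (corner (e i)) (corner (\<Phi> (e i))) \<Phi> = ereal (c i)"
  shows "capacity UNIV UNIV \<Phi> \<le> ereal (ln (\<Sum>i | i \<in> I \<and> e i \<noteq> 0. exp (c i)))"
proof -
  \<comment> \<open>For \<open>e i = 0\<close> the corner has capacity \<open>- \<infinity>\<close>
    and there is no real \<open>c i\<close>; such indices contribute 0 to the bound on the Holevo
    quantity.\<close>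
  define J where "J = {i \<in> I. e i \<noteq> 0}"
  have J: "finite J" using I by (simp add: J_def)
  have "holevo \<Phi> {..<n} x \<le> ln (\<Sum>i\<in>J. exp (c i))"
    if x: "ensemble 1 {..<n} x" "rtr (\<Sum>i<n. x i) = 1" for n :: nat and x
  proof -
    have px: "pos (x m)" if "m < n" for m using x that by (simp add: ensemble_def)
    define a where "a = (\<Sum>m<n. x m)"
    have pa: "pos a" using ensemble_sum[OF x(1)] by (simp add: a_def)
    define xe where "xe i m = e i * x m * e i" for i m
    have xe_sum: "(\<Sum>m<n. xe i m) = e i * a * e i" for i
      by (simp add: xe_def a_def sum_distrib_left sum_distrib_right)
    have comp: "\<Phi> (e i) * \<Phi> z * \<Phi> (e i) = \<Phi> (e i * z * e i)" if "i \<in> I" for i z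
      using that by (intro map_compress e q)
    define p where "p i = rtr (e i * a * e i)" for i
    have p0: "0 \<le> p i" if "i \<in> I" for i
      unfolding p_def using pos_compress_projection[OF e[OF that] pa] pos_trace by blast
    have p1: "(\<Sum>i\<in>J. p i) = 1"
    proof -
      have "(\<Sum>i\<in>J. p i) = (\<Sum>i\<in>I. p i)"
        using I by (intro sum.mono_neutral_left) (auto simp: J_def p_def tr_simps)
      also have "\<dots> = (\<Sum>i\<in>I. rtr (e i * a))" by (simp add: p_def tr_compress e)
      also have "\<dots> = rtr ((\<Sum>i\<in>I. e i) * a)" by (simp add: sum_distrib_right tr_sum)
      finally show ?thesis using x(2) by (simp add: e1 a_def)
    qed
    have h1: "hom_entropy (\<Phi> a) \<le> (\<Sum>i\<in>I. eta (p i) + hom_entropy (\<Phi> (e i * a * e i)))"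
    proof -
      have "hom_entropy (\<Phi> a) = entropy UNIV (\<Phi> a)"
        using x(2) by (simp add: hom_entropy_def map_tr a_def)
      also have "\<dots> \<le> (\<Sum>i\<in>I. entropy UNIV (\<Phi> (e i) * \<Phi> a * \<Phi> (e i)))"
        by (intro entropy_pinching I q sum_map_projections map_pos pa)
      \<comment> \<open>A compressed block has trace \<open>p i\<close> instead of 1, and
        \<open>eta (p i)\<close> is the resulting difference between its two entropies.\<close>
      also have "\<dots> = (\<Sum>i\<in>I. eta (p i) + hom_entropy (\<Phi> (e i * a * e i)))"
        by (intro sum.cong refl) (simp add: comp hom_entropy_def p_def map_tr)
      finally show ?thesis .
    qed
    have h2: "(\<Sum>i\<in>I. hom_entropy (\<Phi> (xe i m))) \<le> hom_entropy (\<Phi> (x m))" if "m < n" for m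
      using hom_entropy_pinching[OF I q sum_map_projections map_pos[OF px[OF that]]] by (simp add: comp xe_def)
    have "(\<Sum>i\<in>I. \<Sum>m<n. hom_entropy (\<Phi> (xe i m))) \<le> (\<Sum>m<n. hom_entropy (\<Phi> (x m)))"
      by (subst sum.swap) (use h2 in \<open>auto intro: sum_mono\<close>)
    then have "holevo \<Phi> {..<n} x \<le> (\<Sum>i\<in>I. eta (p i) + holevo \<Phi> {..<n} (xe i))"
      using h1 by (simp add: holevo_def sum.distrib sum_subtractf xe_sum flip: a_def)
    also have "\<dots> = (\<Sum>i\<in>J. eta (p i) + holevo \<Phi> {..<n} (xe i))"
      using I by (intro sum.mono_neutral_right)
        (auto simp: J_def p_def tr_simps holevo_def xe_def map_simps)
    also have "\<dots> \<le> (\<Sum>i\<in>J. eta (p i) + p i * c i)"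
    proof (intro sum_mono add_left_mono)
      fix i assume "i \<in> J"
      then have i: "i \<in> I" "e i \<noteq> 0" by (auto simp: J_def)
      have "ensemble (e i) {..<n} (xe i)"
        using px e[OF i(1)]
        by (auto simp: ensemble_def xe_def pos_compress_projection compress_in_corner)
      from holevo_le[OF e[OF i(1)] q[OF i(1)] this c[OF i]]
      show "holevo \<Phi> {..<n} (xe i) \<le> p i * c i" by (simp add: xe_sum p_def)
    qed
    also have "\<dots> \<le> ln (\<Sum>i\<in>J. exp (c i))"
      using p0 p1 J by (intro gibbs_variational) (auto simp: J_def)
    finally show ?thesis .
  qed
  then have "capacity (corner 1) (corner (\<Phi> 1)) \<Phi> \<le> ereal (ln (\<Sum>i\<in>J. exp (c i)))"
    by (subst capacity_eq_Sup) (auto simp: unital intro!: Sup_least)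
  then show ?thesis by (simp add: capacity_UNIV J_def)
qed

text \<open>The block capacities are suprema that are only approached, hence the ensembles within
  \<epsilon>. In the zero algebra the left-hand side is still a real number while the capacity is
  \<open>- \<infinity>\<close>, which is why \<open>nontrivial\<close> is assumed.\<close>

lemma capacity_lower:
  fixes c :: "'i \<Rightarrow> real"
  assumes c: "\<And>i. i \<in> I \<Longrightarrow> e i \<noteq> 0 \<Longrightarrow> capacity (corner (e i)) (corner (\<Phi> (e i))) \<Phi> = ereal (c i)"
    and nontrivial: "(1::'m) \<noteq> 0"
  shows "ereal (ln (\<Sum>i | i \<in> I \<and> e i \<noteq> 0. exp (c i))) \<le> capacity UNIV UNIV \<Phi>"
proof -
  define J where "J = {i \<in> I. e i \<noteq> 0}"
  have J: "finite J" "J \<subseteq> I" using I by (auto simp: J_def)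
  have eJ: "(\<Sum>i\<in>J. e i) = 1"
    using e1 I by (subst sum.mono_neutral_left[of I J]) (auto simp: J_def)
  then have "J \<noteq> {}" using nontrivial by auto
  define Z where "Z = (\<Sum>i\<in>J. exp (c i))"
  have Z: "0 < Z" unfolding Z_def using J \<open>J \<noteq> {}\<close> by (intro sum_pos) auto
  \<comment> \<open>The Gibbs weights, that is, the equality case of
    \<open>gibbs_variational\<close>.\<close>
  define p where "p i = exp (c i) / Z" for i
  have p: "0 < p i" "ln (p i) = c i - ln Z" for i using Z by (auto simp: p_def ln_div)
  have p1: "(\<Sum>i\<in>J. p i) = 1" using Z by (simp add: p_def Z_def flip: sum_divide_distrib)
  have "ereal (ln Z - \<epsilon>) \<le> capacity UNIV UNIV \<Phi>" if "\<epsilon> > 0" for \<epsilon>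
  proof -
    have "\<forall>i\<in>J. \<exists>nx. ensemble (e i) {..<fst nx :: nat} (snd nx) \<and> rtr (\<Sum>m<fst nx. snd nx m) = 1 \<and>
        c i - \<epsilon> < holevo \<Phi> {..<fst nx} (snd nx)"
    proof
      fix i assume "i \<in> J"
      then have i: "i \<in> I" "e i \<noteq> 0" by (auto simp: J_def)
      obtain n :: nat and x where "ensemble (e i) {..<n} x" "rtr (\<Sum>i<n. x i) = 1"
        "c i - \<epsilon> < holevo \<Phi> {..<n} x"
        by (rule holevo_near_capacity[OF e[OF i(1)] q[OF i(1)] c[OF i] \<open>\<epsilon> > 0\<close>])
      then show "\<exists>nx. ensemble (e i) {..<fst nx :: nat} (snd nx) \<and> rtr (\<Sum>m<fst nx. snd nx m) = 1 \<and>
        c i - \<epsilon> < holevo \<Phi> {..<fst nx} (snd nx)"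
        by (intro exI[of _ "(n, x)"]) simp
    qed
    from bchoice[OF this] obtain nx where nx: "\<forall>i\<in>J. ensemble (e i) {..<fst (nx i) :: nat} (snd (nx i)) \<and>
        rtr (\<Sum>m<fst (nx i). snd (nx i) m) = 1 \<and> c i - \<epsilon> < holevo \<Phi> {..<fst (nx i)} (snd (nx i))"
      by (elim exE) (rule that)
    define n x where "n i = fst (nx i)" and "x i = snd (nx i)" for i
    have ens: "ensemble (e i) {..<n i} (x i)" and t1: "rtr (\<Sum>m<n i. x i m) = 1"
      and near: "c i - \<epsilon> < holevo \<Phi> {..<n i} (x i)" if "i \<in> J" for i
      using nx that by (auto simp: n_def x_def)
    define a where "a i = (\<Sum>m<n i. x i m)" for i
    have a: "pos (a i)" "a i \<in> corner (e i)" "rtr (a i) = 1" if "i \<in> J" for i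
      using ensemble_sum[OF ens[OF that]] t1[OF that] by (simp_all add: a_def)
    define K where "K = Sigma J (\<lambda>i. {..<n i})"
    define X where "X = (\<lambda>(i, m). p i *\<^sub>R x i m)"
    have sumK: "(\<Sum>k\<in>K. f k) = (\<Sum>i\<in>J. \<Sum>m<n i. f (i, m))" for f :: "'i \<times> nat \<Rightarrow> 'x::comm_monoid_add"
      unfolding K_def using J by (subst sum.Sigma) auto
    have sumX: "(\<Sum>k\<in>K. X k) = (\<Sum>i\<in>J. p i *\<^sub>R a i)"
      by (simp add: sumK X_def a_def scaleR_sum_right)
    have px: "pos (x i m)" if "i \<in> J" "m < n i" for i m
      using ens[OF that(1)] that by (simp add: ensemble_def)
    have ensX: "ensemble 1 K X"
      using J px p(1) by (auto simp: ensemble_def K_def X_def intro!: pos_scaleR less_imp_le)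
    have trX: "rtr (\<Sum>k\<in>K. X k) = 1"
      using a p1 by (simp add: sumX tr_sum tr_simps)
    have "entropy UNIV (\<Phi> (\<Sum>k\<in>K. X k)) = entropy UNIV (\<Sum>i\<in>J. p i *\<^sub>R \<Phi> (a i))"
      by (simp add: sumX map_sum map_simps)
    also have "\<dots> = (\<Sum>i\<in>J. entropy UNIV (p i *\<^sub>R \<Phi> (a i)))"
    proof (rule entropy_orth_sum[OF J(1)])
      show "is_projection (\<Phi> (e i))" if "i \<in> J" for i using that q by (simp add: J_def)
      show "(\<Sum>i\<in>J. \<Phi> (e i)) = 1" by (simp add: eJ unital flip: map_sum)
      show "pos (p i *\<^sub>R \<Phi> (a i))" if "i \<in> J" for i
        using a[OF that] p(1)[of i] by (simp add: pos_scaleR map_pos)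
      show "p i *\<^sub>R \<Phi> (a i) \<in> corner (\<Phi> (e i))" if "i \<in> J" for i
        using a[OF that] that e q by (intro scaleR_in_corner map_corner) (auto simp: J_def)
    qed
    also have "\<dots> = (\<Sum>i\<in>J. eta (p i) + p i * hom_entropy (\<Phi> (a i)))"
      using a p(1) by (intro sum.cong refl)
        (simp add: entropy_scaleR map_pos map_tr hom_entropy_def less_imp_le)
    finally have S: "hom_entropy (\<Phi> (\<Sum>k\<in>K. X k)) = (\<Sum>i\<in>J. eta (p i) + p i * hom_entropy (\<Phi> (a i)))"
      using trX by (simp add: hom_entropy_def map_tr)
    have "(\<Sum>k\<in>K. hom_entropy (\<Phi> (X k))) = (\<Sum>i\<in>J. p i * (\<Sum>m<n i. hom_entropy (\<Phi> (x i m))))"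
      using px p(1) by (simp add: sumK X_def map_simps hom_entropy_scaleR map_pos less_imp_le sum_distrib_left)
    then have "holevo \<Phi> K X = (\<Sum>i\<in>J. eta (p i) + p i * holevo \<Phi> {..<n i} (x i))"
      by (simp add: holevo_def S right_diff_distrib sum.distrib sum_subtractf flip: a_def)
    also have "\<dots> \<ge> (\<Sum>i\<in>J. eta (p i) + p i * (c i - \<epsilon>))"
      using near p(1) by (intro sum_mono add_left_mono mult_left_mono) (auto intro: less_imp_le)
    \<comment> \<open>Since \<open>ln (p i) = c i - ln Z\<close>, the \<open>c i\<close> cancel and
      every block yields the same value per unit of weight.\<close>
    also have "(\<Sum>i\<in>J. eta (p i) + p i * (c i - \<epsilon>)) = (\<Sum>i\<in>J. p i * (ln Z - \<epsilon>))"
    proof (rule sum.cong[OF refl])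
      fix i
      have "eta (p i) = - p i * (c i - ln Z)" using p(1)[of i] by (simp add: eta_eq p(2))
      then show "eta (p i) + p i * (c i - \<epsilon>) = p i * (ln Z - \<epsilon>)" by (simp add: algebra_simps)
    qed
    also have "\<dots> = ln Z - \<epsilon>" by (simp add: p1 flip: sum_distrib_right)
    finally have "ereal (ln Z - \<epsilon>) \<le> ereal (holevo \<Phi> K X)" by simp
    also have "\<dots> \<le> capacity UNIV UNIV \<Phi>"
      using holevo_le_capacity[of 1, OF _ _ ensX trX] by (simp add: unital)
    finally show ?thesis .
  qed
  moreover obtain c' where c': "capacity UNIV UNIV \<Phi> = ereal c'"
    using capacity_real[of 1] nontrivial by (auto simp: unital)
  ultimately have "ln Z \<le> c' + \<epsilon>" if "\<epsilon> > 0" for \<epsilon>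
    using that by (simp add: diff_le_eq)
  then have "ereal (ln Z) \<le> capacity UNIV UNIV \<Phi>"
    unfolding c' by (simp add: field_le_epsilon)
  then show ?thesis by (simp add: Z_def J_def)
qed

end

end

text \<open>Only meaningful for \<open>x \<noteq> \<infinity>\<close>: the value at \<open>\<infinity>\<close> is \<open>1\<close>.\<close>

definition exp_capacity :: "ereal \<Rightarrow> real" where
  "exp_capacity x = (if x = - \<infinity> then 0 else exp (real_of_ereal x))"

lemma exp_capacity_add:
  "x \<noteq> \<infinity> \<Longrightarrow> y \<noteq> \<infinity> \<Longrightarrow> exp_capacity (x + y) = exp_capacity x * exp_capacity y"
  by (cases x; cases y) (auto simp: exp_capacity_def exp_add)

lemma exp_capacity_inj:
  "x \<noteq> \<infinity> \<Longrightarrow> y \<noteq> \<infinity> \<Longrightarrow> exp_capacity x = exp_capacity y \<Longrightarrow> x = y"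
  by (cases x; cases y) (auto simp: exp_capacity_def)

context channel
begin

lemma capacity_not_PInf:
  assumes "is_projection e" "is_projection (\<Phi> e)"
  shows "capacity (corner e) (corner (\<Phi> e)) \<Phi> \<noteq> \<infinity>"
proof (cases "e = 0")
  case True
  then show ?thesis using capacity_zero by simp
next
  case False
  then show ?thesis using capacity_real[OF assms] by auto
qed

text \<open>The exponential form absorbs the degenerate cases: corners of zero projections count as
  0, and in the zero algebra both sides are 0.\<close>

theorem exp_capacity_sum:
  assumes I: "finite I" and e: "\<And>i. i \<in> I \<Longrightarrow> is_projection (e i)" and e1: "(\<Sum>i\<in>I. e i) = 1"
    and q: "\<And>i. i \<in> I \<Longrightarrow> is_projection (\<Phi> (e i))"
  shows "exp_capacity (capacity UNIV UNIV \<Phi>)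
    = (\<Sum>i\<in>I. exp_capacity (capacity (corner (e i)) (corner (\<Phi> (e i))) \<Phi>))"
proof (cases "(1::'m) = 0")
  case True
  have all0: "x = 0" for x :: 'm using mult_1_right[of x] by (simp add: True)
  have "capacity (corner x) (corner (\<Phi> x)) \<Phi> = - \<infinity>" for x
    using capacity_zero all0[of x] by simp
  then show ?thesis by (simp only: capacity_UNIV) (simp add: exp_capacity_def)
next
  case False
  define c where "c i = real_of_ereal (capacity (corner (e i)) (corner (\<Phi> (e i))) \<Phi>)" for i
  have c: "capacity (corner (e i)) (corner (\<Phi> (e i))) \<Phi> = ereal (c i)" if "i \<in> I" "e i \<noteq> 0" for i
    using capacity_real[OF e[OF that(1)] q[OF that(1)] that(2)] by (auto simp: c_def)
  define Z where "Z = (\<Sum>i | i \<in> I \<and> e i \<noteq> 0. exp (c i))"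
  have "{i \<in> I. e i \<noteq> 0} \<noteq> {}"
  proof
    assume "{i \<in> I. e i \<noteq> 0} = {}"
    then have "(\<Sum>i\<in>I. e i) = 0" by (intro sum.neutral) auto
    then show False using e1 False by simp
  qed
  then have Z: "0 < Z" unfolding Z_def using I by (intro sum_pos) auto
  have "capacity UNIV UNIV \<Phi> = ereal (ln Z)"
    unfolding Z_def using I e e1 q c False by (intro antisym capacity_upper capacity_lower) auto
  then have "exp_capacity (capacity UNIV UNIV \<Phi>) = Z" using Z by (simp add: exp_capacity_def)
  also have "\<dots> = (\<Sum>i | i \<in> I \<and> e i \<noteq> 0. exp_capacity (capacity (corner (e i)) (corner (\<Phi> (e i))) \<Phi>))"
    unfolding Z_def by (intro sum.cong refl) (simp add: c exp_capacity_def)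
  also have "\<dots> = (\<Sum>i\<in>I. exp_capacity (capacity (corner (e i)) (corner (\<Phi> (e i))) \<Phi>))"
  proof (rule sum.mono_neutral_left)
    show "\<forall>i\<in>I - {i \<in> I. e i \<noteq> 0}. exp_capacity (capacity (corner (e i)) (corner (\<Phi> (e i))) \<Phi>) = 0"
      using capacity_zero by (auto simp: exp_capacity_def)
  qed (use I in auto)
  finally show ?thesis .
qed

end

section \<open>Tensor products\<close>

lemma cbilinearD:
  assumes "cbilinear t"
  shows "clinear_on UNIV (t x)" "clinear_on UNIV (\<lambda>x. t x y)"
  using assms by (auto simp: cbilinear_def)

lemma cbilinear_sum:
  assumes "cbilinear t"
  shows "t (\<Sum>i\<in>I. x i) y = (\<Sum>i\<in>I. t (x i) y)" "t x' (\<Sum>j\<in>J. y' j) = (\<Sum>j\<in>J. t x' (y' j))"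
  using clinear_on_sum[OF cbilinearD(2)[OF assms, of y] cvs.subspace_UNIV, of I x]
    clinear_on_sum[OF cbilinearD(1)[OF assms] cvs.subspace_UNIV, of J y' x']
  by auto

lemma cbilinear_scaleC:
  assumes "cbilinear t"
  shows "t (c *\<^sub>C x) y = c *\<^sub>C t x y" "t x (c *\<^sub>C y) = c *\<^sub>C t x y"
  using clinear_on_UNIV_simps(2)[OF cbilinearD(2)[OF assms, of y], of c x]
    clinear_on_UNIV_simps(2)[OF cbilinearD(1)[OF assms, of x], of c y] by auto

lemma clinear_on_compose:
  "clinear_on UNIV F \<Longrightarrow> clinear_on UNIV G \<Longrightarrow> clinear_on UNIV (\<lambda>x. F (G x))"
  by (simp add: clinear_on_def)

lemma clinear_on_representation:
  assumes "cvs.independent B" "cvs.span B = UNIV"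
  shows "clinear_on UNIV (\<lambda>x. cvs.representation B x b)"
  using assms by (simp add: clinear_on_def cvs.representation_add cvs.representation_scale scaleC_complex_def)

lemma finite_basis_exists:
  obtains B :: "'a::fd_cstar_algebra set" where "finite B" "cvs.independent B" "cvs.span B = UNIV"
proof -
  obtain S :: "'a set" where S: "finite S" "\<And>T. T \<subseteq> cvs.span S"
    by (rule finite_spanning_set) blast
  define B :: "'a set" where "B = cvs.extend_basis {}"
  have B: "cvs.independent B" "cvs.span B = UNIV"
    unfolding B_def
    by (rule cvs.independent_extend_basis cvs.span_extend_basis; rule cvs.independent_empty)+
  have "finite B" using cvs.independent_span_bound[OF S(1) B(1) S(2)] by (rule conjunct1)
  then show ?thesis using B by (rule that)
qed

context
  fixes t :: "'a::fd_cstar_algebra \<Rightarrow> 'b::fd_cstar_algebra \<Rightarrow> 'c::fd_cstar_algebra"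
  assumes t: "tensor_product t"
begin

lemma tensor_bilinear: "cbilinear t"
  and tensor_one: "t 1 1 = 1"
  and tensor_mult: "t x y * t x' y' = t (x * x') (y * y')"
  and tensor_star: "star (t x y) = t (star x) (star y)"
  and tensor_universal: "cbilinear (\<beta> :: 'a \<Rightarrow> 'b \<Rightarrow> complex) \<Longrightarrow>
    \<exists>!\<phi>. clinear_on UNIV \<phi> \<and> (\<forall>x y. \<phi> (t x y) = \<beta> x y)"
proof -
  note D = t[unfolded tensor_product_def]
  note D1 = D[THEN conjunct2] and D2 = D[THEN conjunct2, THEN conjunct2]
  note D3 = D2[THEN conjunct2]
  show "cbilinear t" by (rule D[THEN conjunct1])
  show "t 1 1 = 1" by (rule D1[THEN conjunct1])
  show "t x y * t x' y' = t (x * x') (y * y')" by (rule D2[THEN conjunct1, rule_format])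
  show "star (t x y) = t (star x) (star y)" by (rule D3[THEN conjunct1, rule_format])
  show "cbilinear \<beta> \<Longrightarrow> \<exists>!\<phi>. clinear_on UNIV \<phi> \<and> (\<forall>x y. \<phi> (t x y) = \<beta> x y)" for \<beta> :: "'a \<Rightarrow> 'b \<Rightarrow> complex"
    by (rule D3[THEN conjunct2, rule_format])
qed

text \<open>This is the uniqueness half of the universal property: a functional vanishing on all
  \<open>t x y\<close> represents the zero form and is therefore 0.\<close>

lemma tensor_span: "cvs.span {t x y | x y. True} = UNIV"
proof (rule ccontr)
  define V where "V = cvs.span {t x y | x y. True}"
  assume "cvs.span {t x y | x y. True} \<noteq> UNIV"
  then obtain z where z: "z \<notin> V" by (auto simp: V_def)
  obtain B0 where B0: "B0 \<subseteq> V" "cvs.independent B0" "V \<subseteq> cvs.span B0"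
    by (rule cvs.maximal_independent_subset[of V])
  have "cvs.span B0 \<subseteq> V"
    using B0(1) cvs.subspace_span unfolding V_def by (rule cvs.span_minimal)
  then have "z \<notin> cvs.span B0" using z by blast
  then have ind: "cvs.independent (insert z B0)" using B0(2) by (rule cvs.independent_insertI)
  define B where "B = cvs.extend_basis (insert z B0)"
  have B: "cvs.independent B" "cvs.span B = UNIV" "insert z B0 \<subseteq> B"
    unfolding B_def using ind cvs.independent_extend_basis cvs.span_extend_basis cvs.extend_basis_superset
    by blast+
  \<comment> \<open>The coordinate at \<open>z\<close> in a basis that extends \<open>z\<close>
    together with a basis of \<open>V\<close>: it vanishes on \<open>V\<close> but equals 1 at
    \<open>z\<close>.\<close>
  define \<phi> where "\<phi> v = cvs.representation B v z" for v
  have lin: "clinear_on UNIV \<phi>"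
    unfolding \<phi>_def by (rule clinear_on_representation[OF B(1,2)])
  have "\<phi> (t x y) = 0" for x y
  proof -
    have "t x y \<in> cvs.span B0" using B0(3) unfolding V_def by (blast intro: cvs.span_base)
    then have "\<phi> (t x y) = cvs.representation B0 (t x y) z"
      unfolding \<phi>_def using B by (subst cvs.representation_extend[of B _ B0]) auto
    also have "\<dots> = 0" using cvs.representation_ne_zero[of B0 "t x y" z] B0(1) z by blast
    finally show ?thesis .
  qed
  moreover have "clinear_on UNIV (\<lambda>_::'c. 0 :: complex)" "cbilinear (\<lambda>(_::'a) (_::'b). 0 :: complex)"
    by (simp_all add: clinear_on_def cbilinear_def)
  ultimately have "\<phi> = (\<lambda>_. 0)" using tensor_universal[of "\<lambda>_ _. 0"] lin by blast
  moreover have "\<phi> z = 1"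
    unfolding \<phi>_def using cvs.representation_basis[OF B(1), of z] B(3) by simp
  ultimately show False by simp
qed

lemma tensor_subspace_UNIV:
  assumes "cvs.subspace S" "\<And>x y. t x y \<in> S"
  shows "z \<in> S"
  using cvs.span_minimal[OF _ assms(1), of "{t x y | x y. True}"] assms(2) tensor_span by blast

lemma tensor_linear_eqI:
  assumes F: "clinear_on UNIV F" and G: "clinear_on UNIV G" and "\<And>x y. F (t x y) = G (t x y)"
  shows "F z = G z"
proof -
  have "cvs.subspace {z. F z = G z}"
    by (rule cvs.subspaceI) (simp_all add: clinear_on_UNIV_simps[OF F] clinear_on_UNIV_simps[OF G])
  then show ?thesis using tensor_subspace_UNIV[of "{z. F z = G z}" z] assms(3) by simp
qed

lemma tensor_linear_ex:
  fixes \<beta> :: "'a \<Rightarrow> 'b \<Rightarrow> 'd::fd_cstar_algebra"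
  assumes "cbilinear \<beta>"
  shows "\<exists>F. clinear_on UNIV F \<and> (\<forall>x y. F (t x y) = \<beta> x y)"
proof -
  obtain B :: "'d set" where B: "finite B" "cvs.independent B" "cvs.span B = UNIV"
    using finite_basis_exists by blast
  have "\<exists>\<phi>. clinear_on UNIV \<phi> \<and> (\<forall>x y. \<phi> (t x y) = cvs.representation B (\<beta> x y) b)" for b
  proof -
    have "cbilinear (\<lambda>x y. cvs.representation B (\<beta> x y) b)"
      unfolding cbilinear_def
      by (intro conjI allI clinear_on_compose[OF clinear_on_representation[OF B(2,3)]] cbilinearD[OF assms])
    from tensor_universal[OF this] show ?thesis by blast
  qed
  then obtain \<phi> where \<phi>: "\<And>b. clinear_on UNIV (\<phi> b)"
    "\<And>b x y. \<phi> b (t x y) = cvs.representation B (\<beta> x y) b"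
    by metis
  define F where "F z = (\<Sum>b\<in>B. \<phi> b z *\<^sub>C b)" for z
  have "clinear_on UNIV F"
    by (auto simp: clinear_on_def F_def clinear_on_UNIV_simps[OF \<phi>(1)] cvs.scale_left_distrib
        sum.distrib cvs.scale_sum_right scaleC_complex_def)
  moreover have "F (t x y) = \<beta> x y" for x y
    unfolding F_def \<phi>(2) using B by (intro cvs.sum_representation_eq) auto
  ultimately show ?thesis by blast
qed

lemma tensor_projection: "is_projection p \<Longrightarrow> is_projection q \<Longrightarrow> is_projection (t p q)"
  by (simp add: is_projection_def tensor_mult tensor_star)

text \<open>The functional induced by the product of the traces is 1 at \<open>t p q\<close>, so
  \<open>t p q \<noteq> 0\<close>. Compression by \<open>t p q\<close> turns elementary tensors,
  hence everything, into multiples of \<open>t p q\<close>; a projection below it is such a multiple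
  with \<open>c * c = c\<close>.\<close>

lemma tensor_minimal:
  assumes p: "minimal_projection_in UNIV p" and q: "minimal_projection_in UNIV q"
  shows "minimal_projection_in UNIV (t p q)"
proof -
  note pp = minimal_projection_in_UNIV_D[OF p] and qq = minimal_projection_in_UNIV_D[OF q]
  have bil: "cbilinear (\<lambda>(x::'a) (y::'b). tr x * tr y)"
    by (simp add: cbilinear_def clinear_on_def tr_simps scaleC_complex_def algebra_simps)
  obtain \<phi> where \<phi>: "clinear_on UNIV \<phi>" "\<And>x y. \<phi> (t x y) = tr x * tr y"
    using tensor_universal[OF bil] by blast
  have "t p q \<noteq> 0"
  proof
    assume "t p q = 0"
    then have "tr p * tr q = 0" using \<phi>(2)[of p q] clinear_on_UNIV_simps(3)[OF \<phi>(1)] by simp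
    then show False using tr_minimal[OF p] tr_minimal[OF q] by simp
  qed
  have proj: "is_projection (t p q)" using pp qq by (intro tensor_projection)
  have scalar: "\<exists>c. t p q * z * t p q = c *\<^sub>C t p q" for z
  proof -
    have "z \<in> {z. \<exists>c. t p q * z * t p q = c *\<^sub>C t p q}"
    proof (rule tensor_subspace_UNIV)
      show "cvs.subspace {z. \<exists>c. t p q * z * t p q = c *\<^sub>C t p q}"
      proof (rule cvs.subspaceI, safe)
        show "\<exists>c. t p q * 0 * t p q = c *\<^sub>C t p q" by (intro exI[of _ 0]) simp
        show "\<exists>c. t p q * (x + y) * t p q = c *\<^sub>C t p q"
          if "t p q * x * t p q = a *\<^sub>C t p q" "t p q * y * t p q = b *\<^sub>C t p q" for x y a b
          by (intro exI[of _ "a + b"]) (simp add: distrib_left distrib_right that cvs.scale_left_distrib)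
        show "\<exists>c. t p q * (d *\<^sub>C x) * t p q = c *\<^sub>C t p q"
          if "t p q * x * t p q = a *\<^sub>C t p q" for d x a
          by (intro exI[of _ "d * a"]) (simp add: mult_scaleC_left mult_scaleC_right that)
      qed
      show "t x y \<in> {z. \<exists>c. t p q * z * t p q = c *\<^sub>C t p q}" for x y
        using min_coeff[OF p, of x] min_coeff[OF q, of y]
        by (auto simp: tensor_mult cbilinear_scaleC[OF tensor_bilinear])
    qed
    then show ?thesis by simp
  qed
  have "r = 0 \<or> r = t p q" if r: "is_projection r" "r * t p q = r" for r
  proof -
    obtain c where c: "t p q * r * t p q = c *\<^sub>C t p q" using scalar by blast
    have "t p q * r = r" using projection_le_sym[OF r(1) proj] r by simp
    then have rc: "r = c *\<^sub>C t p q" using c r by simp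
    then have "(c * c) *\<^sub>C t p q = c *\<^sub>C t p q"
      using r(1) proj by (simp add: is_projection_def mult_scaleC_left mult_scaleC_right)
    then have "c = 0 \<or> c = 1" using \<open>t p q \<noteq> 0\<close> by auto
    then show ?thesis using rc by (auto simp: scaleC_one)
  qed
  then show ?thesis using proj \<open>t p q \<noteq> 0\<close> by (simp add: minimal_projection_in_def)
qed

end

text \<open>By diagonalisation the minimal projections span the algebra, so a linear functional is
  determined by its values on them.\<close>

lemma linear_functional_eq_tr:
  fixes x :: "'a::fd_cstar_algebra"
  assumes lin: "clinear_on UNIV \<phi>" and min: "\<And>p. minimal_projection_in UNIV p \<Longrightarrow> \<phi> p = c"
  shows "\<phi> x = c * tr x"
proof -
  note simps = clinear_on_UNIV_simps[OF lin, unfolded scaleC_complex_def]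
  have sa: "\<phi> a = c * tr a" if a: "star a = a" for a
  proof -
    obtain R d where R: "frame 1 R" "a = (\<Sum>r\<in>R. d r *\<^sub>R r)"
      using diagonalize[OF is_projection_1 a] by (metis UNIV_I corner_one)
    have "\<phi> a = (\<Sum>r\<in>R. \<phi> (d r *\<^sub>R r))"
      unfolding R(2) by (rule clinear_on_sum[OF lin]) simp_all
    also have "\<dots> = (\<Sum>r\<in>R. c * complex_of_real (d r))"
    proof (rule sum.cong[OF refl])
      fix r assume "r \<in> R"
      then have "\<phi> r = c" using R(1) by (intro min) (simp add: frame_def)
      then show "\<phi> (d r *\<^sub>R r) = c * complex_of_real (d r)"
        by (simp add: simps scaleR_conv_of_real mult.commute)
    qed
    also have "\<dots> = c * tr a"
      by (simp only: R(2) tr_frame_sum[OF R(1)] of_real_sum sum_distrib_left)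
    finally show ?thesis .
  qed
  obtain h k where "star h = h" "star k = k" "x = h + \<i> *\<^sub>C k" by (rule selfadjoint_decomp)
  then show ?thesis using sa by (simp add: simps tr_simps algebra_simps)
qed

text \<open>\<open>linear_functional_eq_tr\<close> is applied to one factor at a time: first in
  \<open>x\<close> with a minimal \<open>q\<close> on the right, then in the second factor for
  arbitrary \<open>x\<close>.\<close>

lemma tr_tensor:
  assumes t: "tensor_product t"
  shows "tr (t x y) = tr x * tr y"
proof -
  note lin = cbilinearD[OF tensor_bilinear[OF t]]
  have 1: "tr (t x q) = tr x" if q: "minimal_projection_in UNIV q" for x q
    using linear_functional_eq_tr[OF clinear_on_compose[OF clinear_on_tr lin(2)],
        OF tr_minimal[OF tensor_minimal[OF t _ q]]]
    by simp
  show ?thesis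
    by (rule linear_functional_eq_tr[OF clinear_on_compose[OF clinear_on_tr lin(1)] 1])
qed

text \<open>An element of \<open>corner (t e f)\<close> equals its own compression, and compression
  sends elementary tensors to elementary tensors of the two corners.\<close>

lemma tensor_set_corner:
  assumes t: "tensor_product t" and e: "is_projection e" "is_projection f"
  shows "tensor_set t (corner e) (corner f) = corner (t e f)"
proof
  note ef = tensor_projection[OF t e]
  show "tensor_set t (corner e) (corner f) \<subseteq> corner (t e f)"
    unfolding tensor_set_def
  proof (rule cvs.span_minimal[OF _ subspace_corner], clarify)
    fix x y assume "x \<in> corner e" "y \<in> corner f"
    then show "t x y \<in> corner (t e f)"
      using e ef by (simp add: corner_iff tensor_mult[OF t])
  qed
  show "corner (t e f) \<subseteq> tensor_set t (corner e) (corner f)"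
  proof
    fix z assume z: "z \<in> corner (t e f)"
    define W where "W = tensor_set t (corner e) (corner f)"
    have W: "cvs.subspace W" by (simp add: W_def tensor_set_def cvs.subspace_span)
    have "z \<in> {z. t e f * z * t e f \<in> W}"
    proof (rule tensor_subspace_UNIV[OF t])
      show "cvs.subspace {z. t e f * z * t e f \<in> W}"
        using W by (intro cvs.subspaceI)
          (auto simp: distrib_left distrib_right mult_scaleC_left mult_scaleC_right
            intro: cvs.subspace_0 cvs.subspace_add cvs.subspace_scale)
      show "t x y \<in> {z. t e f * z * t e f \<in> W}" for x y
      proof -
        have "t (e * x * e) (f * y * f) \<in> W"
          unfolding W_def tensor_set_def
          by (rule cvs.span_base)
            (intro CollectI exI[of _ "e * x * e"] exI[of _ "f * y * f"] conjI refl compress_in_corner)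
        then show ?thesis by (simp add: tensor_mult[OF t])
      qed
    qed
    then show "z \<in> tensor_set t (corner e) (corner f)"
      using z ef by (simp add: W_def corner_iff)
  qed
qed

lemma tensor_set_UNIV: "tensor_product t \<Longrightarrow> tensor_set t UNIV UNIV = UNIV"
  using tensor_span by (simp add: tensor_set_def)

lemma tensor_map_UNIV:
  fixes \<Phi> :: "'m::fd_cstar_algebra \<Rightarrow> 'p::fd_cstar_algebra"
    and \<Psi> :: "'n::fd_cstar_algebra \<Rightarrow> 'q::fd_cstar_algebra"
  assumes s: "tensor_product s" and t: "tensor_product t"
    and \<Phi>: "clinear_on UNIV \<Phi>" and \<Psi>: "clinear_on UNIV \<Psi>"
  shows "clinear_on UNIV (tensor_map s t UNIV UNIV \<Phi> \<Psi>)"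
    "tensor_map s t UNIV UNIV \<Phi> \<Psi> (s x y) = t (\<Phi> x) (\<Psi> y)"
proof -
  note lin = cbilinearD[OF tensor_bilinear[OF t]]
  have "cbilinear (\<lambda>x y. t (\<Phi> x) (\<Psi> y))"
    using clinear_on_compose[OF lin(1) \<Psi>] clinear_on_compose[OF lin(2) \<Phi>]
    by (simp add: cbilinear_def)
  from someI_ex[OF tensor_linear_ex[OF s this]]
  show "clinear_on UNIV (tensor_map s t UNIV UNIV \<Phi> \<Psi>)"
    "tensor_map s t UNIV UNIV \<Phi> \<Psi> (s x y) = t (\<Phi> x) (\<Psi> y)"
    by (simp_all add: tensor_map_def tensor_set_UNIV[OF s])
qed

text \<open>\<open>tensor_map\<close> is chosen separately for each pair of subalgebras; on the span
  of elementary tensors every such choice agrees with a global map.\<close>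

lemma tensor_map_restrict:
  assumes F: "clinear_on UNIV F" "\<And>x y. F (s x y) = t (\<Phi> x) (\<Psi> y)"
    and z: "z \<in> tensor_set s A B"
  shows "tensor_map s t A B \<Phi> \<Psi> z = F z"
proof -
  define W where "W = tensor_set s A B"
  define G where "G = tensor_map s t A B \<Phi> \<Psi>"
  have W: "cvs.subspace W" by (simp add: W_def tensor_set_def cvs.subspace_span)
  have "clinear_on W F \<and> (\<forall>x\<in>A. \<forall>y\<in>B. F (s x y) = t (\<Phi> x) (\<Psi> y))"
    using F by (simp add: clinear_on_def)
  then have "clinear_on W G \<and> (\<forall>x\<in>A. \<forall>y\<in>B. G (s x y) = t (\<Phi> x) (\<Psi> y))"
    unfolding G_def tensor_map_def W_def
    by (rule someI[where P = "\<lambda>F. clinear_on (tensor_set s A B) F \<and>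
      (\<forall>x\<in>A. \<forall>y\<in>B. F (s x y) = t (\<Phi> x) (\<Psi> y))"])
  then have G: "clinear_on W G" "\<And>x y. x \<in> A \<Longrightarrow> y \<in> B \<Longrightarrow> G (s x y) = t (\<Phi> x) (\<Psi> y)"
    by blast+
  have G0: "G 0 = 0"
    using G(1) cvs.subspace_0[OF W] unfolding clinear_on_def by (metis cvs.scale_zero_left)
  have "cvs.subspace {z \<in> W. G z = F z}"
  proof (rule cvs.subspaceI)
    show "0 \<in> {z \<in> W. G z = F z}"
      using G0 cvs.subspace_0[OF W] by (simp add: clinear_on_UNIV_simps[OF F(1)])
    show "x + y \<in> {z \<in> W. G z = F z}" if "x \<in> {z \<in> W. G z = F z}" "y \<in> {z \<in> W. G z = F z}" for x y
      using that G(1) cvs.subspace_add[OF W] by (simp add: clinear_on_UNIV_simps[OF F(1)] clinear_on_def)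
    show "c *\<^sub>C x \<in> {z \<in> W. G z = F z}" if "x \<in> {z \<in> W. G z = F z}" for c x
      using that G(1) cvs.subspace_scale[OF W] by (simp add: clinear_on_UNIV_simps[OF F(1)] clinear_on_def)
  qed
  moreover have "{s x y | x y. x \<in> A \<and> y \<in> B} \<subseteq> {z \<in> W. G z = F z}"
    using G(2) F(2) by (auto simp: W_def tensor_set_def intro: cvs.span_base)
  ultimately have "W \<subseteq> {z \<in> W. G z = F z}"
    unfolding W_def tensor_set_def by (intro cvs.span_minimal)
  then show ?thesis using z by (auto simp: W_def G_def)
qed

text \<open>A chosen \<open>tensor_map\<close> has arbitrary values off its domain, so maps can be
  compared only on states.\<close>

lemma capacity_cong:
  assumes "\<And>a. a \<in> states A \<Longrightarrow> F a = G a"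
  shows "capacity A B F = capacity A B G"
  unfolding capacity_def
proof (rule SUP_cong[OF refl])
  fix a assume a: "a \<in> states A"
  have "(\<Sum>i<n. l i * entropy B (F (x i))) = (\<Sum>i<n. l i * entropy B (G (x i)))"
    if "\<forall>i<n. 0 \<le> l i \<and> x i \<in> states A" for n :: nat and l x
    using that assms by (intro sum.cong) auto
  then show "capacity_at A B F a = capacity_at A B G a"
    unfolding capacity_at_def assms[OF a]
    by (intro arg_cong[where f = Sup] Collect_cong ex_cong1) auto
qed

theorem corollary5:
  fixes \<Phi> :: "'m::fd_cstar_algebra \<Rightarrow> 'p::fd_cstar_algebra"
    and \<Psi> :: "'n::fd_cstar_algebra \<Rightarrow> 'q::fd_cstar_algebra"
    and s :: "'m \<Rightarrow> 'n \<Rightarrow> 'mn::fd_cstar_algebra"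
    and t :: "'p \<Rightarrow> 'q \<Rightarrow> 'pq::fd_cstar_algebra"
    and I :: "'i set" and e :: "'i \<Rightarrow> 'm"
    and J :: "'j set" and f :: "'j \<Rightarrow> 'n"
  assumes "tensor_product s" and "tensor_product t"
    and "positive_map_on UNIV UNIV \<Phi>" and "\<Phi> 1 = 1" and "trace_preserving_on UNIV UNIV \<Phi>"
    and "positive_map_on UNIV UNIV \<Psi>" and "\<Psi> 1 = 1" and "trace_preserving_on UNIV UNIV \<Psi>"
    and "positive_map_on UNIV UNIV (tensor_map s t UNIV UNIV \<Phi> \<Psi>)"
    and "finite I" and "\<And>i. i \<in> I \<Longrightarrow> is_projection (e i)" and "(\<Sum>i\<in>I. e i) = 1"
    and "finite J" and "\<And>j. j \<in> J \<Longrightarrow> is_projection (f j)" and "(\<Sum>j\<in>J. f j) = 1"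
    and "\<And>i. i \<in> I \<Longrightarrow> is_projection (\<Phi> (e i))"
    and "\<And>j. j \<in> J \<Longrightarrow> is_projection (\<Psi> (f j))"
    and "\<And>i j. i \<in> I \<Longrightarrow> j \<in> J \<Longrightarrow>
      capacity (tensor_set s (corner (e i)) (corner (f j)))
        (tensor_set t (corner (\<Phi> (e i))) (corner (\<Psi> (f j))))
        (tensor_map s t (corner (e i)) (corner (f j)) \<Phi> \<Psi>)
      = capacity (corner (e i)) (corner (\<Phi> (e i))) \<Phi>
        + capacity (corner (f j)) (corner (\<Psi> (f j))) \<Psi>"
  shows "capacity UNIV UNIV (tensor_map s t UNIV UNIV \<Phi> \<Psi>)
    = capacity UNIV UNIV \<Phi> + capacity UNIV UNIV \<Psi>"
proof -
  note s = assms(1) and t = assms(2)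
  note I = assms(10,11,12,16) and J = assms(13,14,15,17)
  interpret \<Phi>: channel \<Phi> using assms(3,4,5) by unfold_locales
  interpret \<Psi>: channel \<Psi> using assms(6,7,8) by unfold_locales
  define F where "F = tensor_map s t UNIV UNIV \<Phi> \<Psi>"
  have F: "clinear_on UNIV F" "\<And>x y. F (s x y) = t (\<Phi> x) (\<Psi> y)"
    unfolding F_def by (rule tensor_map_UNIV[OF s t \<Phi>.linear \<Psi>.linear])+
  \<comment> \<open>Positivity of \<Phi> \<otimes> \<Psi> enters here. Trace preservation is checked
    on elementary tensors, where the trace is multiplicative.\<close>
  interpret F: channel F
  proof
    show "positive_map_on UNIV UNIV F" using assms(9) by (simp add: F_def)
    show "F 1 = 1"
      using F(2)[of 1 1] by (simp add: tensor_one[OF s] tensor_one[OF t] assms(4,7))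
    have "tr (F z) = tr z" for z
      by (rule tensor_linear_eqI[OF s clinear_on_compose[OF clinear_on_tr F(1)] clinear_on_tr])
        (simp add: F(2) tr_tensor[OF s] tr_tensor[OF t] \<Phi>.map_tr \<Psi>.map_tr)
    then show "trace_preserving_on UNIV UNIV F" by (simp add: trace_preserving_on_def)
  qed
  define E where "E = (\<lambda>(i, j). s (e i) (f j))"
  have E1: "(\<Sum>k\<in>I \<times> J. E k) = 1"
  proof -
    have "(\<Sum>k\<in>I \<times> J. E k) = (\<Sum>i\<in>I. \<Sum>j\<in>J. s (e i) (f j))"
      by (simp add: E_def sum.cartesian_product)
    also have "\<dots> = s (\<Sum>i\<in>I. e i) (\<Sum>j\<in>J. f j)"
      unfolding cbilinear_sum(1)[OF tensor_bilinear[OF s]] cbilinear_sum(2)[OF tensor_bilinear[OF s]]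
      by (rule sum.swap)
    finally show ?thesis by (simp add: I(3) J(3) tensor_one[OF s])
  qed
  have cap: "exp_capacity (capacity (corner (E (i, j))) (corner (F (E (i, j)))) F)
      = exp_capacity (capacity (corner (e i)) (corner (\<Phi> (e i))) \<Phi>)
        * exp_capacity (capacity (corner (f j)) (corner (\<Psi> (f j))) \<Psi>)"
    if ij: "i \<in> I" "j \<in> J" for i j
  proof -
    have p: "is_projection (s (e i) (f j))"
      by (rule tensor_projection[OF s I(2)[OF ij(1)] J(2)[OF ij(2)]])
    have A: "tensor_set s (corner (e i)) (corner (f j)) = corner (s (e i) (f j))"
      by (rule tensor_set_corner[OF s I(2)[OF ij(1)] J(2)[OF ij(2)]])
    have B: "tensor_set t (corner (\<Phi> (e i))) (corner (\<Psi> (f j))) = corner (t (\<Phi> (e i)) (\<Psi> (f j)))"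
      by (rule tensor_set_corner[OF t I(4)[OF ij(1)] J(4)[OF ij(2)]])
    \<comment> \<open>The additivity hypothesis speaks of the map chosen on the tensor product of
      the corners, not of \<open>F\<close>; on states the two coincide.\<close>
    have "capacity (corner (s (e i) (f j))) (corner (F (s (e i) (f j)))) F
        = capacity (corner (s (e i) (f j))) (corner (F (s (e i) (f j))))
          (tensor_map s t (corner (e i)) (corner (f j)) \<Phi> \<Psi>)"
    proof (rule capacity_cong)
      fix a assume "a \<in> states (corner (s (e i) (f j)))"
      then have "a \<in> tensor_set s (corner (e i)) (corner (f j))" by (simp add: states_corner[OF p] A)
      then show "F a = tensor_map s t (corner (e i)) (corner (f j)) \<Phi> \<Psi> a"
        using tensor_map_restrict[of F s t \<Phi> \<Psi>, OF F] by simp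
    qed
    also have "\<dots> = capacity (corner (e i)) (corner (\<Phi> (e i))) \<Phi>
        + capacity (corner (f j)) (corner (\<Psi> (f j))) \<Psi>"
      using assms(18)[OF ij] by (simp add: A B F(2))
    finally show ?thesis
      using \<Phi>.capacity_not_PInf[OF I(2,4), OF ij(1) ij(1)] \<Psi>.capacity_not_PInf[OF J(2,4), OF ij(2) ij(2)]
      by (simp add: E_def exp_capacity_add)
  qed
  have E: "is_projection (E k)" "is_projection (F (E k))" if "k \<in> I \<times> J" for k
    using that tensor_projection[OF s I(2) J(2)] tensor_projection[OF t I(4) J(4)]
    by (auto simp: E_def F(2))
  \<comment> \<open>Excluding \<open>\<infinity>\<close> is what makes \<open>exp_capacity\<close>
    multiplicative and injective.\<close>
  have fin: "capacity UNIV UNIV F \<noteq> \<infinity>" "capacity UNIV UNIV \<Phi> \<noteq> \<infinity>" "capacity UNIV UNIV \<Psi> \<noteq> \<infinity>"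
    unfolding F.capacity_UNIV \<Phi>.capacity_UNIV \<Psi>.capacity_UNIV
    by (rule F.capacity_not_PInf \<Phi>.capacity_not_PInf \<Psi>.capacity_not_PInf;
      simp add: F.unital \<Phi>.unital \<Psi>.unital)+
  have "exp_capacity (capacity UNIV UNIV F)
      = (\<Sum>k\<in>I \<times> J. exp_capacity (capacity (corner (E k)) (corner (F (E k))) F))"
    using I(1) J(1) by (intro F.exp_capacity_sum E E1) auto
  also have "\<dots> = (\<Sum>i\<in>I. \<Sum>j\<in>J. exp_capacity (capacity (corner (e i)) (corner (\<Phi> (e i))) \<Phi>)
        * exp_capacity (capacity (corner (f j)) (corner (\<Psi> (f j))) \<Psi>))"
    by (subst sum.cartesian_product) (auto intro!: sum.cong simp: cap)
  also have "\<dots> = exp_capacity (capacity UNIV UNIV \<Phi>) * exp_capacity (capacity UNIV UNIV \<Psi>)"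
    by (simp add: \<Phi>.exp_capacity_sum[OF I] \<Psi>.exp_capacity_sum[OF J] sum_product)
  also have "\<dots> = exp_capacity (capacity UNIV UNIV \<Phi> + capacity UNIV UNIV \<Psi>)"
    using fin by (simp add: exp_capacity_add)
  finally show ?thesis
    using fin by (intro exp_capacity_inj) (auto simp: F_def)
qed

end
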